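(* Let $n\ge 0$ be an integer. (1) Let $R$ be a commutative ring and $B=R^{\mathrm{mon}}$. Then the usual exterior algebra $\bigwedge R^n$ is canonically isomorphic to $(\bigwedge B^n)^{\mathrm{hull},+}$ as an $R$-algebra, i.e. there is an isomorphism of $R$-algebras between them matching $e_i$ with the class of $e_i$ for every $i\in\{1,\dots,n\}$. (2) Let $S$ be an idempotent semifield and $B=S^{\mathrm{mon}}$. Then the Giansiracusa exterior algebra (tropical Grassmann algebra) $\bigwedge S^n$ is canonically isomorphic to $(\bigwedge B^n)^{\mathrm{idem},+}$ as an $S$-algebra, i.e. there is an isomorphism of $S$-algebras between them matching $e_i$ with the class of $e_i$ for every $i\in\{1,\dots,n\}$.
   Context: **Ordered blueprints.** Semirings are commutative with $0$ and $1$ unless otherwise stated. An ordered semiring is a semiring with a partial order compatible with addition and multiplication ($a\le b$ implies $a+z\le b+z$ and $az\le bz$). An ordered blueprint is $B=(B^\bullet,B^+,\le)$ where $(B^+,\le)$ is an ordered semiring and $B^\bullet\subseteq B^+$ is a multiplicative submonoid containing $0$ and $1$ such that every element of $B^+$ is a finite sum of elements of $B^\bullet$. An $\mathbb{F}_1^{\pm}$-algebra is an ordered blueprint $B$ with a distinguished element $\epsilon\in B^\bullet$ such that $\epsilon^2=1$ and $0\le 1+\epsilon$. If $\mathfrak r$ is a preorder on $B^+$ compatible with addition and multiplication and containing $\le$, the quotient $B/\!\!/\mathfrak r$ has ambient semiring $B^+$ modulo the congruence "$x\le_{\mathfrak r}y$ and $y\le_{\mathfrak r}x$", the partial order induced by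 $\mathfrak r$, and underlying monoid the image of $B^\bullet$. For a set $H$ of pairs, $B/\!\!/\langle H\rangle$ is the quotient by the smallest such preorder containing $H$; a pair written $a\equiv b$ means both $a\le b$ and $b\le a$. **Monomial blueprints.** For a pointed monoid $D$ with absorbing element $0_D$, let $\widetilde D=\mathbb N[D]/\langle 0\equiv 1.0_D\rangle$ (finite formal sums of non-zero elements of $D$, with $1.d$ denoting the element $d$), and $D/\!\!/\langle H\rangle:=(D,\widetilde D,=)/\!\!/\langle H\rangle$ for $H\subseteq\widetilde D\times\widetilde D$. For a ring $R$ with multiplicative monoid $R^\bullet$, $R^{\mathrm{mon}}=R^\bullet/\!\!/\langle 1.b\le\sum 1.a_i \mid b=\sum a_i\text{ in }R\rangle$, an $\mathbb F_1^\pm$-algebra with $\epsilon=1.(-1)$. An idempotent semifield is a semiring $S$ with $0\neq1$, $1+1=1$ and every non-zero element invertible. With $S^\bullet$ its multiplicative monoid, $S^{\mathrm{mon}}=S^\bullet/\!\!/\langle\Omega_S\rangle$, where $\Omega_S$ is the set of relations $1.b\le\sum_{i=1}^m1.a_i$ such that $\sum_{i=1}^m a_i=b+\sum_{i\ne k}a_i$ in $S$ for every $k\in\{1,\dots,m\}$; it is an $\mathbb F_1^\pm$-algebra with $\epsilon=1.1$. **$B$-modules.** An (ordered blue) $B$-module is $M=(M^\bullet,M^+,\le)$ where $M^+$ is a $B^+$-(semi)module, $\le$ is a partial order on $M^+$ compatible with addition and such that $b_1\le b_2$, $m_1\le m_2$ imply $b_1m_1\le b_2m_2$, and $M^\bullet\subseteq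 M^+$ contains $0$, is stable under $B^\bullet$, and generates $M^+$ as a semigroup. An additive $B$-preorder on $M$ is a preorder $\mathfrak r$ on $M^+$ compatible with addition, containing $\le$, with $b_1m_1\le_{\mathfrak r}b_2m_2$ whenever $b_1\le b_2$ and $m_1\le_{\mathfrak r}m_2$; the quotient $M/\!\!/\mathfrak r$ is $M^+$ modulo "$x\le_{\mathfrak r}y$ and $y\le_{\mathfrak r}x$", with induced order and with underlying set the image of $M^\bullet$. $B^n=((B^\bullet)^n,(B^+)^n,\le)$ has the coordinatewise order and canonical basis $e_1,\dots,e_n$. **Hull and idem.** $B^{\mathrm{hull}}=B/\!\!/\langle a\equiv b\mid a\le b\rangle$ and $B^{\mathrm{idem}}=B/\!\!/\langle 1\equiv1+1\rangle$. For a $B$-module $M$, $M^{\mathrm{hull}}$ is the quotient by the smallest additive $B$-preorder containing all $(x,y)$ with $x\le y$ or $y\le x$, and $M^{\mathrm{idem}}$ is the quotient by the smallest additive $B$-preorder containing $(m,m+m)$ and $(m+m,m)$ for all $m\in M^+$. The superscript "$,+$" means the ambient semiring or module of the result. For $M=\bigwedge B^n$, the quotients $M^{\mathrm{hull},+}$, $M^{\mathrm{idem},+}$ carry the product induced by $\wedge$, and are algebras over $R\cong (R^{\mathrm{mon}})^{\mathrm{hull},+}$ (resp. $S\cong (S^{\mathrm{mon}})^{\mathrm{idem},+}$), where $r$ corresponds to the class of $1.r$. **Tensor algebra.** $M_1\otimes_B M_2$: on the tensor product $M_1^+\otimes_{B^+}M_2^+$ of semimodules (universal for $B^+$-bilinear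 maps), take the smallest preorder $\mathfrak r$ compatible with addition and with the action of $(B^+,\le)$ (i.e. such that $b_1z_1\le_{\mathfrak r}b_2z_2$ whenever $b_1\le b_2$ in $B^+$ and $z_1\le_{\mathfrak r}z_2$) containing $x_1\otimes y_1\le x_2\otimes y_2$ whenever $x_1\le x_2$, $y_1\le y_2$; the ambient module is the quotient by the associated equivalence with the induced order, and the underlying set consists of the classes of $m_1\otimes m_2$, $m_i\in M_i^\bullet$. $T(B^n)=\bigoplus_{l\ge0}(B^n)^{\otimes l}$ with $(B^n)^{\otimes0}=B$ and componentwise order; concatenation makes it a (typically non-commutative) $B$-algebra. **Exterior algebra over an $\mathbb F_1^\pm$-algebra.** Let $\tau_n=\{e_i\otimes e_i\equiv0: i\in[n]\}\cup\{e_i\otimes e_j\equiv\epsilon\,e_j\otimes e_i: i\neq j\}$, where $[n]=\{1,\dots,n\}$. Let $\langle\tau_n\rangle$ be the smallest preorder on $T(B^n)^+$ compatible with addition and left and right multiplication, containing the order of $T(B^n)$ and the relations $\tau_n$ in both directions. Let $A_n$ be the quotient of $T(B^n)^+$ by the associated equivalence, with induced order and product $\wedge$. For $I=\{i_1<\dots<i_d\}\subseteq[n]$ let $e_I=e_{i_1}\wedge\dots\wedge e_{i_d}$ ($e_\emptyset=1$), and $H_{d,n}=\{\sum_{|I|=d}b_Ie_I: b_I\in B^\bullet\}$. The exterior algebra is the $B$-module $\bigwedge B^n=(\bigcup_{l=0}^nH_{l,n},A_n,\le)$. **Giansiracusa exterior algebra.** For an idempotent semifield $S$, $\bigwedge S^n=\mathrm{Sym}(S^n)/\langle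 e_i^2\equiv0: i\in[n]\rangle$ (quotient of the symmetric $S$-algebra, i.e. polynomial semiring in $e_1,\dots,e_n$, by the congruence generated by these relations), a graded $S$-algebra. *)

theory Defs
  imports "HOL-Library.Multiset" "HOL-Algebra.QuotRing" "HOL-Algebra.Module"
begin

section \<open>Ordered blueprints, ordered modules and their quotients\<close>

text \<open>
  Semirings are carried by the ring records of HOL-Algebra and semimodules by its module records.
  Preorders and congruences are relations contained in the square of the carrier. In a module
  record that is not an algebra the fields \<open>mult\<close> and \<open>one\<close> carry no information
  and are set to \<open>undefined\<close>.

  A quotient by a preorder \<open>r\<close> consists of the classes of the equivalence \<open>r \<inter> r\<inverse>\<close>; an induced
  operation is the union of the classes of the results on all representatives, which is a single
  class whenever \<open>r\<close> is compatible with the operation.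
\<close>

record 'b oblueprint = "'b ring" +
  bpts :: "'b set"
  ble :: "('b \<times> 'b) set"

record 'b f1pm_algebra = "'b oblueprint" +
  eps :: 'b

record ('b, 'm) omodule = "('b, 'm) module" +
  mle :: "('m \<times> 'm) set"

record ('b, 'm) blue_module = "('b, 'm) omodule" +
  mpts :: "'m set"

definition cls :: "('a \<times> 'a) set \<Rightarrow> 'a \<Rightarrow> 'a set"
  where "cls r x = {y. (x, y) \<in> r \<and> (y, x) \<in> r}"

definition lift1 :: "('a \<times> 'a) set \<Rightarrow> ('a \<Rightarrow> 'a) \<Rightarrow> 'a set \<Rightarrow> 'a set"
  where "lift1 r f X = (\<Union>x\<in>X. cls r (f x))"

definition lift2 :: "('a \<times> 'a) set \<Rightarrow> ('a \<Rightarrow> 'a \<Rightarrow> 'a) \<Rightarrow> 'a set \<Rightarrow> 'a set \<Rightarrow> 'a set"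
  where "lift2 r f X Y = (\<Union>x\<in>X. \<Union>y\<in>Y. cls r (f x y))"

definition ring_quot :: "('a, 'z) ring_scheme \<Rightarrow> ('a \<times> 'a) set \<Rightarrow> 'a set ring"
  where "ring_quot A r =
    \<lparr>carrier = cls r ` carrier A, mult = lift2 r (mult A), one = cls r \<one>\<^bsub>A\<^esub>,
     zero = cls r \<zero>\<^bsub>A\<^esub>, add = lift2 r (add A)\<rparr>"

definition module_quot :: "('k, 'm, 'z) module_scheme \<Rightarrow> ('m \<times> 'm) set \<Rightarrow> ('k, 'm set) module"
  where "module_quot M r =
    ring.extend (ring_quot M r) (module.fields (\<lambda>b. lift1 r (smult M b)))"

definition omodule_quot :: "('k, 'm, 'z) module_scheme \<Rightarrow> ('m \<times> 'm) set \<Rightarrow> ('k, 'm set) omodule"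
  where "omodule_quot M r =
    module.extend (module_quot M r) (omodule.fields ((\<lambda>(x, y). (cls r x, cls r y)) ` r))"

definition blue_quot :: "('b, 'z) oblueprint_scheme \<Rightarrow> ('b \<times> 'b) set \<Rightarrow> 'b set oblueprint"
  where "blue_quot B r =
    ring.extend (ring_quot B r)
      (oblueprint.fields (cls r ` bpts B) ((\<lambda>(x, y). (cls r x, cls r y)) ` r))"

definition blue_module_quot ::
    "('b, 'm, 'z) blue_module_scheme \<Rightarrow> ('m \<times> 'm) set \<Rightarrow> ('b, 'm set) blue_module"
  where "blue_module_quot M r =
    omodule.extend (omodule_quot M r) (blue_module.fields (cls r ` mpts M))"

definition add_compat :: "('a, 'z) ring_scheme \<Rightarrow> ('a \<times> 'a) set \<Rightarrow> bool"
  where "add_compat A r \<longleftrightarrow>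
    (\<forall>(x, y)\<in>r. \<forall>z\<in>carrier A. (x \<oplus>\<^bsub>A\<^esub> z, y \<oplus>\<^bsub>A\<^esub> z) \<in> r)"

definition mult_compat :: "('a, 'z) ring_scheme \<Rightarrow> ('a \<times> 'a) set \<Rightarrow> bool"
  where "mult_compat A r \<longleftrightarrow>
    (\<forall>(x, y)\<in>r. \<forall>z\<in>carrier A.
      (x \<otimes>\<^bsub>A\<^esub> z, y \<otimes>\<^bsub>A\<^esub> z) \<in> r \<and> (z \<otimes>\<^bsub>A\<^esub> x, z \<otimes>\<^bsub>A\<^esub> y) \<in> r)"

definition gen_ring_preorder ::
    "('a, 'z) ring_scheme \<Rightarrow> ('a \<times> 'a) set \<Rightarrow> ('a \<times> 'a) set \<Rightarrow> ('a \<times> 'a) set"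
  where "gen_ring_preorder A L H =
    \<Inter>{r. preorder_on (carrier A) r \<and> add_compat A r \<and> mult_compat A r \<and> L \<subseteq> r \<and> H \<subseteq> r}"

definition gen_ring_congruence ::
    "('a, 'z) ring_scheme \<Rightarrow> ('a \<times> 'a) set \<Rightarrow> ('a \<times> 'a) set"
  where "gen_ring_congruence A H =
    \<Inter>{r. equiv (carrier A) r \<and> add_compat A r \<and> mult_compat A r \<and> H \<subseteq> r}"

definition blue_quot_gen ::
    "('b, 'z) oblueprint_scheme \<Rightarrow> ('b \<times> 'b) set \<Rightarrow> 'b set oblueprint"
  where "blue_quot_gen B H = blue_quot B (gen_ring_preorder B (ble B) H)"

definition additive_preorder ::
    "('b, 'z) oblueprint_scheme \<Rightarrow> ('b, 'm, 'y) omodule_scheme \<Rightarrow> ('m \<times> 'm) set \<Rightarrow> bool"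
  where "additive_preorder B M r \<longleftrightarrow>
    preorder_on (carrier M) r \<and> add_compat M r \<and> mle M \<subseteq> r \<and>
    (\<forall>(b1, b2)\<in>ble B. \<forall>(x1, x2)\<in>r. (b1 \<odot>\<^bsub>M\<^esub> x1, b2 \<odot>\<^bsub>M\<^esub> x2) \<in> r)"

definition gen_additive_preorder ::
    "('b, 'z) oblueprint_scheme \<Rightarrow> ('b, 'm, 'y) omodule_scheme \<Rightarrow> ('m \<times> 'm) set \<Rightarrow> ('m \<times> 'm) set"
  where "gen_additive_preorder B M H = \<Inter>{r. additive_preorder B M r \<and> H \<subseteq> r}"


section \<open>Hull and idem\<close>

definition hull_rel :: "('b, 'z) oblueprint_scheme \<Rightarrow> ('b \<times> 'b) set"
  where "hull_rel B = gen_ring_preorder B (ble B) (ble B \<union> (ble B)\<inverse>)"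

definition blue_hull :: "('b, 'z) oblueprint_scheme \<Rightarrow> 'b set oblueprint"
  where "blue_hull B = blue_quot B (hull_rel B)"

definition idem_rel :: "('b, 'z) oblueprint_scheme \<Rightarrow> ('b \<times> 'b) set"
  where "idem_rel B = gen_ring_preorder B (ble B)
    {(\<one>\<^bsub>B\<^esub>, \<one>\<^bsub>B\<^esub> \<oplus>\<^bsub>B\<^esub> \<one>\<^bsub>B\<^esub>), (\<one>\<^bsub>B\<^esub> \<oplus>\<^bsub>B\<^esub> \<one>\<^bsub>B\<^esub>, \<one>\<^bsub>B\<^esub>)}"

definition blue_idem :: "('b, 'z) oblueprint_scheme \<Rightarrow> 'b set oblueprint"
  where "blue_idem B = blue_quot B (idem_rel B)"

definition module_hull_rel ::
    "('b, 'z) oblueprint_scheme \<Rightarrow> ('b, 'm, 'y) omodule_scheme \<Rightarrow> ('m \<times> 'm) set"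
  where "module_hull_rel B M = gen_additive_preorder B M (mle M \<union> (mle M)\<inverse>)"

definition module_hull ::
    "('b, 'z) oblueprint_scheme \<Rightarrow> ('b, 'm, 'y) blue_module_scheme \<Rightarrow> ('b, 'm set) blue_module"
  where "module_hull B M = blue_module_quot M (module_hull_rel B M)"

definition module_idem_rel ::
    "('b, 'z) oblueprint_scheme \<Rightarrow> ('b, 'm, 'y) omodule_scheme \<Rightarrow> ('m \<times> 'm) set"
  where "module_idem_rel B M = gen_additive_preorder B M
    ((\<lambda>m. (m, m \<oplus>\<^bsub>M\<^esub> m)) ` carrier M \<union> (\<lambda>m. (m \<oplus>\<^bsub>M\<^esub> m, m)) ` carrier M)"

definition module_idem ::
    "('b, 'z) oblueprint_scheme \<Rightarrow> ('b, 'm, 'y) blue_module_scheme \<Rightarrow> ('b, 'm set) blue_module"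
  where "module_idem B M = blue_module_quot M (module_idem_rel B M)"

text \<open>
  \<open>along_quot f M\<close> turns a \<open>B\<^sup>+\<close>-module \<open>M\<close>, whose elements are classes and on which the
  action factors through a quotient \<open>Q\<close> of \<open>B\<^sup>+\<close>, into a \<open>K\<close>-module along \<open>f : K \<rightarrow> Q\<close>: the scalar
  \<open>k\<close> acts by any representative \<open>b \<in> f k\<close>. Since \<open>b \<odot> X\<close> is the same class for all of them, it
  is their union. Only the ambient module (with its product) is retained.
\<close>

definition along_quot ::
    "('k \<Rightarrow> 'b set) \<Rightarrow> ('b, 'm set, 'z) module_scheme \<Rightarrow> ('k, 'm set) module"
  where "along_quot f M =
    \<lparr>carrier = carrier M, mult = mult M, one = \<one>\<^bsub>M\<^esub>, zero = \<zero>\<^bsub>M\<^esub>, add = add M,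
     smult = (\<lambda>k X. \<Union>b\<in>f k. b \<odot>\<^bsub>M\<^esub> X)\<rparr>"


section \<open>Monomial blueprints\<close>

text \<open>
  Here \<open>D\<close> is a pointed monoid with absorbing element \<open>z\<close>. Finite formal sums of non-zero elements
  are multisets; the class \<open>1.d\<close> is the singleton \<open>{#d#}\<close>, except that \<open>1.z\<close> is the empty sum.
\<close>

definition formal :: "'d \<Rightarrow> 'd \<Rightarrow> 'd multiset"
  where "formal z d = (if d = z then {#} else {#d#})"

definition monoid_blue :: "('d, 'x) monoid_scheme \<Rightarrow> 'd \<Rightarrow> 'd multiset oblueprint"
  where "monoid_blue D z =
    \<lparr>carrier = {X. set_mset X \<subseteq> carrier D - {z}},
     mult = (\<lambda>X Y. \<Sum>x\<in>#X. \<Sum>y\<in>#Y. formal z (x \<otimes>\<^bsub>D\<^esub> y)),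
     one = formal z \<one>\<^bsub>D\<^esub>,
     zero = {#},
     add = (+),
     bpts = formal z ` carrier D,
     ble = Id_on {X. set_mset X \<subseteq> carrier D - {z}}\<rparr>"

definition ring_mon_rels :: "('r, 'x) ring_scheme \<Rightarrow> ('r multiset \<times> 'r multiset) set"
  where "ring_mon_rels R =
    {(formal \<zero>\<^bsub>R\<^esub> (\<Oplus>\<^bsub>R\<^esub>i\<in>{1..m}. a i), \<Sum>i\<in>{1..m}. formal \<zero>\<^bsub>R\<^esub> (a i)) | (m::nat) a.
      a \<in> {1..m} \<rightarrow> carrier R}"

definition semifield_mon_rels :: "('s, 'x) ring_scheme \<Rightarrow> ('s multiset \<times> 's multiset) set"
  where "semifield_mon_rels S =
    {(formal \<zero>\<^bsub>S\<^esub> b, \<Sum>i\<in>{1..m}. formal \<zero>\<^bsub>S\<^esub> (a i)) | b (m::nat) a.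
      1 \<le> m \<and> b \<in> carrier S \<and> a \<in> {1..m} \<rightarrow> carrier S \<and>
      (\<forall>k\<in>{1..m}. (\<Oplus>\<^bsub>S\<^esub>i\<in>{1..m}. a i) = b \<oplus>\<^bsub>S\<^esub> (\<Oplus>\<^bsub>S\<^esub>i\<in>{1..m} - {k}. a i))}"

text \<open>
  For \<open>m = 0\<close> the condition on \<open>k\<close> above is vacuous and would give \<open>1.b \<le> 0\<close> for every \<open>b\<close>; a sum
  \<open>a\<^sub>1 + \<dots> + a\<^sub>m\<close> is therefore understood to have at least one term.
\<close>

definition mon_elt ::
    "('d, 'x) ring_scheme \<Rightarrow> ('d multiset \<times> 'd multiset) set \<Rightarrow> 'd \<Rightarrow> 'd multiset set"
  where "mon_elt D H d =
    cls (gen_ring_preorder (monoid_blue D \<zero>\<^bsub>D\<^esub>) (ble (monoid_blue D \<zero>\<^bsub>D\<^esub>)) H) (formal \<zero>\<^bsub>D\<^esub> d)"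

definition ring_mon :: "('r, 'x) ring_scheme \<Rightarrow> 'r multiset set f1pm_algebra"
  where "ring_mon R =
    oblueprint.extend (blue_quot_gen (monoid_blue R \<zero>\<^bsub>R\<^esub>) (ring_mon_rels R))
      (f1pm_algebra.fields (mon_elt R (ring_mon_rels R) (\<ominus>\<^bsub>R\<^esub> \<one>\<^bsub>R\<^esub>)))"

definition semifield_mon :: "('s, 'x) ring_scheme \<Rightarrow> 's multiset set f1pm_algebra"
  where "semifield_mon S =
    oblueprint.extend (blue_quot_gen (monoid_blue S \<zero>\<^bsub>S\<^esub>) (semifield_mon_rels S))
      (f1pm_algebra.fields (mon_elt S (semifield_mon_rels S) \<one>\<^bsub>S\<^esub>))"

definition idempotent_semifield :: "('s, 'x) ring_scheme \<Rightarrow> bool"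
  where "idempotent_semifield S \<longleftrightarrow>
    semiring S \<and> comm_monoid S \<and> \<zero>\<^bsub>S\<^esub> \<noteq> \<one>\<^bsub>S\<^esub> \<and> \<one>\<^bsub>S\<^esub> \<oplus>\<^bsub>S\<^esub> \<one>\<^bsub>S\<^esub> = \<one>\<^bsub>S\<^esub> \<and>
    carrier S - {\<zero>\<^bsub>S\<^esub>} \<subseteq> Units S"


section \<open>Tensor products and the tensor algebra\<close>

definition regular_module :: "('b, 'z) oblueprint_scheme \<Rightarrow> ('b, 'b) blue_module"
  where "regular_module B =
    \<lparr>carrier = carrier B, mult = undefined, one = undefined, zero = \<zero>\<^bsub>B\<^esub>, add = add B,
     smult = mult B, mle = ble B, mpts = bpts B\<rparr>"

definition free_module :: "('b, 'z) oblueprint_scheme \<Rightarrow> nat \<Rightarrow> ('b, nat \<Rightarrow> 'b) blue_module"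
  where "free_module B n =
    \<lparr>carrier = {1..n} \<rightarrow>\<^sub>E carrier B, mult = undefined, one = undefined,
     zero = (\<lambda>i\<in>{1..n}. \<zero>\<^bsub>B\<^esub>),
     add = (\<lambda>u v. \<lambda>i\<in>{1..n}. u i \<oplus>\<^bsub>B\<^esub> v i),
     smult = (\<lambda>b v. \<lambda>i\<in>{1..n}. b \<otimes>\<^bsub>B\<^esub> v i),
     mle = {(u, v). u \<in> {1..n} \<rightarrow>\<^sub>E carrier B \<and> v \<in> {1..n} \<rightarrow>\<^sub>E carrier B \<and>
                    (\<forall>i\<in>{1..n}. (u i, v i) \<in> ble B)},
     mpts = {1..n} \<rightarrow>\<^sub>E bpts B\<rparr>"

definition basis_vec :: "('b, 'z) oblueprint_scheme \<Rightarrow> nat \<Rightarrow> nat \<Rightarrow> nat \<Rightarrow> 'b"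
  where "basis_vec B n i = (\<lambda>j\<in>{1..n}. if j = i then \<one>\<^bsub>B\<^esub> else \<zero>\<^bsub>B\<^esub>)"

text \<open>
  The tensor product of semimodules is the free commutative monoid on pairs (multisets of pairs)
  modulo the congruence generated by the bilinearity relations.
\<close>

definition formal_tensors ::
    "('b, 'm, 'y) module_scheme \<Rightarrow> ('b, 'n, 'x) module_scheme \<Rightarrow> ('b, ('m \<times> 'n) multiset) module"
  where "formal_tensors M N =
    \<lparr>carrier = {X. set_mset X \<subseteq> carrier M \<times> carrier N}, mult = undefined, one = undefined,
     zero = {#}, add = (+), smult = (\<lambda>b. image_mset (\<lambda>(x, y). (b \<odot>\<^bsub>M\<^esub> x, y)))\<rparr>"

definition bilinear_rels ::
    "('b, 'z) oblueprint_scheme \<Rightarrow> ('b, 'm, 'y) module_scheme \<Rightarrow> ('b, 'n, 'x) module_scheme \<Rightarrow>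
     (('m \<times> 'n) multiset \<times> ('m \<times> 'n) multiset) set"
  where "bilinear_rels B M N =
    {({#(x \<oplus>\<^bsub>M\<^esub> x', y)#}, {#(x, y), (x', y)#}) | x x' y.
       x \<in> carrier M \<and> x' \<in> carrier M \<and> y \<in> carrier N} \<union>
    {({#(x, y \<oplus>\<^bsub>N\<^esub> y')#}, {#(x, y), (x, y')#}) | x y y'.
       x \<in> carrier M \<and> y \<in> carrier N \<and> y' \<in> carrier N} \<union>
    {({#(\<zero>\<^bsub>M\<^esub>, y)#}, {#}) | y. y \<in> carrier N} \<union>
    {({#(x, \<zero>\<^bsub>N\<^esub>)#}, {#}) | x. x \<in> carrier M} \<union>
    {({#(b \<odot>\<^bsub>M\<^esub> x, y)#}, {#(x, b \<odot>\<^bsub>N\<^esub> y)#}) | b x y.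
       b \<in> carrier B \<and> x \<in> carrier M \<and> y \<in> carrier N}"

definition tensor_cong ::
    "('b, 'z) oblueprint_scheme \<Rightarrow> ('b, 'm, 'y) module_scheme \<Rightarrow> ('b, 'n, 'x) module_scheme \<Rightarrow>
     (('m \<times> 'n) multiset \<times> ('m \<times> 'n) multiset) set"
  where "tensor_cong B M N =
    \<Inter>{E. equiv (carrier (formal_tensors M N)) E \<and> add_compat (formal_tensors M N) E \<and>
        bilinear_rels B M N \<subseteq> E}"

definition semitensor ::
    "('b, 'z) oblueprint_scheme \<Rightarrow> ('b, 'm, 'y) module_scheme \<Rightarrow> ('b, 'n, 'x) module_scheme \<Rightarrow>
     ('b, ('m \<times> 'n) multiset set) omodule"
  where "semitensor B M N =
    module.extend (module_quot (formal_tensors M N) (tensor_cong B M N))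
      (omodule.fields (Id_on (cls (tensor_cong B M N) ` carrier (formal_tensors M N))))"

definition tensor_preorder ::
    "('b, 'z) oblueprint_scheme \<Rightarrow> ('b, 'm, 'y) omodule_scheme \<Rightarrow> ('b, 'n, 'x) omodule_scheme \<Rightarrow>
     (('m \<times> 'n) multiset set \<times> ('m \<times> 'n) multiset set) set"
  where "tensor_preorder B M N =
    gen_additive_preorder B (semitensor B M N)
      {(cls (tensor_cong B M N) {#(x1, y1)#}, cls (tensor_cong B M N) {#(x2, y2)#}) | x1 y1 x2 y2.
         (x1, x2) \<in> mle M \<and> (y1, y2) \<in> mle N}"

definition tensor_class ::
    "('b, 'z) oblueprint_scheme \<Rightarrow> ('b, 'm, 'y) omodule_scheme \<Rightarrow> ('b, 'n, 'x) omodule_scheme \<Rightarrow>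
     ('m \<times> 'n) multiset \<Rightarrow> ('m \<times> 'n) multiset set set"
  where "tensor_class B M N X = cls (tensor_preorder B M N) (cls (tensor_cong B M N) X)"

definition tensor_product ::
    "('b, 'z) oblueprint_scheme \<Rightarrow> ('b, 'm, 'y) blue_module_scheme \<Rightarrow>
     ('b, 'n, 'x) blue_module_scheme \<Rightarrow> ('b, ('m \<times> 'n) multiset set set) blue_module"
  where "tensor_product B M N =
    omodule.extend (omodule_quot (semitensor B M N) (tensor_preorder B M N))
      (blue_module.fields ((\<lambda>p. tensor_class B M N {#p#}) ` (mpts M \<times> mpts N)))"

text \<open>
  The iterated tensor powers \<open>(B\<^sup>n)\<^sup>\<otimes>\<^sup>l\<close>, with \<open>(B\<^sup>n)\<^sup>\<otimes>\<^sup>0 = B\<close> and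
  \<open>(B\<^sup>n)\<^sup>\<otimes>\<^sup>l\<^sup>+\<^sup>1 = (B\<^sup>n)\<^sup>\<otimes>\<^sup>l \<otimes> B\<^sup>n\<close>, have a type depending on \<open>l\<close>. To put them into one type, the
  structure is transported along injections into the datatype below: a scalar is tagged, and an
  element of a tensor product is replaced by a chosen formal sum of pairs representing it.
\<close>

datatype 'b tensor =
    Scalar (the_scalar: 'b)
  | Formal_Sum (the_sum: "('b tensor \<times> (nat \<Rightarrow> 'b)) multiset")

definition Sum_of_class :: "('b tensor \<times> (nat \<Rightarrow> 'b)) multiset set set \<Rightarrow> 'b tensor"
  where "Sum_of_class C = Formal_Sum (SOME X. X \<in> \<Union>C)"

definition transport ::
    "('m \<Rightarrow> 'n) \<Rightarrow> ('b, 'm, 'z) blue_module_scheme \<Rightarrow> ('b, 'n) blue_module"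
  where "transport f M = (let g = inv_into (carrier M) f in
    \<lparr>carrier = f ` carrier M, mult = undefined, one = undefined, zero = f \<zero>\<^bsub>M\<^esub>,
     add = (\<lambda>x y. f (g x \<oplus>\<^bsub>M\<^esub> g y)), smult = (\<lambda>b x. f (b \<odot>\<^bsub>M\<^esub> g x)),
     mle = (\<lambda>(x, y). (f x, f y)) ` mle M, mpts = f ` mpts M\<rparr>)"

primrec tensor_power ::
    "('b, 'z) oblueprint_scheme \<Rightarrow> nat \<Rightarrow> nat \<Rightarrow> ('b, 'b tensor) blue_module"
  where
    "tensor_power B n 0 = transport Scalar (regular_module B)"
  | "tensor_power B n (Suc l) =
       transport Sum_of_class (tensor_product B (tensor_power B n l) (free_module B n))"

definition sum_tensor ::
    "('b, 'z) oblueprint_scheme \<Rightarrow> nat \<Rightarrow> nat \<Rightarrow> ('b tensor \<times> (nat \<Rightarrow> 'b)) multiset \<Rightarrow> 'b tensor"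
  where "sum_tensor B n l X =
    Sum_of_class (tensor_class B (tensor_power B n l) (free_module B n) X)"

text \<open>
  Concatenation \<open>(B\<^sup>n)\<^sup>\<otimes>\<^sup>l \<times> (B\<^sup>n)\<^sup>\<otimes>\<^sup>m \<rightarrow> (B\<^sup>n)\<^sup>\<otimes>\<^sup>l\<^sup>+\<^sup>m\<close>: a scalar acts on the left factor, and
  \<open>t \<cdot> (\<Sum>u \<otimes> v) = \<Sum>(t \<cdot> u) \<otimes> v\<close>.
\<close>

primrec tensor_concat ::
    "('b, 'z) oblueprint_scheme \<Rightarrow> nat \<Rightarrow> nat \<Rightarrow> nat \<Rightarrow> 'b tensor \<Rightarrow> 'b tensor \<Rightarrow> 'b tensor"
  where
    "tensor_concat B n l 0 t s = the_scalar s \<odot>\<^bsub>tensor_power B n l\<^esub> t"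
  | "tensor_concat B n l (Suc m) t s =
       sum_tensor B n (l + m) (image_mset (\<lambda>(u, v). (tensor_concat B n l m t u, v)) (the_sum s))"

definition tensor_algebra ::
    "('b, 'z) oblueprint_scheme \<Rightarrow> nat \<Rightarrow> ('b, nat \<Rightarrow> 'b tensor) omodule"
  where "tensor_algebra B n =
    (let P = tensor_power B n;
         C = {f. (\<forall>l. f l \<in> carrier (P l)) \<and> finite {l. f l \<noteq> \<zero>\<^bsub>P l\<^esub>}}
     in \<lparr>carrier = C,
         mult = (\<lambda>f g l. \<Oplus>\<^bsub>P l\<^esub>k\<in>{..l}. tensor_concat B n k (l - k) (f k) (g (l - k))),
         one = (\<lambda>l. if l = 0 then Scalar \<one>\<^bsub>B\<^esub> else \<zero>\<^bsub>P l\<^esub>),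
         zero = (\<lambda>l. \<zero>\<^bsub>P l\<^esub>),
         add = (\<lambda>f g l. f l \<oplus>\<^bsub>P l\<^esub> g l),
         smult = (\<lambda>b f l. b \<odot>\<^bsub>P l\<^esub> f l),
         mle = {(f, g). f \<in> C \<and> g \<in> C \<and> (\<forall>l. (f l, g l) \<in> mle (P l))}\<rparr>)"

text \<open>The degree-one part is \<open>B \<otimes> B\<^sup>n\<close>, in which \<open>v \<in> B\<^sup>n\<close> is \<open>1 \<otimes> v\<close>.\<close>

definition tensor_vec ::
    "('b, 'z) oblueprint_scheme \<Rightarrow> nat \<Rightarrow> (nat \<Rightarrow> 'b) \<Rightarrow> nat \<Rightarrow> 'b tensor"
  where "tensor_vec B n v =
    (\<lambda>l. if l = 1 then sum_tensor B n 0 {#(Scalar \<one>\<^bsub>B\<^esub>, v)#} else \<zero>\<^bsub>tensor_power B n l\<^esub>)"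


section \<open>The exterior algebra over an F1pm-algebra\<close>

definition exterior_rels ::
    "('b, 'z) f1pm_algebra_scheme \<Rightarrow> nat \<Rightarrow> ((nat \<Rightarrow> 'b tensor) \<times> (nat \<Rightarrow> 'b tensor)) set"
  where "exterior_rels B n =
    (let T = tensor_algebra B n; e = (\<lambda>i. tensor_vec B n (basis_vec B n i)) in
      {(e i \<otimes>\<^bsub>T\<^esub> e i, \<zero>\<^bsub>T\<^esub>) | i. i \<in> {1..n}} \<union>
      {(e i \<otimes>\<^bsub>T\<^esub> e j, eps B \<odot>\<^bsub>T\<^esub> (e j \<otimes>\<^bsub>T\<^esub> e i)) | i j. i \<in> {1..n} \<and> j \<in> {1..n} \<and> i \<noteq> j})"

definition exterior_preorder ::
    "('b, 'z) f1pm_algebra_scheme \<Rightarrow> nat \<Rightarrow> ((nat \<Rightarrow> 'b tensor) \<times> (nat \<Rightarrow> 'b tensor)) set"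
  where "exterior_preorder B n =
    gen_ring_preorder (tensor_algebra B n) (mle (tensor_algebra B n))
      (exterior_rels B n \<union> (exterior_rels B n)\<inverse>)"

definition exterior_ambient ::
    "('b, 'z) f1pm_algebra_scheme \<Rightarrow> nat \<Rightarrow> ('b, (nat \<Rightarrow> 'b tensor) set) omodule"
  where "exterior_ambient B n = omodule_quot (tensor_algebra B n) (exterior_preorder B n)"

definition exterior_gen :: "('b, 'z) f1pm_algebra_scheme \<Rightarrow> nat \<Rightarrow> nat \<Rightarrow> (nat \<Rightarrow> 'b tensor) set"
  where "exterior_gen B n i = cls (exterior_preorder B n) (tensor_vec B n (basis_vec B n i))"

definition exterior_mono ::
    "('b, 'z) f1pm_algebra_scheme \<Rightarrow> nat \<Rightarrow> nat set \<Rightarrow> (nat \<Rightarrow> 'b tensor) set"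
  where "exterior_mono B n I =
    foldr (\<lambda>i x. exterior_gen B n i \<otimes>\<^bsub>exterior_ambient B n\<^esub> x) (sorted_list_of_set I)
      \<one>\<^bsub>exterior_ambient B n\<^esub>"

definition exterior_homogeneous ::
    "('b, 'z) f1pm_algebra_scheme \<Rightarrow> nat \<Rightarrow> nat \<Rightarrow> (nat \<Rightarrow> 'b tensor) set set"
  where "exterior_homogeneous B n d =
    {\<Oplus>\<^bsub>exterior_ambient B n\<^esub>I\<in>{I. I \<subseteq> {1..n} \<and> card I = d}.
        b I \<odot>\<^bsub>exterior_ambient B n\<^esub> exterior_mono B n I | b.
      b \<in> {I. I \<subseteq> {1..n} \<and> card I = d} \<rightarrow> bpts B}"

definition exterior ::
    "('b, 'z) f1pm_algebra_scheme \<Rightarrow> nat \<Rightarrow> ('b, (nat \<Rightarrow> 'b tensor) set) blue_module"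
  where "exterior B n =
    omodule.extend (exterior_ambient B n)
      (blue_module.fields (\<Union>d\<in>{0..n}. exterior_homogeneous B n d))"


section \<open>The usual exterior algebra and the Giansiracusa exterior algebra\<close>

text \<open>
  For the trivially ordered blueprint \<open>(R, R, =)\<close> the orders on all modules above are equality, so
  that \<open>tensor_algebra (discrete_blue R) n\<close> is the usual tensor algebra of \<open>R\<^sup>n\<close>. The exterior
  algebra is its quotient by the two-sided ideal generated by all squares of vectors.
\<close>

definition discrete_blue :: "('r, 'x) ring_scheme \<Rightarrow> 'r oblueprint"
  where "discrete_blue R =
    \<lparr>carrier = carrier R, mult = mult R, one = \<one>\<^bsub>R\<^esub>, zero = \<zero>\<^bsub>R\<^esub>, add = add R,
     bpts = carrier R, ble = Id_on (carrier R)\<rparr>"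

definition ring_exterior_ideal :: "('r, 'x) ring_scheme \<Rightarrow> nat \<Rightarrow> (nat \<Rightarrow> 'r tensor) set"
  where "ring_exterior_ideal R n =
    (let B = discrete_blue R; T = tensor_algebra B n in
      Idl\<^bsub>T\<^esub> {tensor_vec B n v \<otimes>\<^bsub>T\<^esub> tensor_vec B n v | v. v \<in> carrier (free_module B n)})"

definition ring_exterior ::
    "('r, 'x) ring_scheme \<Rightarrow> nat \<Rightarrow> ('r, (nat \<Rightarrow> 'r tensor) set) module"
  where "ring_exterior R n =
    (let T = tensor_algebra (discrete_blue R) n; I = ring_exterior_ideal R n in
      ring.extend (T Quot I) (module.fields (\<lambda>r X. \<Union>x\<in>X. I +>\<^bsub>T\<^esub> (r \<odot>\<^bsub>T\<^esub> x))))"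

definition ring_exterior_gen :: "('r, 'x) ring_scheme \<Rightarrow> nat \<Rightarrow> nat \<Rightarrow> (nat \<Rightarrow> 'r tensor) set"
  where "ring_exterior_gen R n i =
    (let B = discrete_blue R in
      ring_exterior_ideal R n +>\<^bsub>tensor_algebra B n\<^esub> tensor_vec B n (basis_vec B n i))"

text \<open>
  Polynomials in \<open>e\<^sub>1, \<dots>, e\<^sub>n\<close> are coefficient functions on monomials, which are multisets of
  indices.
\<close>

definition polynomial_semiring ::
    "('s, 'x) ring_scheme \<Rightarrow> nat \<Rightarrow> ('s, nat multiset \<Rightarrow> 's) module"
  where "polynomial_semiring S n =
    \<lparr>carrier = {p. (\<forall>m. p m \<in> carrier S) \<and> finite {m. p m \<noteq> \<zero>\<^bsub>S\<^esub>} \<and>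
                   (\<forall>m. p m \<noteq> \<zero>\<^bsub>S\<^esub> \<longrightarrow> set_mset m \<subseteq> {1..n})},
     mult = (\<lambda>p q m. \<Oplus>\<^bsub>S\<^esub>k\<in>{k. k \<subseteq># m}. p k \<otimes>\<^bsub>S\<^esub> q (m - k)),
     one = (\<lambda>m. if m = {#} then \<one>\<^bsub>S\<^esub> else \<zero>\<^bsub>S\<^esub>),
     zero = (\<lambda>m. \<zero>\<^bsub>S\<^esub>),
     add = (\<lambda>p q m. p m \<oplus>\<^bsub>S\<^esub> q m),
     smult = (\<lambda>s p m. s \<otimes>\<^bsub>S\<^esub> p m)\<rparr>"

definition polynomial_var :: "('s, 'x) ring_scheme \<Rightarrow> nat \<Rightarrow> nat multiset \<Rightarrow> 's"
  where "polynomial_var S i = (\<lambda>m. if m = {#i#} then \<one>\<^bsub>S\<^esub> else \<zero>\<^bsub>S\<^esub>)"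

definition giansiracusa_cong ::
    "('s, 'x) ring_scheme \<Rightarrow> nat \<Rightarrow> ((nat multiset \<Rightarrow> 's) \<times> (nat multiset \<Rightarrow> 's)) set"
  where "giansiracusa_cong S n =
    (let P = polynomial_semiring S n in
      gen_ring_congruence P
        {(polynomial_var S i \<otimes>\<^bsub>P\<^esub> polynomial_var S i, \<zero>\<^bsub>P\<^esub>) | i. i \<in> {1..n}})"

definition giansiracusa_exterior ::
    "('s, 'x) ring_scheme \<Rightarrow> nat \<Rightarrow> ('s, (nat multiset \<Rightarrow> 's) set) module"
  where "giansiracusa_exterior S n =
    module_quot (polynomial_semiring S n) (giansiracusa_cong S n)"

definition giansiracusa_gen :: "('s, 'x) ring_scheme \<Rightarrow> nat \<Rightarrow> nat \<Rightarrow> (nat multiset \<Rightarrow> 's) set"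
  where "giansiracusa_gen S n i = cls (giansiracusa_cong S n) (polynomial_var S i)"


section \<open>The ambient algebras of the hull and the idem of the exterior algebra\<close>

definition exterior_hull_algebra ::
    "('r, 'x) ring_scheme \<Rightarrow> nat \<Rightarrow> ('r, (nat \<Rightarrow> 'r multiset set tensor) set set) module"
  where "exterior_hull_algebra R n =
    (let B = ring_mon R in
      along_quot (\<lambda>r. cls (hull_rel B) (mon_elt R (ring_mon_rels R) r))
        (module_hull B (exterior B n)))"

definition exterior_hull_gen ::
    "('r, 'x) ring_scheme \<Rightarrow> nat \<Rightarrow> nat \<Rightarrow> (nat \<Rightarrow> 'r multiset set tensor) set set"
  where "exterior_hull_gen R n i =
    (let B = ring_mon R in cls (module_hull_rel B (exterior B n)) (exterior_gen B n i))"

definition exterior_idem_algebra ::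
    "('s, 'x) ring_scheme \<Rightarrow> nat \<Rightarrow> ('s, (nat \<Rightarrow> 's multiset set tensor) set set) module"
  where "exterior_idem_algebra S n =
    (let B = semifield_mon S in
      along_quot (\<lambda>s. cls (idem_rel B) (mon_elt S (semifield_mon_rels S) s))
        (module_idem B (exterior B n)))"

definition exterior_idem_gen ::
    "('s, 'x) ring_scheme \<Rightarrow> nat \<Rightarrow> nat \<Rightarrow> (nat \<Rightarrow> 's multiset set tensor) set set"
  where "exterior_idem_gen S n i =
    (let B = semifield_mon S in cls (module_idem_rel B (exterior B n)) (exterior_gen B n i))"


section \<open>Isomorphisms of algebras over a commutative semiring\<close>

text \<open>Algebras are associative and unital, but not necessarily commutative.\<close>

definition semialgebra :: "('k, 'x) ring_scheme \<Rightarrow> ('k, 'a, 'z) module_scheme \<Rightarrow> bool"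
  where "semialgebra K A \<longleftrightarrow>
    semiring K \<and> comm_monoid K \<and> semiring A \<and>
    (\<forall>k\<in>carrier K. \<forall>x\<in>carrier A. k \<odot>\<^bsub>A\<^esub> x \<in> carrier A) \<and>
    (\<forall>k\<in>carrier K. \<forall>l\<in>carrier K. \<forall>x\<in>carrier A.
      (k \<oplus>\<^bsub>K\<^esub> l) \<odot>\<^bsub>A\<^esub> x = k \<odot>\<^bsub>A\<^esub> x \<oplus>\<^bsub>A\<^esub> l \<odot>\<^bsub>A\<^esub> x \<and>
      (k \<otimes>\<^bsub>K\<^esub> l) \<odot>\<^bsub>A\<^esub> x = k \<odot>\<^bsub>A\<^esub> (l \<odot>\<^bsub>A\<^esub> x)) \<and>
    (\<forall>k\<in>carrier K. \<forall>x\<in>carrier A. \<forall>y\<in>carrier A.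
      k \<odot>\<^bsub>A\<^esub> (x \<oplus>\<^bsub>A\<^esub> y) = k \<odot>\<^bsub>A\<^esub> x \<oplus>\<^bsub>A\<^esub> k \<odot>\<^bsub>A\<^esub> y \<and>
      (k \<odot>\<^bsub>A\<^esub> x) \<otimes>\<^bsub>A\<^esub> y = k \<odot>\<^bsub>A\<^esub> (x \<otimes>\<^bsub>A\<^esub> y) \<and>
      x \<otimes>\<^bsub>A\<^esub> (k \<odot>\<^bsub>A\<^esub> y) = k \<odot>\<^bsub>A\<^esub> (x \<otimes>\<^bsub>A\<^esub> y)) \<and>
    (\<forall>x\<in>carrier A. \<one>\<^bsub>K\<^esub> \<odot>\<^bsub>A\<^esub> x = x \<and> \<zero>\<^bsub>K\<^esub> \<odot>\<^bsub>A\<^esub> x = \<zero>\<^bsub>A\<^esub>) \<and>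
    (\<forall>k\<in>carrier K. k \<odot>\<^bsub>A\<^esub> \<zero>\<^bsub>A\<^esub> = \<zero>\<^bsub>A\<^esub>)"

definition algebra_iso ::
    "('k, 'x) ring_scheme \<Rightarrow> ('k, 'a, 'z) module_scheme \<Rightarrow> ('k, 'c, 'y) module_scheme \<Rightarrow>
     ('a \<Rightarrow> 'c) set"
  where "algebra_iso K A C =
    {\<phi> \<in> ring_iso A C. semialgebra K A \<and> semialgebra K C \<and> \<phi> \<zero>\<^bsub>A\<^esub> = \<zero>\<^bsub>C\<^esub> \<and>
      (\<forall>k\<in>carrier K. \<forall>x\<in>carrier A. \<phi> (k \<odot>\<^bsub>A\<^esub> x) = k \<odot>\<^bsub>C\<^esub> \<phi> x)}"

end

theory Submission
  imports Defs
begin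

text \<open>
  Both parts are proved by comparing universal properties. The tensor algebra \<open>T(B\<^sup>n)\<close> is free as an
  ordered algebra: if \<open>C\<close> is an algebra over \<open>B\<close> with a partial order \<open>r\<close> compatible with sums and
  products, and \<open>a \<le> b\<close> in \<open>B\<close> implies \<open>a x \<le> b x\<close> in \<open>C\<close>, then for any \<open>g\<^sub>1, \<dots>, g\<^sub>n\<close> in \<open>C\<close> there
  is a monotone homomorphism \<open>T(B\<^sup>n) \<rightarrow> C\<close> with \<open>e\<^sub>i \<mapsto> g\<^sub>i\<close> (locale \<open>tensor_target\<close>). Since all further
  quotients are by least preorders, the map descends to the exterior algebra as soon as
  \<open>g\<^sub>i\<^sup>2 = 0\<close> and \<open>g\<^sub>i g\<^sub>j = \<epsilon> g\<^sub>j g\<^sub>i\<close> for \<open>i \<noteq> j\<close>, and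
  to the hull, respectively the idem, as soon as \<open>r\<close> is equality,
  respectively the natural order of an idempotent algebra \<open>C\<close> (\<open>W_universal\<close>).

  The hull and the idem are algebras over the original \<open>R\<close> or \<open>S\<close> because \<open>k \<mapsto> 1.k\<close> becomes additive:
  in the hull of \<open>R\<^sup>m\<^sup>o\<^sup>n\<close> the relation \<open>1.(k + l) \<le> 1.k + 1.l\<close> is made an equality, and in the idem of
  \<open>S\<^sup>m\<^sup>o\<^sup>n\<close> the opposite inequality follows from \<open>1.k \<le> 1.(k + l) + 1.(k + l) = 1.(k + l)\<close>. In the other
  direction, summing up a formal sum in \<open>R\<close> or \<open>S\<close> is a monotone map \<open>val\<close> from the blueprint, so that
  every algebra over \<open>R\<close> or \<open>S\<close> is one over the blueprint. Hence there is a homomorphism from the hull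
  or idem to the classical algebra, which matches the generators.

  The homomorphism back comes from the universal properties of the classical algebras. For a ring, the
  tensor algebra over the trivially ordered \<open>R\<close> maps to the hull, and squares of vectors go to zero
  since the images of the \<open>e\<^sub>i\<close> square to zero and anticommute (\<open>square_of_anticommuting_sum\<close>). For an
  idempotent semifield \<open>\<epsilon> = 1\<close>, so the idem is commutative (\<open>W_commute\<close>) and receives a homomorphism from
  the polynomial semiring. Both sides are generated by the \<open>e\<^sub>i\<close> (\<open>T_induct\<close>, \<open>W_induct\<close>,
  \<open>Poly_induct\<close>), therefore the two homomorphisms are inverse to each other
  (\<open>ring_case\<close>, \<open>semifield_case\<close>).
\<close>

section \<open>Classes of a preorder\<close>

lemma preorder_on_carrier: "preorder_on A r \<Longrightarrow> (x, y) \<in> r \<Longrightarrow> x \<in> A \<and> y \<in> A"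
  by (auto simp: preorder_on_def)

lemma preorder_on_refl: "preorder_on A r \<Longrightarrow> x \<in> A \<Longrightarrow> (x, x) \<in> r"
  by (auto simp: preorder_on_def refl_on_def)

lemma preorder_on_trans: "preorder_on A r \<Longrightarrow> (x, y) \<in> r \<Longrightarrow> (y, z) \<in> r \<Longrightarrow> (x, z) \<in> r"
  unfolding preorder_on_def by (meson transD)

lemma preorder_onI:
  assumes "\<And>x y. (x, y) \<in> r \<Longrightarrow> x \<in> A \<and> y \<in> A" and "\<And>x. x \<in> A \<Longrightarrow> (x, x) \<in> r"
    and "\<And>x y z. (x, y) \<in> r \<Longrightarrow> (y, z) \<in> r \<Longrightarrow> (x, z) \<in> r"
  shows "preorder_on A r"
  unfolding preorder_on_def
  by (intro conjI subrelI refl_onI transI) (use assms in blast)+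

lemma equiv_iff_sym_preorder: "equiv A r \<longleftrightarrow> preorder_on A r \<and> sym r"
  by (auto simp: equiv_def preorder_on_def)

lemma preorder_on_Inter:
  assumes "F \<noteq> {}" and "\<And>r. r \<in> F \<Longrightarrow> preorder_on A r"
  shows "preorder_on A (\<Inter>F)"
proof (rule preorder_onI)
  fix x y assume "(x, y) \<in> \<Inter>F"
  then show "x \<in> A \<and> y \<in> A"
    using assms preorder_on_carrier by (metis Inter_iff all_not_in_conv)
next
  fix x assume "x \<in> A"
  then show "(x, x) \<in> \<Inter>F"
    using assms(2) preorder_on_refl by (metis InterI)
next
  fix x y z assume "(x, y) \<in> \<Inter>F" "(y, z) \<in> \<Inter>F"
  then show "(x, z) \<in> \<Inter>F"
    using assms(2) preorder_on_trans[of A _ x y z] by auto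
qed

lemma cls_self: "preorder_on A r \<Longrightarrow> x \<in> A \<Longrightarrow> x \<in> cls r x"
  by (simp add: cls_def preorder_on_refl)

lemma cls_eq_iff:
  assumes "preorder_on A r" "x \<in> A"
  shows "cls r x = cls r y \<longleftrightarrow> (x, y) \<in> r \<and> (y, x) \<in> r"
proof
  assume "cls r x = cls r y"
  then have "x \<in> cls r y"
    using cls_self[OF assms] by simp
  then show "(x, y) \<in> r \<and> (y, x) \<in> r"
    by (simp add: cls_def)
next
  assume "(x, y) \<in> r \<and> (y, x) \<in> r"
  then show "cls r x = cls r y"
    using preorder_on_trans[OF assms(1)] by (auto simp: cls_def)
qed

lemma cls_eqI: "preorder_on A r \<Longrightarrow> (x, y) \<in> r \<Longrightarrow> (y, x) \<in> r \<Longrightarrow> cls r x = cls r y"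
  using cls_eq_iff preorder_on_carrier by metis

lemma lift1_cls:
  assumes r: "preorder_on A r" and x: "x \<in> A"
    and f: "\<And>x y. (x, y) \<in> r \<Longrightarrow> (f x, f y) \<in> r"
  shows "lift1 r f (cls r x) = cls r (f x)"
proof -
  have "cls r (f y) = cls r (f x)" if "y \<in> cls r x" for y
    by (rule cls_eqI[OF r]) (use that f in \<open>auto simp: cls_def\<close>)
  then show ?thesis
    unfolding lift1_def using cls_self[OF r x] by blast
qed

lemma lift2_cls:
  assumes r: "preorder_on A r" and x: "x \<in> A" and y: "y \<in> A"
    and f: "\<And>x x' y y'. (x, x') \<in> r \<Longrightarrow> (y, y') \<in> r \<Longrightarrow> (f x y, f x' y') \<in> r"
  shows "lift2 r f (cls r x) (cls r y) = cls r (f x y)"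
proof -
  have *: "cls r (f x' y') = cls r (f x y)" if "x' \<in> cls r x" "y' \<in> cls r y" for x' y'
    by (rule cls_eqI[OF r]) (use that f in \<open>auto simp: cls_def\<close>)
  have "(\<Union>x'\<in>cls r x. \<Union>y'\<in>cls r y. cls r (f x' y')) = (\<Union>x'\<in>cls r x. \<Union>y'\<in>cls r y. cls r (f x y))"
    by (intro SUP_cong refl) (use * in auto)
  then show ?thesis
    unfolding lift2_def using cls_self[OF r x] cls_self[OF r y] by auto
qed

text \<open>
  The order on a quotient is the set of pairs of classes of related elements. Since the classes are
  those of the symmetric part of the preorder, the relation between two classes does not depend on
  the representatives, and antisymmetry holds.
\<close>

lemma cls_image_mem_iff:
  assumes r: "preorder_on A r" and xy: "x \<in> A" "y \<in> A"
  shows "(cls r x, cls r y) \<in> (\<lambda>(x, y). (cls r x, cls r y)) ` r \<longleftrightarrow> (x, y) \<in> r"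
proof
  assume "(cls r x, cls r y) \<in> (\<lambda>(x, y). (cls r x, cls r y)) ` r"
  then obtain x' y' where *: "(x', y') \<in> r" "cls r x = cls r x'" "cls r y = cls r y'"
    by auto
  have "(x, x') \<in> r" "(y', y) \<in> r"
    using * cls_eq_iff[OF r xy(1)] cls_eq_iff[OF r xy(2)] by auto
  then show "(x, y) \<in> r"
    using * preorder_on_trans[OF r] by blast
qed auto

lemma partial_order_cls_image:
  assumes r: "preorder_on A r"
  shows "partial_order_on (cls r ` A) ((\<lambda>(x, y). (cls r x, cls r y)) ` r)"
    (is "partial_order_on _ ?q")
proof -
  note iff = cls_image_mem_iff[OF r]
  have sub: "?q \<subseteq> cls r ` A \<times> cls r ` A"
    using preorder_on_carrier[OF r] by auto
  have "preorder_on (cls r ` A) ?q"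
  proof (rule preorder_onI)
    fix X Y assume "(X, Y) \<in> ?q" then show "X \<in> cls r ` A \<and> Y \<in> cls r ` A"
      using sub by blast
  next
    fix X assume "X \<in> cls r ` A"
    then obtain x where "x \<in> A" "X = cls r x" by blast
    then show "(X, X) \<in> ?q"
      using iff[of x x] preorder_on_refl[OF r, of x] by simp
  next
    fix X Y Z assume 1: "(X, Y) \<in> ?q" "(Y, Z) \<in> ?q"
    then obtain x y z where xyz: "x \<in> A" "y \<in> A" "z \<in> A" "X = cls r x" "Y = cls r y" "Z = cls r z"
      using sub by blast
    then have "(x, y) \<in> r" "(y, z) \<in> r"
      using 1 iff by metis+
    then have "(x, z) \<in> r"
      by (rule preorder_on_trans[OF r])
    then show "(X, Z) \<in> ?q"
      using xyz by auto
  qed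
  moreover have "antisym ?q"
  proof (rule antisymI)
    fix X Y assume 1: "(X, Y) \<in> ?q" "(Y, X) \<in> ?q"
    then obtain x y where xy: "x \<in> A" "y \<in> A" "X = cls r x" "Y = cls r y"
      using sub by blast
    then have "(x, y) \<in> r" "(y, x) \<in> r"
      using 1 iff by metis+
    then show "X = Y"
      unfolding xy by (rule cls_eqI[OF r])
  qed
  ultimately show ?thesis
    by (simp add: partial_order_on_def)
qed


text \<open>
  A map descends to a quotient by a least preorder because its pullback preorder is one of those
  among which that preorder is least.
\<close>

lemma pullback_preorder:
  assumes r: "preorder_on C r" and h: "\<And>x. x \<in> A \<Longrightarrow> h x \<in> C"
  shows "preorder_on A {(x, y). x \<in> A \<and> y \<in> A \<and> (h x, h y) \<in> r}"
proof (rule preorder_onI)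
  fix x y z
  assume "(x, y) \<in> {(x, y). x \<in> A \<and> y \<in> A \<and> (h x, h y) \<in> r}"
    and "(y, z) \<in> {(x, y). x \<in> A \<and> y \<in> A \<and> (h x, h y) \<in> r}"
  then show "(x, z) \<in> {(x, y). x \<in> A \<and> y \<in> A \<and> (h x, h y) \<in> r}"
    using preorder_on_trans[OF r, of "h x" "h y" "h z"] by simp
qed (use preorder_on_refl[OF r] h in auto)

text \<open>
  How a map is defined on a quotient: it takes the value of \<open>k\<close> at any chosen preimage.
\<close>

lemma factor_through_image:
  assumes "x \<in> A" and "\<And>y. y \<in> A \<Longrightarrow> q y = q x \<Longrightarrow> k y = k x"
  shows "k (inv_into A q (q x)) = k x"
  using assms by (metis f_inv_into_f image_eqI inv_into_into)


section \<open>Compatible preorders\<close>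

lemma add_compatD: "add_compat A r \<Longrightarrow> (x, y) \<in> r \<Longrightarrow> z \<in> carrier A \<Longrightarrow> (x \<oplus>\<^bsub>A\<^esub> z, y \<oplus>\<^bsub>A\<^esub> z) \<in> r"
  by (auto simp: add_compat_def)

lemma add_compatI: "(\<And>x y z. (x, y) \<in> r \<Longrightarrow> z \<in> carrier A \<Longrightarrow> (x \<oplus>\<^bsub>A\<^esub> z, y \<oplus>\<^bsub>A\<^esub> z) \<in> r) \<Longrightarrow> add_compat A r"
  by (auto simp: add_compat_def)

lemma mult_compatD:
  assumes "mult_compat A r" "(x, y) \<in> r" "z \<in> carrier A"
  shows "(x \<otimes>\<^bsub>A\<^esub> z, y \<otimes>\<^bsub>A\<^esub> z) \<in> r" "(z \<otimes>\<^bsub>A\<^esub> x, z \<otimes>\<^bsub>A\<^esub> y) \<in> r"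
  using assms by (auto simp: mult_compat_def)

lemma mult_compatI:
  "(\<And>x y z. (x, y) \<in> r \<Longrightarrow> z \<in> carrier A \<Longrightarrow> (x \<otimes>\<^bsub>A\<^esub> z, y \<otimes>\<^bsub>A\<^esub> z) \<in> r) \<Longrightarrow>
   (\<And>x y z. (x, y) \<in> r \<Longrightarrow> z \<in> carrier A \<Longrightarrow> (z \<otimes>\<^bsub>A\<^esub> x, z \<otimes>\<^bsub>A\<^esub> y) \<in> r) \<Longrightarrow> mult_compat A r"
  by (auto simp: mult_compat_def)

lemma add_compat2:
  assumes "abelian_monoid A" "preorder_on (carrier A) r" "add_compat A r" "(x, x') \<in> r" "(y, y') \<in> r"
  shows "(x \<oplus>\<^bsub>A\<^esub> y, x' \<oplus>\<^bsub>A\<^esub> y') \<in> r"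
proof -
  interpret abelian_monoid A by fact
  have c: "x \<in> carrier A" "x' \<in> carrier A" "y \<in> carrier A" "y' \<in> carrier A"
    using preorder_on_carrier[OF assms(2)] assms(4,5) by blast+
  have "(y \<oplus>\<^bsub>A\<^esub> x', y' \<oplus>\<^bsub>A\<^esub> x') \<in> r"
    using assms c by (intro add_compatD)
  then have "(x' \<oplus>\<^bsub>A\<^esub> y, x' \<oplus>\<^bsub>A\<^esub> y') \<in> r"
    using c a_comm by metis
  then show ?thesis
    using add_compatD[OF assms(3,4) c(3)] preorder_on_trans[OF assms(2)] by blast
qed

lemma mult_compat2:
  assumes "preorder_on (carrier A) r" "mult_compat A r" "(x, x') \<in> r" "(y, y') \<in> r"
  shows "(x \<otimes>\<^bsub>A\<^esub> y, x' \<otimes>\<^bsub>A\<^esub> y') \<in> r"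
proof -
  have c: "x' \<in> carrier A" "y \<in> carrier A"
    using preorder_on_carrier[OF assms(1)] assms(3,4) by blast+
  show ?thesis
    by (rule preorder_on_trans[OF assms(1) mult_compatD(1)[OF assms(2,3) c(2)]
          mult_compatD(2)[OF assms(2,4) c(1)]])
qed

lemma gen_ring_preorder_least:
  assumes "preorder_on (carrier A) r" "add_compat A r" "mult_compat A r" "L \<subseteq> r" "H \<subseteq> r"
  shows "gen_ring_preorder A L H \<subseteq> r"
  using assms by (auto simp: gen_ring_preorder_def)

lemma
  assumes A: "semiring A" and LH: "L \<subseteq> carrier A \<times> carrier A" "H \<subseteq> carrier A \<times> carrier A"
  shows gen_ring_preorder_preorder: "preorder_on (carrier A) (gen_ring_preorder A L H)"
    and gen_ring_preorder_add: "add_compat A (gen_ring_preorder A L H)"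
    and gen_ring_preorder_mult: "mult_compat A (gen_ring_preorder A L H)"
    and gen_ring_preorder_order: "L \<subseteq> gen_ring_preorder A L H"
    and gen_ring_preorder_rels: "H \<subseteq> gen_ring_preorder A L H"
proof -
  interpret semiring A by fact
  let ?F = "{r. preorder_on (carrier A) r \<and> add_compat A r \<and> mult_compat A r \<and> L \<subseteq> r \<and> H \<subseteq> r}"
  have "carrier A \<times> carrier A \<in> ?F"
    using LH by (auto simp: preorder_on_def refl_on_def trans_def add_compat_def mult_compat_def)
  then show "preorder_on (carrier A) (gen_ring_preorder A L H)"
    unfolding gen_ring_preorder_def by (intro preorder_on_Inter) auto
  show "add_compat A (gen_ring_preorder A L H)"
    by (rule add_compatI) (auto simp: gen_ring_preorder_def intro: add_compatD)
  show "mult_compat A (gen_ring_preorder A L H)"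
    by (rule mult_compatI) (auto simp: gen_ring_preorder_def intro: mult_compatD)
  show "L \<subseteq> gen_ring_preorder A L H" "H \<subseteq> gen_ring_preorder A L H"
    by (auto simp: gen_ring_preorder_def)
qed

lemma gen_ring_congruence_least:
  assumes "equiv (carrier A) r" "add_compat A r" "mult_compat A r" "H \<subseteq> r"
  shows "gen_ring_congruence A H \<subseteq> r"
  using assms by (auto simp: gen_ring_congruence_def)

lemma
  assumes A: "semiring A" and H: "H \<subseteq> carrier A \<times> carrier A"
  shows gen_ring_congruence_preorder: "preorder_on (carrier A) (gen_ring_congruence A H)"
    and gen_ring_congruence_add: "add_compat A (gen_ring_congruence A H)"
    and gen_ring_congruence_mult: "mult_compat A (gen_ring_congruence A H)"
    and gen_ring_congruence_rels: "H \<subseteq> gen_ring_congruence A H"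
    and gen_ring_congruence_sym: "sym (gen_ring_congruence A H)"
proof -
  interpret semiring A by fact
  let ?F = "{r. equiv (carrier A) r \<and> add_compat A r \<and> mult_compat A r \<and> H \<subseteq> r}"
  have "carrier A \<times> carrier A \<in> ?F"
    using H by (auto simp: equiv_def refl_on_def trans_def sym_def add_compat_def mult_compat_def)
  then show "preorder_on (carrier A) (gen_ring_congruence A H)"
    unfolding gen_ring_congruence_def by (intro preorder_on_Inter) (auto simp: equiv_iff_sym_preorder)
  show "add_compat A (gen_ring_congruence A H)"
    by (rule add_compatI) (auto simp: gen_ring_congruence_def intro: add_compatD)
  show "mult_compat A (gen_ring_congruence A H)"
    by (rule mult_compatI) (auto simp: gen_ring_congruence_def intro: mult_compatD)
  show "H \<subseteq> gen_ring_congruence A H"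
    by (auto simp: gen_ring_congruence_def)
  show "sym (gen_ring_congruence A H)"
    by (rule symI) (auto simp: gen_ring_congruence_def equiv_def dest: symD)
qed


lemma
  assumes add: "\<And>x y. \<lbrakk>x \<in> carrier M; y \<in> carrier M\<rbrakk> \<Longrightarrow> x \<oplus>\<^bsub>M\<^esub> y \<in> carrier M"
    and smult: "\<And>a b x. \<lbrakk>(a, b) \<in> ble B; x \<in> carrier M\<rbrakk> \<Longrightarrow> a \<odot>\<^bsub>M\<^esub> x \<in> carrier M \<and> b \<odot>\<^bsub>M\<^esub> x \<in> carrier M"
    and mle: "mle M \<subseteq> carrier M \<times> carrier M" and H: "H \<subseteq> carrier M \<times> carrier M"
  shows gen_additive_preorder_additive: "additive_preorder B M (gen_additive_preorder B M H)"
    and gen_additive_preorder_rels: "H \<subseteq> gen_additive_preorder B M H"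
proof -
  let ?F = "{r. additive_preorder B M r \<and> H \<subseteq> r}"
  have full: "carrier M \<times> carrier M \<in> ?F"
    using add smult mle H
    by (fastforce simp: additive_preorder_def preorder_on_def refl_on_def trans_def add_compat_def)
  have ex: "gen_additive_preorder B M H = \<Inter>?F"
    by (simp add: gen_additive_preorder_def)
  have "preorder_on (carrier M) (\<Inter>?F)"
  proof (rule preorder_on_Inter)
    show "?F \<noteq> {}"
      using full by blast
  qed (simp add: additive_preorder_def)
  moreover have "add_compat M (\<Inter>?F)"
    by (rule add_compatI) (auto simp: additive_preorder_def intro: add_compatD)
  moreover have "mle M \<subseteq> \<Inter>?F"
    by (auto simp: additive_preorder_def)
  moreover have "(a \<odot>\<^bsub>M\<^esub> x, b \<odot>\<^bsub>M\<^esub> y) \<in> \<Inter>?F" if "(a, b) \<in> ble B" "(x, y) \<in> \<Inter>?F" for a b x y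
    using that unfolding additive_preorder_def by blast
  ultimately show "additive_preorder B M (gen_additive_preorder B M H)"
    unfolding ex by (auto simp: additive_preorder_def)
  show "H \<subseteq> gen_additive_preorder B M H"
    unfolding ex by blast
qed

lemma gen_additive_preorder_least:
  "additive_preorder B M r \<Longrightarrow> H \<subseteq> r \<Longrightarrow> gen_additive_preorder B M H \<subseteq> r"
  unfolding gen_additive_preorder_def by blast


section \<open>Ordered semirings, ordered modules and algebras\<close>

locale ordered_semiring = semiring B + comm_monoid B for B (structure) +
  assumes ble_order: "partial_order_on (carrier B) (ble B)"
    and ble_add: "add_compat B (ble B)"
    and ble_mult: "mult_compat B (ble B)"
begin

lemma ble_preorder: "preorder_on (carrier B) (ble B)"
  using ble_order by (simp add: partial_order_on_def)

end

locale ordered_module = B: ordered_semiring B + abelian_monoid M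
  for B :: "('b, 'z) oblueprint_scheme" and M :: "('b, 'm, 'y) omodule_scheme" +
  assumes smult_closed [simp, intro]: "\<lbrakk>b \<in> carrier B; x \<in> carrier M\<rbrakk> \<Longrightarrow> b \<odot>\<^bsub>M\<^esub> x \<in> carrier M"
    and smult_l_distr: "\<lbrakk>a \<in> carrier B; b \<in> carrier B; x \<in> carrier M\<rbrakk> \<Longrightarrow>
      (a \<oplus>\<^bsub>B\<^esub> b) \<odot>\<^bsub>M\<^esub> x = a \<odot>\<^bsub>M\<^esub> x \<oplus>\<^bsub>M\<^esub> b \<odot>\<^bsub>M\<^esub> x"
    and smult_r_distr: "\<lbrakk>b \<in> carrier B; x \<in> carrier M; y \<in> carrier M\<rbrakk> \<Longrightarrow>
      b \<odot>\<^bsub>M\<^esub> (x \<oplus>\<^bsub>M\<^esub> y) = b \<odot>\<^bsub>M\<^esub> x \<oplus>\<^bsub>M\<^esub> b \<odot>\<^bsub>M\<^esub> y"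
    and smult_assoc: "\<lbrakk>a \<in> carrier B; b \<in> carrier B; x \<in> carrier M\<rbrakk> \<Longrightarrow>
      (a \<otimes>\<^bsub>B\<^esub> b) \<odot>\<^bsub>M\<^esub> x = a \<odot>\<^bsub>M\<^esub> (b \<odot>\<^bsub>M\<^esub> x)"
    and smult_one [simp]: "x \<in> carrier M \<Longrightarrow> \<one>\<^bsub>B\<^esub> \<odot>\<^bsub>M\<^esub> x = x"
    and smult_l_null [simp]: "x \<in> carrier M \<Longrightarrow> \<zero>\<^bsub>B\<^esub> \<odot>\<^bsub>M\<^esub> x = \<zero>\<^bsub>M\<^esub>"
    and smult_r_null [simp]: "b \<in> carrier B \<Longrightarrow> b \<odot>\<^bsub>M\<^esub> \<zero>\<^bsub>M\<^esub> = \<zero>\<^bsub>M\<^esub>"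
    and mle_order: "partial_order_on (carrier M) (mle M)"
    and mle_add: "add_compat M (mle M)"
    and mle_smult: "\<lbrakk>(a, b) \<in> ble B; (x, y) \<in> mle M\<rbrakk> \<Longrightarrow> (a \<odot>\<^bsub>M\<^esub> x, b \<odot>\<^bsub>M\<^esub> y) \<in> mle M"
begin

lemma mle_preorder: "preorder_on (carrier M) (mle M)"
  using mle_order by (simp add: partial_order_on_def)

lemma mle_antisym: "(x, y) \<in> mle M \<Longrightarrow> (y, x) \<in> mle M \<Longrightarrow> x = y"
  using mle_order by (auto simp: partial_order_on_def antisym_def)

end

locale semialg =
  fixes K :: "('k, 'x) ring_scheme" and A :: "('k, 'a, 'z) module_scheme"
  assumes semialgebra: "semialgebra K A"
begin

sublocale K: semiring K
  using semialgebra by (simp add: semialgebra_def)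

sublocale K: comm_monoid K
  using semialgebra by (simp add: semialgebra_def)

sublocale A: semiring A
  using semialgebra by (simp add: semialgebra_def)

lemma smult_closed [simp, intro]: "\<lbrakk>k \<in> carrier K; x \<in> carrier A\<rbrakk> \<Longrightarrow> k \<odot>\<^bsub>A\<^esub> x \<in> carrier A"
  using semialgebra by (simp add: semialgebra_def)

lemma smult_l_distr: "\<lbrakk>k \<in> carrier K; l \<in> carrier K; x \<in> carrier A\<rbrakk> \<Longrightarrow>
    (k \<oplus>\<^bsub>K\<^esub> l) \<odot>\<^bsub>A\<^esub> x = k \<odot>\<^bsub>A\<^esub> x \<oplus>\<^bsub>A\<^esub> l \<odot>\<^bsub>A\<^esub> x"
  using semialgebra by (simp add: semialgebra_def)

lemma smult_assoc: "\<lbrakk>k \<in> carrier K; l \<in> carrier K; x \<in> carrier A\<rbrakk> \<Longrightarrow>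
    (k \<otimes>\<^bsub>K\<^esub> l) \<odot>\<^bsub>A\<^esub> x = k \<odot>\<^bsub>A\<^esub> (l \<odot>\<^bsub>A\<^esub> x)"
  using semialgebra by (simp add: semialgebra_def)

lemma smult_r_distr: "\<lbrakk>k \<in> carrier K; x \<in> carrier A; y \<in> carrier A\<rbrakk> \<Longrightarrow>
    k \<odot>\<^bsub>A\<^esub> (x \<oplus>\<^bsub>A\<^esub> y) = k \<odot>\<^bsub>A\<^esub> x \<oplus>\<^bsub>A\<^esub> k \<odot>\<^bsub>A\<^esub> y"
  using semialgebra by (simp add: semialgebra_def)

lemma smult_mult_l: "\<lbrakk>k \<in> carrier K; x \<in> carrier A; y \<in> carrier A\<rbrakk> \<Longrightarrow>
    (k \<odot>\<^bsub>A\<^esub> x) \<otimes>\<^bsub>A\<^esub> y = k \<odot>\<^bsub>A\<^esub> (x \<otimes>\<^bsub>A\<^esub> y)"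
  using semialgebra by (simp add: semialgebra_def)

lemma smult_mult_r: "\<lbrakk>k \<in> carrier K; x \<in> carrier A; y \<in> carrier A\<rbrakk> \<Longrightarrow>
    x \<otimes>\<^bsub>A\<^esub> (k \<odot>\<^bsub>A\<^esub> y) = k \<odot>\<^bsub>A\<^esub> (x \<otimes>\<^bsub>A\<^esub> y)"
  using semialgebra by (simp add: semialgebra_def)

lemma smult_one [simp]: "x \<in> carrier A \<Longrightarrow> \<one>\<^bsub>K\<^esub> \<odot>\<^bsub>A\<^esub> x = x"
  using semialgebra by (simp add: semialgebra_def)

lemma smult_l_null [simp]: "x \<in> carrier A \<Longrightarrow> \<zero>\<^bsub>K\<^esub> \<odot>\<^bsub>A\<^esub> x = \<zero>\<^bsub>A\<^esub>"
  using semialgebra by (simp add: semialgebra_def)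

lemma smult_r_null [simp]: "k \<in> carrier K \<Longrightarrow> k \<odot>\<^bsub>A\<^esub> \<zero>\<^bsub>A\<^esub> = \<zero>\<^bsub>A\<^esub>"
  using semialgebra by (simp add: semialgebra_def)

text \<open>
  Scalars act as multiples of the unit. Hence a preorder that is compatible with products is
  compatible with scalars as well.
\<close>

lemma smult_conv_mult: "\<lbrakk>k \<in> carrier K; x \<in> carrier A\<rbrakk> \<Longrightarrow> k \<odot>\<^bsub>A\<^esub> x = (k \<odot>\<^bsub>A\<^esub> \<one>\<^bsub>A\<^esub>) \<otimes>\<^bsub>A\<^esub> x"
  by (simp add: smult_mult_l)

lemma smult_compat:
  "\<lbrakk>mult_compat A r; preorder_on (carrier A) r; (x, y) \<in> r; k \<in> carrier K\<rbrakk> \<Longrightarrow> (k \<odot>\<^bsub>A\<^esub> x, k \<odot>\<^bsub>A\<^esub> y) \<in> r"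
  using mult_compatD(2)[of A r x y "k \<odot>\<^bsub>A\<^esub> \<one>\<^bsub>A\<^esub>"] preorder_on_carrier[of "carrier A" r x y]
  by (metis A.one_closed smult_closed smult_conv_mult)

end

text \<open>
  Every quotient and every transported structure below is the image of a known structure under a
  map that respects the operations, and identities pass to images.
\<close>

lemma abelian_monoid_image:
  assumes A: "abelian_monoid A" and car: "carrier Q = h ` carrier A"
    and add: "\<And>x y. \<lbrakk>x \<in> carrier A; y \<in> carrier A\<rbrakk> \<Longrightarrow> h x \<oplus>\<^bsub>Q\<^esub> h y = h (x \<oplus>\<^bsub>A\<^esub> y)"
    and zero: "\<zero>\<^bsub>Q\<^esub> = h \<zero>\<^bsub>A\<^esub>"
  shows "abelian_monoid Q"
proof -
  interpret abelian_monoid A by fact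
  show ?thesis
    by (rule abelian_monoidI) (auto simp: car add zero a_ac)
qed

lemma semiring_image:
  assumes A: "semiring A" and car: "carrier Q = h ` carrier A"
    and add: "\<And>x y. \<lbrakk>x \<in> carrier A; y \<in> carrier A\<rbrakk> \<Longrightarrow> h x \<oplus>\<^bsub>Q\<^esub> h y = h (x \<oplus>\<^bsub>A\<^esub> y)"
    and mult: "\<And>x y. \<lbrakk>x \<in> carrier A; y \<in> carrier A\<rbrakk> \<Longrightarrow> h x \<otimes>\<^bsub>Q\<^esub> h y = h (x \<otimes>\<^bsub>A\<^esub> y)"
    and zero: "\<zero>\<^bsub>Q\<^esub> = h \<zero>\<^bsub>A\<^esub>" and one: "\<one>\<^bsub>Q\<^esub> = h \<one>\<^bsub>A\<^esub>"
  shows "semiring Q"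
proof -
  interpret semiring A by fact
  interpret Q: abelian_monoid Q
    using abelian_monoid_image[OF abelian_monoid_axioms car add zero] .
  show ?thesis
    by unfold_locales (auto simp: car add mult zero one m_assoc l_distr r_distr)
qed

lemma comm_monoid_image:
  assumes A: "comm_monoid A" and car: "carrier Q = h ` carrier A"
    and mult: "\<And>x y. \<lbrakk>x \<in> carrier A; y \<in> carrier A\<rbrakk> \<Longrightarrow> h x \<otimes>\<^bsub>Q\<^esub> h y = h (x \<otimes>\<^bsub>A\<^esub> y)"
    and one: "\<one>\<^bsub>Q\<^esub> = h \<one>\<^bsub>A\<^esub>"
  shows "comm_monoid Q"
proof -
  interpret comm_monoid A by fact
  show ?thesis
    by unfold_locales (auto simp: car mult one m_ac)
qed

text \<open>
  In the next lemma the scalars change along a map \<open>\<iota>\<close> which respects the operations only up to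
  the identifications made by \<open>h\<close>; this is what happens when scalars are chosen representatives.
\<close>

lemma semialgebra_image:
  assumes A: "semialgebra B A" and K: "semiring K" "comm_monoid K" and car: "carrier Q = h ` carrier A"
    and add: "\<And>x y. \<lbrakk>x \<in> carrier A; y \<in> carrier A\<rbrakk> \<Longrightarrow> h x \<oplus>\<^bsub>Q\<^esub> h y = h (x \<oplus>\<^bsub>A\<^esub> y)"
    and mult: "\<And>x y. \<lbrakk>x \<in> carrier A; y \<in> carrier A\<rbrakk> \<Longrightarrow> h x \<otimes>\<^bsub>Q\<^esub> h y = h (x \<otimes>\<^bsub>A\<^esub> y)"
    and zero: "\<zero>\<^bsub>Q\<^esub> = h \<zero>\<^bsub>A\<^esub>" and one: "\<one>\<^bsub>Q\<^esub> = h \<one>\<^bsub>A\<^esub>"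
    and smult: "\<And>k x. \<lbrakk>k \<in> carrier K; x \<in> carrier A\<rbrakk> \<Longrightarrow> k \<odot>\<^bsub>Q\<^esub> h x = h (\<iota> k \<odot>\<^bsub>A\<^esub> x)"
    and \<iota>: "\<And>k. k \<in> carrier K \<Longrightarrow> \<iota> k \<in> carrier B"
    and \<iota>_add: "\<And>k l x. \<lbrakk>k \<in> carrier K; l \<in> carrier K; x \<in> carrier A\<rbrakk> \<Longrightarrow>
      h (\<iota> (k \<oplus>\<^bsub>K\<^esub> l) \<odot>\<^bsub>A\<^esub> x) = h ((\<iota> k \<oplus>\<^bsub>B\<^esub> \<iota> l) \<odot>\<^bsub>A\<^esub> x)"
    and \<iota>_mult: "\<And>k l x. \<lbrakk>k \<in> carrier K; l \<in> carrier K; x \<in> carrier A\<rbrakk> \<Longrightarrow>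
      h (\<iota> (k \<otimes>\<^bsub>K\<^esub> l) \<odot>\<^bsub>A\<^esub> x) = h ((\<iota> k \<otimes>\<^bsub>B\<^esub> \<iota> l) \<odot>\<^bsub>A\<^esub> x)"
    and \<iota>_one: "\<And>x. x \<in> carrier A \<Longrightarrow> h (\<iota> \<one>\<^bsub>K\<^esub> \<odot>\<^bsub>A\<^esub> x) = h x"
    and \<iota>_zero: "\<And>x. x \<in> carrier A \<Longrightarrow> h (\<iota> \<zero>\<^bsub>K\<^esub> \<odot>\<^bsub>A\<^esub> x) = h \<zero>\<^bsub>A\<^esub>"
  shows "semialgebra K Q"
proof -
  interpret A: semialg B A by unfold_locales fact
  interpret K: semiring K by fact
  show ?thesis
    unfolding semialgebra_def
    using K semiring_image[OF A.A.semiring_axioms car add mult zero one]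
    by (auto simp: car add mult zero one smult \<iota> \<iota>_add \<iota>_mult \<iota>_one \<iota>_zero A.smult_l_distr
        A.smult_r_distr A.smult_assoc A.smult_mult_l A.smult_mult_r)
qed

lemma ordered_module_image:
  assumes A: "ordered_module B A" and car: "carrier Q = h ` carrier A"
    and add: "\<And>x y. \<lbrakk>x \<in> carrier A; y \<in> carrier A\<rbrakk> \<Longrightarrow> h x \<oplus>\<^bsub>Q\<^esub> h y = h (x \<oplus>\<^bsub>A\<^esub> y)"
    and zero: "\<zero>\<^bsub>Q\<^esub> = h \<zero>\<^bsub>A\<^esub>"
    and smult: "\<And>k x. \<lbrakk>k \<in> carrier B; x \<in> carrier A\<rbrakk> \<Longrightarrow> k \<odot>\<^bsub>Q\<^esub> h x = h (k \<odot>\<^bsub>A\<^esub> x)"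
    and mle: "mle Q = (\<lambda>(x, y). (h x, h y)) ` mle A"
    and inj: "inj_on h (carrier A)"
  shows "ordered_module B Q"
proof -
  interpret A: ordered_module B A by fact
  interpret Q: abelian_monoid Q
    using abelian_monoid_image[OF A.abelian_monoid_axioms car add zero] .
  note cl = preorder_on_carrier[OF A.mle_preorder]
  have pre: "preorder_on (carrier Q) (mle Q)"
  proof (rule preorder_onI)
    fix X Y assume "(X, Y) \<in> mle Q" then show "X \<in> carrier Q \<and> Y \<in> carrier Q"
      using cl by (auto simp: mle car)
  next
    fix X assume "X \<in> carrier Q" then show "(X, X) \<in> mle Q"
      using preorder_on_refl[OF A.mle_preorder] by (force simp: mle car)
  next
    fix X Y Z assume "(X, Y) \<in> mle Q" "(Y, Z) \<in> mle Q"
    then obtain x y y' z where *: "(x, y) \<in> mle A" "(y', z) \<in> mle A" "h y = h y'" "X = h x" "Z = h z"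
      unfolding mle by auto
    then have "y = y'"
      using cl inj by (metis inj_onD)
    then have "(x, z) \<in> mle A"
      using * preorder_on_trans[OF A.mle_preorder] by blast
    then show "(X, Z) \<in> mle Q"
      using * by (auto simp: mle)
  qed
  have anti: "antisym (mle Q)"
  proof (rule antisymI)
    fix X Y assume "(X, Y) \<in> mle Q" "(Y, X) \<in> mle Q"
    then obtain x y x' y' where *: "(x, y) \<in> mle A" "(y', x') \<in> mle A" "h y = h y'" "h x = h x'" "X = h x" "Y = h y"
      unfolding mle by auto
    then have "y = y'" "x = x'"
      using cl inj by (metis inj_onD)+
    then show "X = Y"
      using * A.mle_antisym by blast
  qed
  have "add_compat Q (mle Q)"
  proof (rule add_compatI)
    fix X Y Z assume "(X, Y) \<in> mle Q" "Z \<in> carrier Q"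
    then obtain x y z where *: "(x, y) \<in> mle A" "z \<in> carrier A" "X = h x" "Y = h y" "Z = h z"
      unfolding mle car by auto
    then have "(x \<oplus>\<^bsub>A\<^esub> z, y \<oplus>\<^bsub>A\<^esub> z) \<in> mle A"
      by (intro add_compatD[OF A.mle_add])
    then show "(X \<oplus>\<^bsub>Q\<^esub> Z, Y \<oplus>\<^bsub>Q\<^esub> Z) \<in> mle Q"
      using * cl by (force simp: mle add)
  qed
  moreover have "(a \<odot>\<^bsub>Q\<^esub> X, b \<odot>\<^bsub>Q\<^esub> Y) \<in> mle Q" if ab: "(a, b) \<in> ble B" and XY: "(X, Y) \<in> mle Q" for a b X Y
  proof -
    obtain x y where *: "(x, y) \<in> mle A" "X = h x" "Y = h y"
      using XY unfolding mle by auto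
    then have "(a \<odot>\<^bsub>A\<^esub> x, b \<odot>\<^bsub>A\<^esub> y) \<in> mle A"
      by (intro A.mle_smult ab)
    then show ?thesis
      using * cl[of x y] preorder_on_carrier[OF A.B.ble_preorder ab] by (force simp: mle smult)
  qed
  ultimately show ?thesis
    using pre anti
    by unfold_locales
      (auto simp: car add zero smult partial_order_on_def A.smult_l_distr A.smult_r_distr A.smult_assoc)
qed


section \<open>Sums over multisets\<close>

text \<open>
  The sum of a family over a multiset in the additive monoid of a record, defined along an arbitrary
  listing of the multiset. It is the value that a bilinear map gives to a formal sum of pairs.
\<close>

definition msum :: "('a, 'z) ring_scheme \<Rightarrow> ('x \<Rightarrow> 'a) \<Rightarrow> 'x multiset \<Rightarrow> 'a"
  where "msum A \<phi> X = fold (\<lambda>x a. \<phi> x \<oplus>\<^bsub>A\<^esub> a) (SOME xs. mset xs = X) \<zero>\<^bsub>A\<^esub>"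

context abelian_monoid
begin

lemma msum_mset:
  assumes "\<And>x. x \<in> set xs \<Longrightarrow> \<phi> x \<in> carrier G"
  shows "msum G \<phi> (mset xs) = fold (\<lambda>x a. \<phi> x \<oplus> a) xs \<zero>"
proof -
  define ys where "ys = (SOME ys. mset ys = mset xs)"
  have ys: "mset ys = mset xs"
    unfolding ys_def by (rule someI[of _ xs]) simp
  have "fold (\<lambda>x a. \<phi> x \<oplus> a) ys \<zero> = fold (\<lambda>x a. \<phi> x \<oplus> a) xs \<zero>"
  proof (rule fold_permuted_eq[where P = "\<lambda>z. z \<in> carrier G", OF ys])
    have "set ys = set xs"
      using ys by (metis set_mset_mset)
    then show "x \<in> set ys \<Longrightarrow> z \<in> carrier G \<Longrightarrow> \<phi> x \<oplus> z \<in> carrier G"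
      and "x \<in> set ys \<Longrightarrow> y \<in> set ys \<Longrightarrow> z \<in> carrier G \<Longrightarrow> \<phi> x \<oplus> (\<phi> y \<oplus> z) = \<phi> y \<oplus> (\<phi> x \<oplus> z)" for x y z
      using assms a_lcomm by auto
  qed simp
  then show ?thesis
    by (simp add: msum_def ys_def)
qed

lemma msum_empty [simp]: "msum G \<phi> {#} = \<zero>"
  using msum_mset[of "[]" \<phi>] by simp

lemma msum_add_mset [simp]:
  assumes "\<phi> x \<in> carrier G" "\<And>y. y \<in># X \<Longrightarrow> \<phi> y \<in> carrier G"
  shows "msum G \<phi> (add_mset x X) = \<phi> x \<oplus> msum G \<phi> X"
proof -
  obtain xs where xs: "mset xs = X"
    using ex_mset by blast
  have "msum G \<phi> (mset (xs @ [x])) = \<phi> x \<oplus> msum G \<phi> (mset xs)"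
    using assms xs by (subst (1 2) msum_mset) auto
  then show ?thesis
    using xs by simp
qed

lemma msum_single [simp]: "\<phi> x \<in> carrier G \<Longrightarrow> msum G \<phi> {#x#} = \<phi> x"
  by (subst msum_add_mset) auto

lemma msum_pair: "\<phi> x \<in> carrier G \<Longrightarrow> \<phi> y \<in> carrier G \<Longrightarrow> msum G \<phi> {#x, y#} = \<phi> x \<oplus> \<phi> y"
  by (subst msum_add_mset) auto

lemma msum_closed [simp, intro]:
  "(\<And>x. x \<in># X \<Longrightarrow> \<phi> x \<in> carrier G) \<Longrightarrow> msum G \<phi> X \<in> carrier G"
  by (induction X) auto

lemma msum_union:
  "\<lbrakk>\<And>x. x \<in># X \<Longrightarrow> \<phi> x \<in> carrier G; \<And>x. x \<in># Y \<Longrightarrow> \<phi> x \<in> carrier G\<rbrakk> \<Longrightarrow>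
   msum G \<phi> (X + Y) = msum G \<phi> X \<oplus> msum G \<phi> Y"
proof (induction X)
  case (add x X)
  have "msum G \<phi> (add_mset x (X + Y)) = \<phi> x \<oplus> msum G \<phi> (X + Y)"
    by (rule msum_add_mset) (use add.prems in auto)
  then show ?case
    using add by (simp add: a_assoc)
qed simp

lemma msum_cong:
  "\<lbrakk>\<And>x. x \<in># X \<Longrightarrow> \<phi> x = \<psi> x; \<And>x. x \<in># X \<Longrightarrow> \<psi> x \<in> carrier G\<rbrakk> \<Longrightarrow> msum G \<phi> X = msum G \<psi> X"
  by (induction X) auto

lemma msum_image_mset:
  "(\<And>x. x \<in># X \<Longrightarrow> \<phi> (f x) \<in> carrier G) \<Longrightarrow> msum G \<phi> (image_mset f X) = msum G (\<lambda>x. \<phi> (f x)) X"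
proof (induction X)
  case (add x X)
  have "msum G \<phi> (add_mset (f x) (image_mset f X)) = \<phi> (f x) \<oplus> msum G \<phi> (image_mset f X)"
    by (rule msum_add_mset) (use add.prems in auto)
  then show ?case
    using add by simp
qed simp

end

lemma msum_hom:
  assumes "abelian_monoid G" "abelian_monoid H"
    and "\<And>x. x \<in> carrier G \<Longrightarrow> h x \<in> carrier H" and "h \<zero>\<^bsub>G\<^esub> = \<zero>\<^bsub>H\<^esub>"
    and "\<And>x y. x \<in> carrier G \<Longrightarrow> y \<in> carrier G \<Longrightarrow> h (x \<oplus>\<^bsub>G\<^esub> y) = h x \<oplus>\<^bsub>H\<^esub> h y"
    and "\<And>x. x \<in># X \<Longrightarrow> \<phi> x \<in> carrier G"
  shows "h (msum G \<phi> X) = msum H (\<lambda>x. h (\<phi> x)) X"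
proof -
  interpret G: abelian_monoid G by fact
  interpret H: abelian_monoid H by fact
  show ?thesis
    using assms(6) by (induction X) (auto simp: assms(3,4,5))
qed

section \<open>Tensor products of ordered modules\<close>

locale tensor_pair = M: ordered_module B M + N: ordered_module B N
  for B :: "('b, 'z) oblueprint_scheme" and M :: "('b, 'm, 'y) blue_module_scheme"
    and N :: "('b, 'n, 'x) blue_module_scheme"
begin

abbreviation forms :: "('m \<times> 'n) multiset set"
  where "forms \<equiv> {X. set_mset X \<subseteq> carrier M \<times> carrier N}"

abbreviation act :: "'b \<Rightarrow> ('m \<times> 'n) multiset \<Rightarrow> ('m \<times> 'n) multiset"
  where "act b \<equiv> image_mset (\<lambda>(x, y). (b \<odot>\<^bsub>M\<^esub> x, y))"

abbreviation cong :: "(('m \<times> 'n) multiset \<times> ('m \<times> 'n) multiset) set"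
  where "cong \<equiv> tensor_cong B M N"

lemma forms_act: "b \<in> carrier B \<Longrightarrow> X \<in> forms \<Longrightarrow> act b X \<in> forms"
  by auto

lemma bilinear_rels_forms: "(X, Y) \<in> bilinear_rels B M N \<Longrightarrow> X \<in> forms \<and> Y \<in> forms"
  by (auto simp: bilinear_rels_def)

lemma bilinear_relsI:
  "\<lbrakk>x \<in> carrier M; x' \<in> carrier M; y \<in> carrier N\<rbrakk> \<Longrightarrow>
    ({#(x \<oplus>\<^bsub>M\<^esub> x', y)#}, {#(x, y), (x', y)#}) \<in> bilinear_rels B M N"
  "\<lbrakk>x \<in> carrier M; y \<in> carrier N; y' \<in> carrier N\<rbrakk> \<Longrightarrow>
    ({#(x, y \<oplus>\<^bsub>N\<^esub> y')#}, {#(x, y), (x, y')#}) \<in> bilinear_rels B M N"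
  "y \<in> carrier N \<Longrightarrow> ({#(\<zero>\<^bsub>M\<^esub>, y)#}, {#}) \<in> bilinear_rels B M N"
  "x \<in> carrier M \<Longrightarrow> ({#(x, \<zero>\<^bsub>N\<^esub>)#}, {#}) \<in> bilinear_rels B M N"
  "\<lbrakk>b \<in> carrier B; x \<in> carrier M; y \<in> carrier N\<rbrakk> \<Longrightarrow>
    ({#(b \<odot>\<^bsub>M\<^esub> x, y)#}, {#(x, b \<odot>\<^bsub>N\<^esub> y)#}) \<in> bilinear_rels B M N"
  by (unfold bilinear_rels_def) blast+

lemma tensor_cong_least:
  assumes "preorder_on forms E" "sym E" "\<And>X Y Z. (X, Y) \<in> E \<Longrightarrow> Z \<in> forms \<Longrightarrow> (X + Z, Y + Z) \<in> E"
    and "bilinear_rels B M N \<subseteq> E"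
  shows "cong \<subseteq> E"
  using assms unfolding tensor_cong_def
  by (auto simp: formal_tensors_def add_compat_def equiv_iff_sym_preorder)

lemma
  shows cong_preorder: "preorder_on forms cong"
    and cong_sym: "(X, Y) \<in> cong \<Longrightarrow> (Y, X) \<in> cong"
    and cong_add: "(X, Y) \<in> cong \<Longrightarrow> Z \<in> forms \<Longrightarrow> (X + Z, Y + Z) \<in> cong"
    and cong_rels: "bilinear_rels B M N \<subseteq> cong"
proof -
  let ?E = "{E. equiv (carrier (formal_tensors M N)) E \<and> add_compat (formal_tensors M N) E \<and>
        bilinear_rels B M N \<subseteq> E}"
  have "forms \<times> forms \<in> ?E"
    using bilinear_rels_forms
    by (auto simp: equiv_def refl_on_def trans_def sym_def add_compat_def formal_tensors_def)
  then show "preorder_on forms cong"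
    unfolding tensor_cong_def
    by (intro preorder_on_Inter) (auto simp: equiv_iff_sym_preorder formal_tensors_def)
  show "(X, Y) \<in> cong \<Longrightarrow> (Y, X) \<in> cong"
    by (auto simp: tensor_cong_def equiv_def dest: symD)
  show "(X, Y) \<in> cong \<Longrightarrow> Z \<in> forms \<Longrightarrow> (X + Z, Y + Z) \<in> cong"
    using add_compatD[of "formal_tensors M N" _ X Y Z] by (auto simp: tensor_cong_def formal_tensors_def)
  show "bilinear_rels B M N \<subseteq> cong"
    by (auto simp: tensor_cong_def)
qed

lemmas cong_trans = preorder_on_trans[OF cong_preorder]

lemma cong_add2: "(X, X') \<in> cong \<Longrightarrow> (Y, Y') \<in> cong \<Longrightarrow> (X + Y, X' + Y') \<in> cong"
  using cong_add[of X X' Y] cong_add[of Y Y' X'] preorder_on_carrier[OF cong_preorder] cong_trans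
  by (metis add.commute)

text \<open>
  The tensor congruence is generated from the bilinearity relations by addition alone. That scalars
  respect it follows from the stability of these relations under scalars, which uses that \<open>B\<close> is
  commutative.
\<close>

lemma cong_act:
  assumes "(X, Y) \<in> cong" and b: "b \<in> carrier B"
  shows "(act b X, act b Y) \<in> cong"
proof -
  define E where "E = {(X, Y). X \<in> forms \<and> Y \<in> forms \<and> (act b X, act b Y) \<in> cong}"
  have "cong \<subseteq> E"
  proof (rule tensor_cong_least)
    show "preorder_on forms E"
    proof (rule preorder_onI)
      fix X assume "X \<in> forms"
      then show "(X, X) \<in> E"
        using preorder_on_refl[OF cong_preorder forms_act[OF b]] by (simp add: E_def)
    next
      fix X Y Z assume "(X, Y) \<in> E" "(Y, Z) \<in> E"
      then show "(X, Z) \<in> E"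
        using cong_trans[of "act b X" "act b Y" "act b Z"] by (simp add: E_def)
    qed (simp add: E_def)
    show "sym E"
      using cong_sym by (auto simp: sym_def E_def)
    show "(X + Z, Y + Z) \<in> E" if "(X, Y) \<in> E" "Z \<in> forms" for X Y Z
      using that cong_add[of "act b X" "act b Y" "act b Z"] forms_act[OF b, of Z] by (auto simp: E_def)
    have "(act b X, act b Y) \<in> bilinear_rels B M N" if "(X, Y) \<in> bilinear_rels B M N" for X Y
    proof -
      have "(b \<odot>\<^bsub>M\<^esub> (c \<odot>\<^bsub>M\<^esub> x)) = c \<odot>\<^bsub>M\<^esub> (b \<odot>\<^bsub>M\<^esub> x)" if "c \<in> carrier B" "x \<in> carrier M" for c x
        using that b by (simp add: M.smult_assoc[symmetric] M.B.m_comm)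
      then show ?thesis
        using that[unfolded bilinear_rels_def] b
        by (elim UnE CollectE exE conjE) (auto simp: M.smult_r_distr intro: bilinear_relsI)
    qed
    then show "bilinear_rels B M N \<subseteq> E"
      using cong_rels bilinear_rels_forms unfolding E_def by blast
  qed
  then show ?thesis
    using assms(1) by (auto simp: E_def)
qed

abbreviation semi where "semi \<equiv> semitensor B M N"
abbreviation tpre where "tpre \<equiv> tensor_preorder B M N"

lemma semi_carrier: "carrier semi = cls cong ` forms"
  by (simp add: semitensor_def module_quot_def ring_quot_def module.defs ring.defs formal_tensors_def)

lemma semi_zero: "\<zero>\<^bsub>semi\<^esub> = cls cong {#}"
  by (simp add: semitensor_def module_quot_def ring_quot_def module.defs ring.defs formal_tensors_def)

lemma semi_add: "X \<in> forms \<Longrightarrow> Y \<in> forms \<Longrightarrow> cls cong X \<oplus>\<^bsub>semi\<^esub> cls cong Y = cls cong (X + Y)"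
  using lift2_cls[OF cong_preorder, of X Y "(+)"] cong_add2
  by (simp add: semitensor_def module_quot_def ring_quot_def module.defs ring.defs formal_tensors_def)

lemma semi_smult: "b \<in> carrier B \<Longrightarrow> X \<in> forms \<Longrightarrow> b \<odot>\<^bsub>semi\<^esub> cls cong X = cls cong (act b X)"
  using lift1_cls[OF cong_preorder, of X "act b"] cong_act
  by (simp add: semitensor_def module_quot_def ring_quot_def module.defs ring.defs formal_tensors_def)

lemma semi_mle: "mle semi = Id_on (carrier semi)"
  by (simp add: semitensor_def module_quot_def ring_quot_def module.defs ring.defs omodule.defs formal_tensors_def)

abbreviation tensor_gens where
  "tensor_gens \<equiv> {(cls cong {#(x1, y1)#}, cls cong {#(x2, y2)#}) | x1 y1 x2 y2.
     (x1, x2) \<in> mle M \<and> (y1, y2) \<in> mle N}"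

lemma tpre_additive: "additive_preorder B semi tpre"
  and tpre_pairs: "tensor_gens \<subseteq> tpre"
proof -
  have c1: "x \<oplus>\<^bsub>semi\<^esub> y \<in> carrier semi" if xy: "x \<in> carrier semi" "y \<in> carrier semi" for x y
  proof -
    obtain X Y where "X \<in> forms" "Y \<in> forms" "x = cls cong X" "y = cls cong Y"
      using xy by (auto simp: semi_carrier)
    then show ?thesis
      by (simp add: semi_add) (simp add: semi_carrier)
  qed
  have c2: "a \<odot>\<^bsub>semi\<^esub> x \<in> carrier semi \<and> b \<odot>\<^bsub>semi\<^esub> x \<in> carrier semi"
    if ab: "(a, b) \<in> ble B" and x: "x \<in> carrier semi" for a b x
  proof -
    obtain X where "X \<in> forms" "x = cls cong X"
      using x by (auto simp: semi_carrier)
    then show ?thesis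
      using preorder_on_carrier[OF M.B.ble_preorder ab] forms_act by (simp add: semi_smult) (auto simp: semi_carrier)
  qed
  have c3: "mle semi \<subseteq> carrier semi \<times> carrier semi"
    by (auto simp: semi_mle)
  have c4: "tensor_gens \<subseteq> carrier semi \<times> carrier semi"
    using preorder_on_carrier[OF M.mle_preorder] preorder_on_carrier[OF N.mle_preorder]
    by (force simp: semi_carrier)
  show "additive_preorder B semi tpre"
    unfolding tensor_preorder_def by (rule gen_additive_preorder_additive[OF c1 c2 c3 c4])
  show "tensor_gens \<subseteq> tpre"
    unfolding tensor_preorder_def by (rule gen_additive_preorder_rels[OF c1 c2 c3 c4])
qed

lemmas tpre_preorder = tpre_additive[unfolded additive_preorder_def, THEN conjunct1]

text \<open>The preorder which the tensor product induces on formal sums of pairs.\<close>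

definition tle :: "(('m \<times> 'n) multiset \<times> ('m \<times> 'n) multiset) set"
  where "tle = {(X, Y). X \<in> forms \<and> Y \<in> forms \<and> (cls cong X, cls cong Y) \<in> tpre}"

lemma tle_preorder: "preorder_on forms tle"
proof (rule preorder_onI)
  fix X assume "X \<in> forms"
  then show "(X, X) \<in> tle"
    using preorder_on_refl[OF tpre_preorder] by (simp add: tle_def semi_carrier)
next
  fix X Y Z assume "(X, Y) \<in> tle" "(Y, Z) \<in> tle"
  then show "(X, Z) \<in> tle"
    using preorder_on_trans[OF tpre_preorder, of "cls cong X" "cls cong Y" "cls cong Z"] by (simp add: tle_def)
qed (simp add: tle_def)

lemmas tle_trans = preorder_on_trans[OF tle_preorder]
  and tle_forms = preorder_on_carrier[OF tle_preorder]

lemma tle_add: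
  assumes "(X, Y) \<in> tle" "Z \<in> forms"
  shows "(X + Z, Y + Z) \<in> tle"
proof -
  have "add_compat semi tpre"
    using tpre_additive by (simp add: additive_preorder_def)
  then have "(cls cong X \<oplus>\<^bsub>semi\<^esub> cls cong Z, cls cong Y \<oplus>\<^bsub>semi\<^esub> cls cong Z) \<in> tpre"
    by (rule add_compatD) (use assms in \<open>auto simp: tle_def semi_carrier\<close>)
  then show ?thesis
    using assms by (simp add: tle_def semi_add)
qed

lemma tle_add2: "(X, X') \<in> tle \<Longrightarrow> (Y, Y') \<in> tle \<Longrightarrow> (X + Y, X' + Y') \<in> tle"
  using tle_add[of X X' Y] tle_add[of Y Y' X'] tle_forms tle_trans
  by (metis add.commute)

lemma tle_act:
  assumes ab: "(a, b) \<in> ble B" and XY: "(X, Y) \<in> tle"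
  shows "(act a X, act b Y) \<in> tle"
proof -
  have *: "(a \<odot>\<^bsub>semi\<^esub> cls cong X, b \<odot>\<^bsub>semi\<^esub> cls cong Y) \<in> tpre"
    using tpre_additive assms by (auto simp: additive_preorder_def tle_def)
  have c: "a \<in> carrier B" "b \<in> carrier B" "X \<in> forms" "Y \<in> forms"
    using preorder_on_carrier[OF M.B.ble_preorder ab] tle_forms[OF XY] by auto
  show ?thesis
    using * c forms_act[OF c(1,3)] forms_act[OF c(2,4)] by (simp add: tle_def semi_smult)
qed

lemma tle_act_same: "b \<in> carrier B \<Longrightarrow> (X, Y) \<in> tle \<Longrightarrow> (act b X, act b Y) \<in> tle"
  by (rule tle_act) (rule preorder_on_refl[OF M.B.ble_preorder])

lemma cong_imp_tle: "(X, Y) \<in> cong \<Longrightarrow> (X, Y) \<in> tle"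
  using preorder_on_refl[OF tpre_preorder] cls_eqI[OF cong_preorder, of X Y] cong_sym
    preorder_on_carrier[OF cong_preorder, of X Y]
  by (simp add: tle_def semi_carrier)

lemma tle_pairs:
  assumes "(x1, x2) \<in> mle M" "(y1, y2) \<in> mle N"
  shows "({#(x1, y1)#}, {#(x2, y2)#}) \<in> tle"
proof -
  have "(cls cong {#(x1, y1)#}, cls cong {#(x2, y2)#}) \<in> tpre"
    by (rule subsetD[OF tpre_pairs]) (use assms in blast)
  then show ?thesis
    using preorder_on_carrier[OF M.mle_preorder assms(1)] preorder_on_carrier[OF N.mle_preorder assms(2)]
    by (simp add: tle_def)
qed

text \<open>
  A preorder on formal sums that contains the bilinearity relations and the order on pure tensors,
  and is compatible with sums and scalars, contains the tensor preorder: it contains the tensor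
  congruence, therefore it descends to classes, and there it is one of the preorders among which
  the tensor preorder is least.
\<close>

lemma tle_least:
  assumes r: "preorder_on forms r" and add: "\<And>X Y Z. (X, Y) \<in> r \<Longrightarrow> Z \<in> forms \<Longrightarrow> (X + Z, Y + Z) \<in> r"
    and smult: "\<And>a b X Y. (a, b) \<in> ble B \<Longrightarrow> (X, Y) \<in> r \<Longrightarrow> (act a X, act b Y) \<in> r"
    and rels: "\<And>X Y. (X, Y) \<in> bilinear_rels B M N \<Longrightarrow> (X, Y) \<in> r \<and> (Y, X) \<in> r"
    and pairs: "\<And>x1 x2 y1 y2. (x1, x2) \<in> mle M \<Longrightarrow> (y1, y2) \<in> mle N \<Longrightarrow> ({#(x1, y1)#}, {#(x2, y2)#}) \<in> r"
  shows "tle \<subseteq> r"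
proof -
  note rc = preorder_on_carrier[OF r] and rt = preorder_on_trans[OF r]
  have cr: "cong \<subseteq> r"
  proof -
    have "cong \<subseteq> r \<inter> r\<inverse>"
    proof (rule tensor_cong_least)
      show "preorder_on forms (r \<inter> r\<inverse>)"
        by (rule preorder_onI) (use rc rt preorder_on_refl[OF r] in blast)+
      show "sym (r \<inter> r\<inverse>)"
        by (auto simp: sym_def)
    qed (use add rels in auto)
    then show ?thesis by blast
  qed
  define q where "q = (\<lambda>(X, Y). (cls cong X, cls cong Y)) ` r"
  have q: "(X, Y) \<in> r" if "(cls cong X, cls cong Y) \<in> q" "X \<in> forms" "Y \<in> forms" for X Y
  proof -
    obtain X' Y' where *: "(X', Y') \<in> r" "cls cong X = cls cong X'" "cls cong Y = cls cong Y'"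
      using \<open>_ \<in> q\<close> by (auto simp: q_def)
    have "(X, X') \<in> cong" "(Y', Y) \<in> cong"
      using * cls_eq_iff[OF cong_preorder that(2)] cls_eq_iff[OF cong_preorder that(3)] by auto
    then show ?thesis
      using * cr rt by blast
  qed
  have qI: "(cls cong X, cls cong Y) \<in> q" if "(X, Y) \<in> r" for X Y
    using that by (force simp: q_def)
  have qE: "\<exists>X Y. (X, Y) \<in> r \<and> X \<in> forms \<and> Y \<in> forms \<and> x = cls cong X \<and> y = cls cong Y" if "(x, y) \<in> q" for x y
    using that rc by (fastforce simp: q_def)
  have "additive_preorder B semi q"
    unfolding additive_preorder_def
  proof (intro conjI)
    show "preorder_on (carrier semi) q"
    proof (rule preorder_onI)
      fix x y assume "(x, y) \<in> q" then show "x \<in> carrier semi \<and> y \<in> carrier semi"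
        using qE by (force simp: semi_carrier)
    next
      fix x assume "x \<in> carrier semi"
      then show "(x, x) \<in> q"
        using preorder_on_refl[OF r] qI by (force simp: semi_carrier)
    next
      fix x y z assume xy: "(x, y) \<in> q" and yz: "(y, z) \<in> q"
      obtain X Y where X: "(X, Y) \<in> r" "Y \<in> forms" "x = cls cong X" "y = cls cong Y"
        using qE[OF xy] by blast
      obtain Z where Z: "Z \<in> forms" "z = cls cong Z"
        using qE[OF yz] by blast
      have "(Y, Z) \<in> r"
        using q[of Y Z] yz X Z by blast
      then show "(x, z) \<in> q"
        unfolding X(3) Z(2) by (intro qI rt[OF X(1)])
    qed
    show "add_compat semi q"
    proof (rule add_compatI)
      fix x y z assume "(x, y) \<in> q" and z: "z \<in> carrier semi"
      then obtain X Y where XY: "(X, Y) \<in> r" "X \<in> forms" "Y \<in> forms" "x = cls cong X" "y = cls cong Y"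
        using qE by blast
      obtain Z where "Z \<in> forms" "z = cls cong Z"
        using z by (auto simp: semi_carrier)
      then show "(x \<oplus>\<^bsub>semi\<^esub> z, y \<oplus>\<^bsub>semi\<^esub> z) \<in> q"
        using XY qI[OF add, of X Y Z] by (simp add: semi_add)
    qed
    show "mle semi \<subseteq> q"
      using preorder_on_refl[OF r] qI by (force simp: semi_mle semi_carrier)
    have "(a \<odot>\<^bsub>semi\<^esub> x, b \<odot>\<^bsub>semi\<^esub> y) \<in> q" if ab: "(a, b) \<in> ble B" and xy: "(x, y) \<in> q" for a b x y
    proof -
      obtain X Y where XY: "(X, Y) \<in> r" "X \<in> forms" "Y \<in> forms" "x = cls cong X" "y = cls cong Y"
        using qE[OF xy] by blast
      then show ?thesis
        using qI[OF smult, OF ab XY(1)] preorder_on_carrier[OF M.B.ble_preorder ab] by (simp add: semi_smult)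
    qed
    then show "\<forall>(a, b)\<in>ble B. \<forall>(x, y)\<in>q. (a \<odot>\<^bsub>semi\<^esub> x, b \<odot>\<^bsub>semi\<^esub> y) \<in> q"
      by auto
  qed
  moreover have "tensor_gens \<subseteq> q"
    using pairs qI by blast
  ultimately have "tpre \<subseteq> q"
    unfolding tensor_preorder_def by (rule gen_additive_preorder_least)
  then show ?thesis
    using q by (auto simp: tle_def)
qed


subsection \<open>The tensor product as a quotient of formal sums\<close>

text \<open>
  The element of the tensor product represented by a formal sum. An element is a class of classes,
  for the order and for the congruence in turn; in terms of representatives it is a class for
  \<open>tle\<close>.
\<close>

definition st :: "('m \<times> 'n) multiset \<Rightarrow> ('m \<times> 'n) multiset set set"
  where "st X = tensor_class B M N X"

abbreviation tp where "tp \<equiv> tensor_product B M N"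

lemma tp_carrier: "carrier tp = st ` forms"
  by (auto simp: tensor_product_def omodule_quot_def module_quot_def ring_quot_def omodule.defs module.defs
      ring.defs semi_carrier[unfolded semitensor_def module_quot_def ring_quot_def module.defs ring.defs] semi_carrier image_image st_def tensor_class_def)

lemma st_eq_iff: "X \<in> forms \<Longrightarrow> Y \<in> forms \<Longrightarrow> st X = st Y \<longleftrightarrow> (X, Y) \<in> tle \<and> (Y, X) \<in> tle"
  unfolding st_def tensor_class_def by (subst cls_eq_iff[OF tpre_preorder]) (auto simp: semi_carrier tle_def)

lemma tp_zero: "\<zero>\<^bsub>tp\<^esub> = st {#}"
  by (simp add: tensor_product_def omodule_quot_def module_quot_def ring_quot_def omodule.defs module.defs
      ring.defs semi_zero st_def tensor_class_def)

lemma tp_add: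
  assumes "X \<in> forms" "Y \<in> forms"
  shows "st X \<oplus>\<^bsub>tp\<^esub> st Y = st (X + Y)"
proof -
  have "st X \<oplus>\<^bsub>tp\<^esub> st Y = lift2 tpre (add semi) (cls tpre (cls cong X)) (cls tpre (cls cong Y))"
    by (simp add: tensor_product_def omodule_quot_def module_quot_def ring_quot_def omodule.defs module.defs
      ring.defs st_def tensor_class_def)
  also have "\<dots> = cls tpre (cls cong X \<oplus>\<^bsub>semi\<^esub> cls cong Y)"
  proof (rule lift2_cls[OF tpre_preorder])
    fix x x' y y' assume *: "(x, x') \<in> tpre" "(y, y') \<in> tpre"
    then obtain X X' Y Y' where "X \<in> forms" "X' \<in> forms" "Y \<in> forms" "Y' \<in> forms"
       "x = cls cong X" "x' = cls cong X'" "y = cls cong Y" "y' = cls cong Y'"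
      using preorder_on_carrier[OF tpre_preorder *(1)] preorder_on_carrier[OF tpre_preorder *(2)]
      unfolding semi_carrier by blast
    then show "(x \<oplus>\<^bsub>semi\<^esub> y, x' \<oplus>\<^bsub>semi\<^esub> y') \<in> tpre"
      using * tle_add2[of X X' Y Y'] by (simp add: semi_add tle_def)
  qed (use assms in \<open>auto simp: semi_carrier\<close>)
  finally show ?thesis
    using assms by (simp add: semi_add st_def tensor_class_def)
qed

lemma tp_smult:
  assumes b: "b \<in> carrier B" and X: "X \<in> forms"
  shows "b \<odot>\<^bsub>tp\<^esub> st X = st (act b X)"
proof -
  have "b \<odot>\<^bsub>tp\<^esub> st X = lift1 tpre (smult semi b) (cls tpre (cls cong X))"
    by (simp add: tensor_product_def omodule_quot_def module_quot_def ring_quot_def omodule.defs module.defs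
      ring.defs st_def tensor_class_def)
  also have "\<dots> = cls tpre (b \<odot>\<^bsub>semi\<^esub> cls cong X)"
  proof (rule lift1_cls[OF tpre_preorder])
    fix x x' assume *: "(x, x') \<in> tpre"
    then obtain X X' where "X \<in> forms" "X' \<in> forms" "x = cls cong X" "x' = cls cong X'"
      using preorder_on_carrier[OF tpre_preorder *] unfolding semi_carrier by blast
    then show "(b \<odot>\<^bsub>semi\<^esub> x, b \<odot>\<^bsub>semi\<^esub> x') \<in> tpre"
      using * tle_act_same[OF b, of X X'] b by (simp add: semi_smult tle_def)
  qed (use X in \<open>auto simp: semi_carrier\<close>)
  finally show ?thesis
    using assms by (simp add: semi_smult st_def tensor_class_def)
qed

lemma tp_mle_eq: "mle tp = (\<lambda>(X, Y). (cls tpre X, cls tpre Y)) ` tpre"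
  by (simp add: tensor_product_def omodule_quot_def omodule.defs module.defs)

lemma tp_mle_iff: "X \<in> forms \<Longrightarrow> Y \<in> forms \<Longrightarrow> (st X, st Y) \<in> mle tp \<longleftrightarrow> (X, Y) \<in> tle"
  unfolding tp_mle_eq st_def tensor_class_def
  by (subst cls_image_mem_iff[OF tpre_preorder]) (auto simp: semi_carrier tle_def)

lemma tp_mle_order: "partial_order_on (carrier tp) (mle tp)"
proof -
  have "carrier tp = cls tpre ` carrier semi"
    by (auto simp: tp_carrier semi_carrier st_def tensor_class_def)
  then show ?thesis
    using partial_order_cls_image[OF tpre_preorder] by (simp add: tp_mle_eq)
qed

lemma tp_mleE:
  assumes "(x, y) \<in> mle tp"
  obtains X Y where "X \<in> forms" "Y \<in> forms" "x = st X" "y = st Y"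
proof -
  have "x \<in> carrier tp" "y \<in> carrier tp"
    using assms partial_order_onD(4)[OF tp_mle_order] by blast+
  then show ?thesis
    using that unfolding tp_carrier by blast
qed

text \<open>
  Additivity in the scalar is not imposed on formal sums; it follows from bilinearity term by term.
\<close>

lemma cong_act_add:
  assumes ab: "a \<in> carrier B" "b \<in> carrier B" and "X \<in> forms"
  shows "(act (a \<oplus>\<^bsub>B\<^esub> b) X, act a X + act b X) \<in> cong"
  using \<open>X \<in> forms\<close>
proof (induction X)
  case (add p X)
  obtain x y where p: "p = (x, y)" "x \<in> carrier M" "y \<in> carrier N"
    using add.prems by auto
  have "({#((a \<oplus>\<^bsub>B\<^esub> b) \<odot>\<^bsub>M\<^esub> x, y)#}, {#(a \<odot>\<^bsub>M\<^esub> x, y), (b \<odot>\<^bsub>M\<^esub> x, y)#}) \<in> bilinear_rels B M N"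
    using ab p unfolding bilinear_rels_def by (auto simp: M.smult_l_distr)
  then have "({#((a \<oplus>\<^bsub>B\<^esub> b) \<odot>\<^bsub>M\<^esub> x, y)#} + act (a \<oplus>\<^bsub>B\<^esub> b) X,
      {#(a \<odot>\<^bsub>M\<^esub> x, y), (b \<odot>\<^bsub>M\<^esub> x, y)#} + (act a X + act b X)) \<in> cong"
    using cong_rels add by (intro cong_add2) auto
  then show ?case
    by (simp add: p(1) add_mset_commute)
qed (use preorder_on_refl[OF cong_preorder, of "{#}"] in simp)

lemma cong_act_zero: "X \<in> forms \<Longrightarrow> (act \<zero>\<^bsub>B\<^esub> X, {#}) \<in> cong"
proof (induction X)
  case (add p X)
  obtain x y where p: "p = (x, y)" "x \<in> carrier M" "y \<in> carrier N"
    using add.prems by auto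
  have "({#(\<zero>\<^bsub>M\<^esub>, y)#}, {#}) \<in> bilinear_rels B M N"
    using p unfolding bilinear_rels_def by auto
  then show ?case
    using cong_add2[of "{#(\<zero>\<^bsub>M\<^esub>, y)#}" "{#}" "act \<zero>\<^bsub>B\<^esub> X" "{#}"] add cong_rels p by auto
qed (use preorder_on_refl[OF cong_preorder, of "{#}"] in simp)

lemma st_cong: "(X, Y) \<in> cong \<Longrightarrow> st X = st Y"
  using st_eq_iff[of X Y] cong_imp_tle cong_sym preorder_on_carrier[OF cong_preorder] by metis

lemma tp_module: "ordered_module B tp"
proof -
  interpret tp: abelian_monoid tp
    by (rule abelian_monoidI) (auto simp: tp_carrier tp_add tp_zero ac_simps)
  have comp: "act a (act b X) = act (a \<otimes>\<^bsub>B\<^esub> b) X" if "a \<in> carrier B" "b \<in> carrier B" "X \<in> forms" for a b X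
    unfolding multiset.map_comp
    by (rule image_mset_cong) (use that in \<open>auto simp: M.smult_assoc\<close>)
  have one: "act \<one>\<^bsub>B\<^esub> X = X" if "X \<in> forms" for X
    using that image_mset_cong[of X "\<lambda>(x, y). (\<one>\<^bsub>B\<^esub> \<odot>\<^bsub>M\<^esub> x, y)" id] by fastforce
  have fo: "act b X \<in> forms" if "b \<in> carrier B" "X \<in> forms" for b X
    using forms_act that .
  show ?thesis
  proof unfold_locales
    fix a b x assume "a \<in> carrier B" "b \<in> carrier B" "x \<in> carrier tp"
    moreover from this obtain X where "X \<in> forms" "x = st X"
      by (auto simp: tp_carrier)
    ultimately show "(a \<oplus>\<^bsub>B\<^esub> b) \<odot>\<^bsub>tp\<^esub> x = a \<odot>\<^bsub>tp\<^esub> x \<oplus>\<^bsub>tp\<^esub> b \<odot>\<^bsub>tp\<^esub> x"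
      using st_cong[OF cong_act_add, of a b X] fo[of a X] fo[of b X] by (simp add: tp_smult tp_add)
  next
    show "add_compat tp (mle tp)"
    proof (rule add_compatI)
      fix x y z assume *: "(x, y) \<in> mle tp" "z \<in> carrier tp"
      obtain X Y where X: "X \<in> forms" and Y: "Y \<in> forms" and xy: "x = st X" "y = st Y"
        by (rule tp_mleE[OF *(1)])
      obtain Z where Z: "Z \<in> forms" "z = st Z"
        using *(2) unfolding tp_carrier by blast
      have "(X + Z, Y + Z) \<in> tle"
        using * X Y Z tp_mle_iff[of X Y] tle_add[of X Y Z] unfolding xy by blast
      then show "(x \<oplus>\<^bsub>tp\<^esub> z, y \<oplus>\<^bsub>tp\<^esub> z) \<in> mle tp"
        using X Y Z tle_forms unfolding xy by (simp add: tp_add tp_mle_iff)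
    qed
  next
    fix a b x y assume ab: "(a, b) \<in> ble B" and *: "(x, y) \<in> mle tp"
    obtain X Y where X: "X \<in> forms" and Y: "Y \<in> forms" and xy: "x = st X" "y = st Y"
      by (rule tp_mleE[OF *])
    have "(act a X, act b Y) \<in> tle"
      using * X Y tp_mle_iff[of X Y] tle_act[OF ab] unfolding xy by blast
    then show "(a \<odot>\<^bsub>tp\<^esub> x, b \<odot>\<^bsub>tp\<^esub> y) \<in> mle tp"
      using X Y preorder_on_carrier[OF M.B.ble_preorder ab] tle_forms[of "act a X" "act b Y"] unfolding xy
      by (simp add: tp_smult tp_mle_iff)
  next
    show "\<zero>\<^bsub>B\<^esub> \<odot>\<^bsub>tp\<^esub> x = \<zero>\<^bsub>tp\<^esub>" if "x \<in> carrier tp" for x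
      using that st_cong[OF cong_act_zero] by (auto simp: tp_carrier tp_zero tp_smult)
  next
    show "b \<odot>\<^bsub>tp\<^esub> x \<in> carrier tp" if "b \<in> carrier B" "x \<in> carrier tp" for b x
    proof -
      from that(2) obtain X where "X \<in> forms" "x = st X"
        by (auto simp: tp_carrier)
      then show ?thesis
        using that fo[of b X] by (simp add: tp_smult) (auto simp: tp_carrier)
    qed
  next
    show "b \<odot>\<^bsub>tp\<^esub> (x \<oplus>\<^bsub>tp\<^esub> y) = b \<odot>\<^bsub>tp\<^esub> x \<oplus>\<^bsub>tp\<^esub> b \<odot>\<^bsub>tp\<^esub> y"
      if "b \<in> carrier B" "x \<in> carrier tp" "y \<in> carrier tp" for b x y
    proof -
      from that(2,3) obtain X Y where "X \<in> forms" "x = st X" "Y \<in> forms" "y = st Y"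
        by (auto simp: tp_carrier)
      then show ?thesis
        using that fo[OF that(1), of X] fo[OF that(1), of Y] by (simp add: tp_add tp_smult)
    qed
  next
    show "(a \<otimes>\<^bsub>B\<^esub> b) \<odot>\<^bsub>tp\<^esub> x = a \<odot>\<^bsub>tp\<^esub> (b \<odot>\<^bsub>tp\<^esub> x)"
      if "a \<in> carrier B" "b \<in> carrier B" "x \<in> carrier tp" for a b x
    proof -
      from that(3) obtain X where "X \<in> forms" "x = st X"
        by (auto simp: tp_carrier)
      then show ?thesis
        using that fo[of b X] comp[of a b X] by (simp add: tp_smult)
    qed
  next
    show "\<one>\<^bsub>B\<^esub> \<odot>\<^bsub>tp\<^esub> x = x" if "x \<in> carrier tp" for x
      using that one by (auto simp: tp_carrier tp_smult)
  next
    show "b \<odot>\<^bsub>tp\<^esub> \<zero>\<^bsub>tp\<^esub> = \<zero>\<^bsub>tp\<^esub>" if "b \<in> carrier B" for b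
      using that by (simp add: tp_zero tp_smult)
  qed (fact tp_mle_order)
qed

end

definition bilinear_map :: "('b, 'z) oblueprint_scheme \<Rightarrow> ('b, 'm, 'y) omodule_scheme \<Rightarrow>
    ('b, 'n, 'x) omodule_scheme \<Rightarrow> ('b, 'l, 'w) omodule_scheme \<Rightarrow> ('m \<times> 'n \<Rightarrow> 'l) \<Rightarrow> bool"
  where "bilinear_map B M N L \<phi> \<longleftrightarrow>
    (\<forall>x\<in>carrier M. \<forall>y\<in>carrier N. \<phi> (x, y) \<in> carrier L) \<and>
    (\<forall>x\<in>carrier M. \<forall>x'\<in>carrier M. \<forall>y\<in>carrier N. \<phi> (x \<oplus>\<^bsub>M\<^esub> x', y) = \<phi> (x, y) \<oplus>\<^bsub>L\<^esub> \<phi> (x', y)) \<and>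
    (\<forall>x\<in>carrier M. \<forall>y\<in>carrier N. \<forall>y'\<in>carrier N. \<phi> (x, y \<oplus>\<^bsub>N\<^esub> y') = \<phi> (x, y) \<oplus>\<^bsub>L\<^esub> \<phi> (x, y')) \<and>
    (\<forall>b\<in>carrier B. \<forall>x\<in>carrier M. \<forall>y\<in>carrier N. \<phi> (b \<odot>\<^bsub>M\<^esub> x, y) = b \<odot>\<^bsub>L\<^esub> \<phi> (x, y)) \<and>
    (\<forall>b\<in>carrier B. \<forall>x\<in>carrier M. \<forall>y\<in>carrier N. \<phi> (x, b \<odot>\<^bsub>N\<^esub> y) = b \<odot>\<^bsub>L\<^esub> \<phi> (x, y)) \<and>
    (\<forall>y\<in>carrier N. \<phi> (\<zero>\<^bsub>M\<^esub>, y) = \<zero>\<^bsub>L\<^esub>) \<and> (\<forall>x\<in>carrier M. \<phi> (x, \<zero>\<^bsub>N\<^esub>) = \<zero>\<^bsub>L\<^esub>) \<and>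
    (\<forall>(x, x')\<in>mle M. \<forall>(y, y')\<in>mle N. (\<phi> (x, y), \<phi> (x', y')) \<in> mle L)"

context tensor_pair
begin

text \<open>
  The universal property of the ordered tensor product: comparing the sums of the values of a
  bilinear, order-preserving map defines a preorder on formal sums to which minimality applies.
\<close>

lemma bilinear_map_tle:
  assumes L: "ordered_module B L" and \<phi>: "bilinear_map B M N L \<phi>" and XY: "(X, Y) \<in> tle"
  shows "(msum L \<phi> X, msum L \<phi> Y) \<in> mle L"
proof -
  interpret L: ordered_module B L by fact
  have \<phi>c: "\<phi> (x, y) \<in> carrier L" if "x \<in> carrier M" "y \<in> carrier N" for x y
    using that \<phi> by (simp add: bilinear_map_def)
  have \<phi>m: "\<phi> p \<in> carrier L" if "X \<in> forms" "p \<in># X" for X p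
    using \<phi>c[of "fst p" "snd p"] that by (auto dest: subsetD)
  have mc: "msum L \<phi> X \<in> carrier L" if "X \<in> forms" for X
    by (rule L.msum_closed) (use \<phi>m[OF that] in auto)
  define r where "r = {(X, Y). X \<in> forms \<and> Y \<in> forms \<and> (msum L \<phi> X, msum L \<phi> Y) \<in> mle L}"
  have act: "msum L \<phi> (act b X) = b \<odot>\<^bsub>L\<^esub> msum L \<phi> X" if b: "b \<in> carrier B" and X: "X \<in> forms" for b X
  proof -
    have "b \<odot>\<^bsub>L\<^esub> msum L \<phi> X = msum L (\<lambda>p. b \<odot>\<^bsub>L\<^esub> \<phi> p) X"
      by (rule msum_hom[OF L.abelian_monoid_axioms L.abelian_monoid_axioms])
        (use b X \<phi>m in \<open>auto simp: L.smult_r_distr\<close>)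
    also have "\<dots> = msum L (\<lambda>p. \<phi> (case p of (x, y) \<Rightarrow> (b \<odot>\<^bsub>M\<^esub> x, y))) X"
      by (rule L.msum_cong) (use b X \<phi> in \<open>auto simp: bilinear_map_def dest!: subsetD\<close>)
    also have "\<dots> = msum L \<phi> (act b X)"
      by (rule L.msum_image_mset[symmetric]) (use b X \<phi>c in \<open>auto dest!: subsetD\<close>)
    finally show ?thesis by simp
  qed
  have "tle \<subseteq> r"
  proof (rule tle_least)
    show "preorder_on forms r"
      unfolding r_def by (rule pullback_preorder[OF L.mle_preorder mc])
  next
    fix X Y Z assume "(X, Y) \<in> r" "Z \<in> forms"
    moreover from this have "msum L \<phi> (X + Z) = msum L \<phi> X \<oplus>\<^bsub>L\<^esub> msum L \<phi> Z"
      "msum L \<phi> (Y + Z) = msum L \<phi> Y \<oplus>\<^bsub>L\<^esub> msum L \<phi> Z"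
      using \<phi>m unfolding r_def by (intro L.msum_union; blast)+
    ultimately show "(X + Z, Y + Z) \<in> r"
      using add_compatD[OF L.mle_add, of _ _ "msum L \<phi> Z"] mc[of Z] by (simp add: r_def)
  next
    fix a b X Y assume ab: "(a, b) \<in> ble B" and XY: "(X, Y) \<in> r"
    then have "(a \<odot>\<^bsub>L\<^esub> msum L \<phi> X, b \<odot>\<^bsub>L\<^esub> msum L \<phi> Y) \<in> mle L"
      by (intro L.mle_smult) (simp_all add: r_def)
    moreover have c: "a \<in> carrier B" "b \<in> carrier B" "X \<in> forms" "Y \<in> forms"
      using preorder_on_carrier[OF M.B.ble_preorder ab] XY by (auto simp: r_def)
    ultimately show "(act a X, act b Y) \<in> r"
      using forms_act[OF c(1,3)] forms_act[OF c(2,4)] act[OF c(1,3)] act[OF c(2,4)] by (simp add: r_def)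
  next
    fix X Y assume *: "(X, Y) \<in> bilinear_rels B M N"
    have "msum L \<phi> X = msum L \<phi> Y"
      using *[unfolded bilinear_rels_def] \<phi>[unfolded bilinear_map_def]
      by (elim UnE CollectE exE conjE) (simp_all add: L.msum_pair)
    then show "(X, Y) \<in> r \<and> (Y, X) \<in> r"
      using bilinear_rels_forms[OF *] mc preorder_on_refl[OF L.mle_preorder] by (simp add: r_def)
  next
    fix x1 x2 y1 y2 assume *: "(x1, x2) \<in> mle M" "(y1, y2) \<in> mle N"
    then have "(\<phi> (x1, y1), \<phi> (x2, y2)) \<in> mle L"
      using \<phi> unfolding bilinear_map_def by fast
    then show "({#(x1, y1)#}, {#(x2, y2)#}) \<in> r"
      using preorder_on_carrier[OF M.mle_preorder *(1)] preorder_on_carrier[OF N.mle_preorder *(2)] \<phi>c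
      by (simp add: r_def)
  qed
  then show ?thesis
    using XY by (auto simp: r_def)
qed

end

section \<open>Linear maps\<close>

definition linear_map :: "('b, 'z) oblueprint_scheme \<Rightarrow> ('b, 'm, 'y) omodule_scheme \<Rightarrow>
    ('b, 'l, 'w) omodule_scheme \<Rightarrow> ('m \<Rightarrow> 'l) \<Rightarrow> bool"
  where "linear_map B M L f \<longleftrightarrow>
    (\<forall>x\<in>carrier M. f x \<in> carrier L) \<and>
    (\<forall>x\<in>carrier M. \<forall>y\<in>carrier M. f (x \<oplus>\<^bsub>M\<^esub> y) = f x \<oplus>\<^bsub>L\<^esub> f y) \<and>
    (\<forall>b\<in>carrier B. \<forall>x\<in>carrier M. f (b \<odot>\<^bsub>M\<^esub> x) = b \<odot>\<^bsub>L\<^esub> f x) \<and>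
    f \<zero>\<^bsub>M\<^esub> = \<zero>\<^bsub>L\<^esub> \<and> (\<forall>(x, y)\<in>mle M. (f x, f y) \<in> mle L)"

lemma linear_mapD:
  assumes "linear_map B M L f"
  shows "x \<in> carrier M \<Longrightarrow> f x \<in> carrier L"
    and "x \<in> carrier M \<Longrightarrow> y \<in> carrier M \<Longrightarrow> f (x \<oplus>\<^bsub>M\<^esub> y) = f x \<oplus>\<^bsub>L\<^esub> f y"
    and "b \<in> carrier B \<Longrightarrow> x \<in> carrier M \<Longrightarrow> f (b \<odot>\<^bsub>M\<^esub> x) = b \<odot>\<^bsub>L\<^esub> f x"
    and "f \<zero>\<^bsub>M\<^esub> = \<zero>\<^bsub>L\<^esub>"
    and "(x, y) \<in> mle M \<Longrightarrow> (f x, f y) \<in> mle L"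
  using assms by (auto simp: linear_map_def)

lemma bilinear_mapD:
  assumes "bilinear_map B M N L \<phi>"
  shows "x \<in> carrier M \<Longrightarrow> y \<in> carrier N \<Longrightarrow> \<phi> (x, y) \<in> carrier L"
    and "x \<in> carrier M \<Longrightarrow> x' \<in> carrier M \<Longrightarrow> y \<in> carrier N \<Longrightarrow> \<phi> (x \<oplus>\<^bsub>M\<^esub> x', y) = \<phi> (x, y) \<oplus>\<^bsub>L\<^esub> \<phi> (x', y)"
    and "x \<in> carrier M \<Longrightarrow> y \<in> carrier N \<Longrightarrow> y' \<in> carrier N \<Longrightarrow> \<phi> (x, y \<oplus>\<^bsub>N\<^esub> y') = \<phi> (x, y) \<oplus>\<^bsub>L\<^esub> \<phi> (x, y')"
    and "b \<in> carrier B \<Longrightarrow> x \<in> carrier M \<Longrightarrow> y \<in> carrier N \<Longrightarrow> \<phi> (b \<odot>\<^bsub>M\<^esub> x, y) = b \<odot>\<^bsub>L\<^esub> \<phi> (x, y)"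
    and "b \<in> carrier B \<Longrightarrow> x \<in> carrier M \<Longrightarrow> y \<in> carrier N \<Longrightarrow> \<phi> (x, b \<odot>\<^bsub>N\<^esub> y) = b \<odot>\<^bsub>L\<^esub> \<phi> (x, y)"
    and "y \<in> carrier N \<Longrightarrow> \<phi> (\<zero>\<^bsub>M\<^esub>, y) = \<zero>\<^bsub>L\<^esub>"
    and "x \<in> carrier M \<Longrightarrow> \<phi> (x, \<zero>\<^bsub>N\<^esub>) = \<zero>\<^bsub>L\<^esub>"
    and "(x, x') \<in> mle M \<Longrightarrow> (y, y') \<in> mle N \<Longrightarrow> (\<phi> (x, y), \<phi> (x', y')) \<in> mle L"
  using assms by (auto simp: bilinear_map_def)

lemma bilinear_map_comp:
  assumes f: "linear_map B M' M f" and \<phi>: "bilinear_map B M N L \<phi>"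
  shows "bilinear_map B M' N L (\<lambda>(x, y). \<phi> (f x, y))"
  using f unfolding bilinear_map_def by (auto simp: linear_map_def bilinear_mapD[OF \<phi>])

context tensor_pair
begin

text \<open>Every representative hidden in a class of classes is a formal sum representing it.\<close>

lemma Union_st:
  assumes "X \<in> forms"
  shows "Z \<in> \<Union>(st X) \<longleftrightarrow> Z \<in> forms \<and> st Z = st X"
proof
  assume "Z \<in> \<Union>(st X)"
  then obtain c where c: "(cls cong X, c) \<in> tpre" "(c, cls cong X) \<in> tpre" "Z \<in> c"
    by (auto simp: st_def tensor_class_def cls_def)
  then obtain W where W: "W \<in> forms" "c = cls cong W"
    using preorder_on_carrier[OF tpre_preorder] unfolding semi_carrier by blast
  then have "(W, Z) \<in> cong" "(Z, W) \<in> cong"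
    using c(3) by (auto simp: cls_def)
  then have "cls cong Z = c" and Z: "Z \<in> forms"
    using cls_eqI[OF cong_preorder] preorder_on_carrier[OF cong_preorder] W by metis+
  then have "st Z = cls tpre c"
    by (simp add: st_def tensor_class_def)
  also have "\<dots> = st X"
    using cls_eqI[OF tpre_preorder c(2,1)] by (simp add: st_def tensor_class_def)
  finally show "Z \<in> forms \<and> st Z = st X"
    using Z by simp
next
  assume Z: "Z \<in> forms \<and> st Z = st X"
  then have "Z \<in> cls cong Z" "cls cong Z \<in> st Z"
    using cls_self[OF cong_preorder] cls_self[OF tpre_preorder]
    by (auto simp: st_def tensor_class_def semi_carrier)
  then show "Z \<in> \<Union>(st X)"
    using Z by auto
qed

lemma pure_bilinear: "bilinear_map B M N tp (\<lambda>p. st {#p#})"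
proof -
  have r: "st X = st Y" if "(X, Y) \<in> bilinear_rels B M N" for X Y
    using st_cong cong_rels that by blast
  have le: "(st {#(x, y)#}, st {#(x', y')#}) \<in> mle tp" if "(x, x') \<in> mle M" "(y, y') \<in> mle N" for x x' y y'
    using preorder_on_carrier[OF M.mle_preorder that(1)] preorder_on_carrier[OF N.mle_preorder that(2)]
      tle_pairs[OF that] by (simp add: tp_mle_iff)
  show ?thesis
    unfolding bilinear_map_def
    by (auto simp: tp_carrier tp_add tp_zero tp_smult le add_mset_commute
        r[OF bilinear_relsI(1)] r[OF bilinear_relsI(2)] r[OF bilinear_relsI(3)]
        r[OF bilinear_relsI(4)] r[OF bilinear_relsI(5), symmetric])
qed

end


section \<open>The free module\<close>

lemma (in ordered_semiring) regular_module_ordered: "ordered_module B (regular_module B)"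
proof -
  interpret R: abelian_monoid "regular_module B"
    by (rule abelian_monoidI) (auto simp: regular_module_def a_ac)
  show ?thesis
    by unfold_locales
      (auto simp: regular_module_def m_assoc l_distr r_distr ble_order
        add_compat_def intro: add_compatD[OF ble_add] mult_compat2[OF ble_preorder ble_mult])
qed

lemma (in ordered_semiring) free_module_ordered: "ordered_module B (free_module B n)"
proof -
  interpret R: abelian_monoid "free_module B n"
    by (rule abelian_monoidI) (auto simp: free_module_def a_ac PiE_iff extensional_def fun_eq_iff restrict_def)
  have po: "partial_order_on (carrier (free_module B n)) (mle (free_module B n))"
    unfolding partial_order_on_def
  proof
    show "preorder_on (carrier (free_module B n)) (mle (free_module B n))"
    proof (rule preorder_onI)
      fix x y z assume "(x, y) \<in> mle (free_module B n)" "(y, z) \<in> mle (free_module B n)"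
      then show "(x, z) \<in> mle (free_module B n)"
        by (auto simp: free_module_def intro: preorder_on_trans[OF ble_preorder])
    qed (auto simp: free_module_def PiE_iff intro: preorder_on_refl[OF ble_preorder])
    show "antisym (mle (free_module B n))"
    proof (rule antisymI)
      fix x y assume *: "(x, y) \<in> mle (free_module B n)" "(y, x) \<in> mle (free_module B n)"
      show "x = y"
      proof (rule PiE_ext)
        show "x \<in> {1..n} \<rightarrow>\<^sub>E carrier B" "y \<in> {1..n} \<rightarrow>\<^sub>E carrier B"
          using * by (auto simp: free_module_def)
        show "x i = y i" if "i \<in> {1..n}" for i
          using * that antisymD[OF partial_order_onD(3)[OF ble_order], of "x i" "y i"]
          by (auto simp: free_module_def)
      qed
    qed
  qed
  have add: "add_compat (free_module B n) (mle (free_module B n))"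
    by (rule add_compatI) (auto simp: free_module_def intro: add_compatD[OF ble_add] dest: PiE_mem)
  have smult: "(a \<odot>\<^bsub>free_module B n\<^esub> x, b \<odot>\<^bsub>free_module B n\<^esub> y) \<in> mle (free_module B n)"
    if "(a, b) \<in> ble B" "(x, y) \<in> mle (free_module B n)" for a b x y
    using that preorder_on_carrier[OF ble_preorder that(1)]
    by (auto simp: free_module_def intro: mult_compat2[OF ble_preorder ble_mult] dest: PiE_mem)
  show ?thesis
    by (unfold_locales; (intro po add smult; assumption)?)
      (auto simp: free_module_def m_assoc l_distr r_distr PiE_iff restrict_def extensional_def fun_eq_iff)
qed

locale tensor_powers = ordered_semiring B for B (structure) + fixes n :: nat
begin

abbreviation V where "V \<equiv> free_module B n"
abbreviation P where "P l \<equiv> tensor_power B n l"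
abbreviation basis where "basis i \<equiv> basis_vec B n i"

sublocale V: ordered_module B V
  by (rule free_module_ordered)

lemma V_apply:
  "i \<in> {1..n} \<Longrightarrow> (u \<oplus>\<^bsub>V\<^esub> v) i = u i \<oplus> v i"
  "i \<in> {1..n} \<Longrightarrow> (b \<odot>\<^bsub>V\<^esub> v) i = b \<otimes> v i"
  "i \<in> {1..n} \<Longrightarrow> \<zero>\<^bsub>V\<^esub> i = \<zero>"
  by (auto simp: free_module_def)

lemma V_apply_closed: "v \<in> carrier V \<Longrightarrow> i \<in> {1..n} \<Longrightarrow> v i \<in> carrier B"
  by (auto simp: free_module_def)

lemma basis_closed: "basis i \<in> carrier V"
  by (auto simp: free_module_def basis_vec_def)

text \<open>
  A vector is the end of a chain of partial vectors, each of which differs from the previous one by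
  a multiple of a basis vector.
\<close>

lemma V_induct [consumes 1, case_names add smult zero basis]:
  assumes v: "v \<in> carrier V"
    and add: "\<And>u v. \<lbrakk>u \<in> carrier V; v \<in> carrier V; Q u; Q v\<rbrakk> \<Longrightarrow> Q (u \<oplus>\<^bsub>V\<^esub> v)"
    and smult: "\<And>b v. \<lbrakk>b \<in> carrier B; v \<in> carrier V; Q v\<rbrakk> \<Longrightarrow> Q (b \<odot>\<^bsub>V\<^esub> v)"
    and zero: "Q \<zero>\<^bsub>V\<^esub>"
    and basis: "\<And>i. i \<in> {1..n} \<Longrightarrow> Q (basis i)"
  shows "Q v"
proof -
  define w where "w k = (\<lambda>i\<in>{1..n}. if i \<le> k then v i else \<zero>)" for k
  have wc: "w k \<in> carrier V" for k
    using v by (auto simp: w_def free_module_def)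
  have "k \<le> n \<Longrightarrow> Q (w k)" for k
  proof (induction k)
    case 0
    have "w 0 = \<zero>\<^bsub>V\<^esub>"
      by (auto simp: w_def free_module_def)
    then show ?case
      using zero by simp
  next
    case (Suc k)
    have k: "Suc k \<in> {1..n}"
      using Suc.prems by auto
    have vi: "v i \<in> carrier B" if "i \<in> {1..n}" for i
      using V_apply_closed[OF v that] .
    have "w (Suc k) = w k \<oplus>\<^bsub>V\<^esub> (v (Suc k) \<odot>\<^bsub>V\<^esub> basis (Suc k))"
      using vi k by (auto simp: w_def free_module_def basis_vec_def fun_eq_iff le_Suc_eq)
    moreover have "Q (v (Suc k) \<odot>\<^bsub>V\<^esub> basis (Suc k))"
      by (intro smult vi k basis_closed basis)
    moreover have "v (Suc k) \<odot>\<^bsub>V\<^esub> basis (Suc k) \<in> carrier V"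
      by (intro V.smult_closed vi k basis_closed)
    ultimately show ?case
      using Suc add[OF wc[of k]] by simp
  qed
  moreover have "w n = v"
    using v by (auto simp: w_def free_module_def PiE_iff extensional_def fun_eq_iff)
  ultimately show ?thesis
    by force
qed


section \<open>Tensor powers\<close>

lemma transport_facts:
  assumes M: "ordered_module B M" and inj: "inj_on f (carrier M)"
  shows "ordered_module B (transport f M)"
    and "carrier (transport f M) = f ` carrier M"
    and "\<lbrakk>x \<in> carrier M; y \<in> carrier M\<rbrakk> \<Longrightarrow> f x \<oplus>\<^bsub>transport f M\<^esub> f y = f (x \<oplus>\<^bsub>M\<^esub> y)"
    and "x \<in> carrier M \<Longrightarrow> b \<odot>\<^bsub>transport f M\<^esub> f x = f (b \<odot>\<^bsub>M\<^esub> x)"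
    and "\<zero>\<^bsub>transport f M\<^esub> = f \<zero>\<^bsub>M\<^esub>"
    and "mle (transport f M) = (\<lambda>(x, y). (f x, f y)) ` mle M"
proof -
  interpret M: ordered_module B M by fact
  show a: "carrier (transport f M) = f ` carrier M"
    and b: "\<lbrakk>x \<in> carrier M; y \<in> carrier M\<rbrakk> \<Longrightarrow> f x \<oplus>\<^bsub>transport f M\<^esub> f y = f (x \<oplus>\<^bsub>M\<^esub> y)"
    and c: "x \<in> carrier M \<Longrightarrow> b \<odot>\<^bsub>transport f M\<^esub> f x = f (b \<odot>\<^bsub>M\<^esub> x)"
    and d: "\<zero>\<^bsub>transport f M\<^esub> = f \<zero>\<^bsub>M\<^esub>"
    and e: "mle (transport f M) = (\<lambda>(x, y). (f x, f y)) ` mle M" for x y b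
    using inj by (auto simp: transport_def Let_def)
  show "ordered_module B (transport f M)"
    by (rule ordered_module_image[OF M, where h = f]) (use a b c d e inj in auto)
qed

lemma Scalar_inj: "inj_on Scalar A"
  by (auto simp: inj_on_def)

lemmas P0_transport = transport_facts[OF regular_module_ordered Scalar_inj]

lemma P0_module: "ordered_module B (P 0)"
  using P0_transport(1) by simp

lemma P0_carrier: "carrier (P 0) = Scalar ` carrier B"
  using P0_transport(2) by (simp add: regular_module_def)

lemma P0_add: "a \<in> carrier B \<Longrightarrow> b \<in> carrier B \<Longrightarrow> Scalar a \<oplus>\<^bsub>P 0\<^esub> Scalar b = Scalar (a \<oplus> b)"
  using P0_transport(3) by (simp add: regular_module_def)

lemma P0_smult: "b \<in> carrier B \<Longrightarrow> a \<odot>\<^bsub>P 0\<^esub> Scalar b = Scalar (a \<otimes> b)"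
  using P0_transport(4) by (simp add: regular_module_def)

lemma P0_zero: "\<zero>\<^bsub>P 0\<^esub> = Scalar \<zero>"
  using P0_transport(5) by (simp add: regular_module_def)

lemma P0_mle: "(x, y) \<in> mle (P 0) \<longleftrightarrow> (\<exists>a b. (a, b) \<in> ble B \<and> x = Scalar a \<and> y = Scalar b)"
  using P0_transport(6) by (auto simp: regular_module_def)

abbreviation ts where "ts l \<equiv> sum_tensor B n l"
abbreviation sums where "sums l \<equiv> {X. set_mset X \<subseteq> carrier (P l) \<times> carrier V}"

text \<open>
  The structure of \<open>(B\<^sup>n)\<^sup>\<otimes>\<^sup>l\<^sup>+\<^sup>1\<close> in terms of formal sums. The chosen representative of an
  element determines it, so that nothing is lost when the tensor product is transported to the
  datatype.
\<close>

lemma P_Suc_facts: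
  assumes "ordered_module B (P l)"
  shows "ordered_module B (P (Suc l))" (is ?mod)
    and "carrier (P (Suc l)) = ts l ` sums l" (is ?car)
    and "X \<in> sums l \<Longrightarrow> the_sum (ts l X) \<in> sums l \<and> ts l (the_sum (ts l X)) = ts l X"
    and "\<lbrakk>X \<in> sums l; Y \<in> sums l\<rbrakk> \<Longrightarrow> ts l X \<oplus>\<^bsub>P (Suc l)\<^esub> ts l Y = ts l (X + Y)"
    and "\<zero>\<^bsub>P (Suc l)\<^esub> = ts l {#}" (is ?zero)
    and "\<lbrakk>X \<in> sums l; Y \<in> sums l; (ts l X, ts l Y) \<in> mle (P (Suc l)); ordered_module B L;
      bilinear_map B (P l) V L \<phi>\<rbrakk> \<Longrightarrow> (msum L \<phi> X, msum L \<phi> Y) \<in> mle L"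
    and "bilinear_map B (P l) V (P (Suc l)) (\<lambda>p. ts l {#p#})" (is ?pure)
proof -
  interpret T: tensor_pair B "P l" V
    using assms V.ordered_module_axioms by (simp add: tensor_pair_def)
  let ?g = "\<lambda>C :: ('a tensor \<times> (nat \<Rightarrow> 'a)) multiset set set. SOME Y. Y \<in> \<Union>C"
  have ts: "ts l X = Sum_of_class (T.st X)" for X
    by (simp add: sum_tensor_def T.st_def)
  have g: "?g (T.st X) \<in> sums l \<and> T.st (?g (T.st X)) = T.st X" if "X \<in> sums l" for X
    using someI[of "\<lambda>Y. Y \<in> \<Union>(T.st X)" X] T.Union_st[OF that] that by metis
  then show "X \<in> sums l \<Longrightarrow> the_sum (ts l X) \<in> sums l \<and> ts l (the_sum (ts l X)) = ts l X"
    by (simp add: ts Sum_of_class_def)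
  have inj: "inj_on Sum_of_class (carrier T.tp)"
  proof (rule inj_onI)
    fix x y assume "x \<in> carrier T.tp" "y \<in> carrier T.tp" and eq: "Sum_of_class x = Sum_of_class y"
    then obtain X Y where XY: "X \<in> sums l" "x = T.st X" "Y \<in> sums l" "y = T.st Y"
      by (auto simp: T.tp_carrier)
    have "?g x = ?g y"
      using eq by (simp add: Sum_of_class_def)
    then show "x = y"
      using g[OF XY(1)] g[OF XY(3)] XY by metis
  qed
  note tr = transport_facts[OF T.tp_module inj]
  have P: "P (Suc l) = transport Sum_of_class T.tp"
    by simp
  show ?mod
    using tr(1) by simp
  show car: ?car
    using tr(2) by (simp add: T.tp_carrier image_image ts)
  show add: "\<lbrakk>X \<in> sums l; Y \<in> sums l\<rbrakk> \<Longrightarrow> ts l X \<oplus>\<^bsub>P (Suc l)\<^esub> ts l Y = ts l (X + Y)" for X Y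
    using tr(3)[of "T.st X" "T.st Y"] T.tp_add[of X Y] T.tp_carrier unfolding P ts by auto
  show zero: ?zero
    using tr(5) T.tp_zero unfolding P ts by simp
  have mle: "(ts l X, ts l Y) \<in> mle (P (Suc l)) \<longleftrightarrow> (X, Y) \<in> T.tle" if "X \<in> sums l" "Y \<in> sums l" for X Y
  proof -
    have "(ts l X, ts l Y) \<in> mle (P (Suc l)) \<longleftrightarrow> (T.st X, T.st Y) \<in> mle T.tp"
    proof
      assume "(ts l X, ts l Y) \<in> mle (P (Suc l))"
      then obtain x y where xy: "(x, y) \<in> mle T.tp" "Sum_of_class (T.st X) = Sum_of_class x"
          "Sum_of_class (T.st Y) = Sum_of_class y"
        unfolding P ts tr(6) by auto
      then have "T.st X = x" "T.st Y = y"
        using inj_onD[OF inj xy(2)] inj_onD[OF inj xy(3)] that xy(1) partial_order_onD(4)[OF T.tp_mle_order]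
          T.tp_carrier by auto
      then show "(T.st X, T.st Y) \<in> mle T.tp"
        using xy by simp
    next
      assume "(T.st X, T.st Y) \<in> mle T.tp"
      then show "(ts l X, ts l Y) \<in> mle (P (Suc l))"
        unfolding P ts tr(6) by (rule image_eqI[rotated]) simp
    qed
    then show ?thesis
      using T.tp_mle_iff that by blast
  qed
  show "(msum L \<phi> X, msum L \<phi> Y) \<in> mle L"
    if "X \<in> sums l" "Y \<in> sums l" "(ts l X, ts l Y) \<in> mle (P (Suc l))" "ordered_module B L"
      "bilinear_map B (P l) V L \<phi>" for X Y L \<phi>
    using T.bilinear_map_tle[OF that(4,5)] mle that by blast
  have smult: "b \<odot>\<^bsub>P (Suc l)\<^esub> ts l X = Sum_of_class (b \<odot>\<^bsub>T.tp\<^esub> T.st X)" if "X \<in> sums l" for b X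
    using tr(4)[of "T.st X" b] T.tp_carrier that unfolding P ts by auto
  have "linear_map B T.tp (P (Suc l)) Sum_of_class"
    unfolding linear_map_def P using tr(2-6) by auto
  note lin = linear_mapD[OF this]
  show ?pure
    unfolding ts bilinear_map_def
    using bilinear_mapD[OF T.pure_bilinear]
    by (auto simp: lin(1) lin(2)[symmetric] lin(3)[symmetric] lin(4) lin(5) simp del: tensor_power.simps)
qed

lemma P_module: "ordered_module B (P l)"
  by (induction l) (use P0_module P_Suc_facts(1) in blast)+

lemmas P_Suc = P_Suc_facts[OF P_module]

end

sublocale tensor_powers \<subseteq> P: ordered_module B "tensor_power B n l" for l
  by (rule P_module)

context tensor_powers
begin

declare tensor_power.simps [simp del]

lemmas pure_tensor = bilinear_mapD[OF P_Suc(7)]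

lemma ts_conv_msum:
  assumes "X \<in> sums l"
  shows "ts l X = msum (P (Suc l)) (\<lambda>p. ts l {#p#}) X"
  using assms
proof (induction X)
  case empty
  then show ?case by (simp add: P_Suc(5))
next
  case (add p X)
  have "msum (P (Suc l)) (\<lambda>p. ts l {#p#}) (add_mset p X) = ts l {#p#} \<oplus>\<^bsub>P (Suc l)\<^esub> msum (P (Suc l)) (\<lambda>p. ts l {#p#}) X"
    by (rule P.msum_add_mset) (use add.prems pure_tensor(1) in auto)
  then show ?case
    using P_Suc(4)[of "{#p#}" l X] add by simp
qed

lemma ts_closed: "X \<in> sums l \<Longrightarrow> ts l X \<in> carrier (P (Suc l))"
  by (auto simp: P_Suc(2))

lemma the_sum_facts:
  assumes "t \<in> carrier (P (Suc l))"
  shows "the_sum t \<in> sums l" "ts l (the_sum t) = t"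
  using assms P_Suc(3) unfolding P_Suc(2) by auto

text \<open>
  The chosen representative may be replaced by any other: two formal sums of the same element
  have values that are below each other, and the order of \<open>L\<close> is antisymmetric.
\<close>

lemma msum_ts:
  assumes L: "ordered_module B L" and \<phi>: "bilinear_map B (P l) V L \<phi>" and X: "X \<in> sums l"
  shows "msum L \<phi> (the_sum (ts l X)) = msum L \<phi> X"
proof -
  interpret L: ordered_module B L by fact
  have "(ts l X, ts l X) \<in> mle (P (Suc l))"
    using preorder_on_refl[OF P.mle_preorder ts_closed[OF X]] .
  then show ?thesis
    using P_Suc(6)[OF _ _ _ L \<phi>, of X "the_sum (ts l X)"] P_Suc(6)[OF _ _ _ L \<phi>, of "the_sum (ts l X)" X]
      P_Suc(3)[OF X] X by (intro L.mle_antisym) auto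
qed

lemma bilinear_map_msum_closed:
  assumes L: "ordered_module B L" and \<phi>: "bilinear_map B (P l) V L \<phi>" and X: "X \<in> sums l"
  shows "msum L \<phi> X \<in> carrier L"
proof -
  interpret L: ordered_module B L by fact
  show ?thesis
    by (rule L.msum_closed) (use X bilinear_mapD(1)[OF \<phi>] in auto)
qed

text \<open>
  A bilinear map induces a linear map on the tensor product, computed on the chosen formal sums.
\<close>

lemma induced_linear_map:
  assumes L: "ordered_module B L" and \<phi>: "bilinear_map B (P l) V L \<phi>"
  shows "linear_map B (P (Suc l)) L (\<lambda>t. msum L \<phi> (the_sum t))"
proof -
  interpret L: ordered_module B L by fact
  have \<phi>c: "\<phi> p \<in> carrier L" if "X \<in> sums l" "p \<in># X" for X p
    using bilinear_mapD(1)[OF \<phi>, of "fst p" "snd p"] that by (auto dest: subsetD)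
  note c = bilinear_map_msum_closed[OF L \<phi>]
  show ?thesis
    unfolding linear_map_def
  proof (intro conjI ballI)
    fix t assume t: "t \<in> carrier (P (Suc l))"
    show "msum L \<phi> (the_sum t) \<in> carrier L"
      by (rule c[OF the_sum_facts(1)[OF t]])
  next
    fix t s assume t: "t \<in> carrier (P (Suc l))" and s: "s \<in> carrier (P (Suc l))"
    note ft = the_sum_facts[OF t] and fs = the_sum_facts[OF s]
    have "t \<oplus>\<^bsub>P (Suc l)\<^esub> s = ts l (the_sum t + the_sum s)"
      using P_Suc(4)[OF ft(1) fs(1)] ft fs by simp
    then have "msum L \<phi> (the_sum (t \<oplus>\<^bsub>P (Suc l)\<^esub> s)) = msum L \<phi> (the_sum t + the_sum s)"
      using msum_ts[OF L \<phi>, of "the_sum t + the_sum s"] ft fs by simp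
    also have "\<dots> = msum L \<phi> (the_sum t) \<oplus>\<^bsub>L\<^esub> msum L \<phi> (the_sum s)"
      by (rule L.msum_union) (use \<phi>c ft fs in auto)
    finally show "msum L \<phi> (the_sum (t \<oplus>\<^bsub>P (Suc l)\<^esub> s)) = msum L \<phi> (the_sum t) \<oplus>\<^bsub>L\<^esub> msum L \<phi> (the_sum s)" .
  next
    fix b t assume b: "b \<in> carrier B" and t: "t \<in> carrier (P (Suc l))"
    note ft = the_sum_facts[OF t]
    let ?bX = "image_mset (\<lambda>(u, v). (b \<odot>\<^bsub>P l\<^esub> u, v)) (the_sum t)"
    have bX: "?bX \<in> sums l"
      using ft b by auto
    have "b \<odot>\<^bsub>P (Suc l)\<^esub> t = b \<odot>\<^bsub>P (Suc l)\<^esub> msum (P (Suc l)) (\<lambda>p. ts l {#p#}) (the_sum t)"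
      using ts_conv_msum[OF ft(1)] ft by simp
    also have "\<dots> = msum (P (Suc l)) (\<lambda>p. b \<odot>\<^bsub>P (Suc l)\<^esub> ts l {#p#}) (the_sum t)"
      by (rule msum_hom[OF P.abelian_monoid_axioms P.abelian_monoid_axioms])
        (use b ft in \<open>auto simp: P.smult_r_distr intro!: ts_closed\<close>)
    also have "\<dots> = msum (P (Suc l)) (\<lambda>p. ts l {#(\<lambda>(u, v). (b \<odot>\<^bsub>P l\<^esub> u, v)) p#}) (the_sum t)"
      by (rule P.msum_cong) (use b ft in \<open>auto simp: pure_tensor(1,4) dest!: subsetD\<close>)
    also have "\<dots> = msum (P (Suc l)) (\<lambda>p. ts l {#p#}) ?bX"
      by (rule P.msum_image_mset[symmetric]) (use bX in \<open>auto intro!: ts_closed\<close>)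
    finally have "b \<odot>\<^bsub>P (Suc l)\<^esub> t = ts l ?bX"
      using ts_conv_msum[OF bX] by simp
    then have "msum L \<phi> (the_sum (b \<odot>\<^bsub>P (Suc l)\<^esub> t)) = msum L \<phi> ?bX"
      using msum_ts[OF L \<phi> bX] by simp
    also have "\<dots> = msum L (\<lambda>p. \<phi> (case p of (u, v) \<Rightarrow> (b \<odot>\<^bsub>P l\<^esub> u, v))) (the_sum t)"
      by (rule L.msum_image_mset) (use bX \<phi>c[OF bX] in auto)
    also have "\<dots> = msum L (\<lambda>p. b \<odot>\<^bsub>L\<^esub> \<phi> p) (the_sum t)"
      by (rule L.msum_cong) (use b ft \<phi>c[OF ft(1)] bilinear_mapD(4)[OF \<phi>] in \<open>auto dest!: subsetD\<close>)
    also have "\<dots> = b \<odot>\<^bsub>L\<^esub> msum L \<phi> (the_sum t)"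
      by (rule msum_hom[OF L.abelian_monoid_axioms L.abelian_monoid_axioms, symmetric])
        (use b ft \<phi>c[OF ft(1)] in \<open>auto simp: L.smult_r_distr\<close>)
    finally show "msum L \<phi> (the_sum (b \<odot>\<^bsub>P (Suc l)\<^esub> t)) = b \<odot>\<^bsub>L\<^esub> msum L \<phi> (the_sum t)" .
  next
    show "msum L \<phi> (the_sum \<zero>\<^bsub>P (Suc l)\<^esub>) = \<zero>\<^bsub>L\<^esub>"
      using msum_ts[OF L \<phi>, of "{#}"] by (simp add: P_Suc(5))
  next
    fix p assume p: "p \<in> mle (P (Suc l))"
    obtain t s where ts: "p = (t, s)"
      by (cases p)
    then have "t \<in> carrier (P (Suc l))" "s \<in> carrier (P (Suc l))"
      using p preorder_on_carrier[OF P.mle_preorder] by blast+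
    note ft = the_sum_facts[OF this(1)] and fs = the_sum_facts[OF this(2)]
    show "case p of (t, s) \<Rightarrow> (msum L \<phi> (the_sum t), msum L \<phi> (the_sum s)) \<in> mle L"
      using P_Suc(6)[OF ft(1) fs(1) _ L \<phi>] ft fs p ts by simp
  qed
qed


section \<open>Concatenation of tensors\<close>

abbreviation cc where "cc \<equiv> tensor_concat B n"

text \<open>
  Concatenation with \<open>t\<close> on \<open>(B\<^sup>n)\<^sup>\<otimes>\<^sup>m\<^sup>+\<^sup>1\<close> is the linear map induced by
  \<open>(u, v) \<mapsto> (t \<cdot> u) \<otimes> v\<close>, and this map is bilinear because concatenation with \<open>t\<close> is
  already linear on \<open>(B\<^sup>n)\<^sup>\<otimes>\<^sup>m\<close>. So linearity and independence of the representative are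
  proved in one induction.
\<close>

lemma concat_linear:
  assumes t: "t \<in> carrier (P l)"
  shows "linear_map B (P m) (P (l + m)) (cc l m t)"
    and "X \<in> sums m \<Longrightarrow> cc l (Suc m) t (ts m X) = ts (l + m) (image_mset (\<lambda>(u, v). (cc l m t u, v)) X)"
proof -
  have Suc: "linear_map B (P (Suc m)) (P (l + Suc m)) (cc l (Suc m) t) \<and>
    (\<forall>X\<in>sums m. cc l (Suc m) t (ts m X) = ts (l + m) (image_mset (\<lambda>(u, v). (cc l m t u, v)) X))"
    if IH: "linear_map B (P m) (P (l + m)) (cc l m t)" for m
  proof -
    let ?\<phi> = "\<lambda>(u, v). ts (l + m) {#(cc l m t u, v)#}"
    have \<phi>: "bilinear_map B (P m) V (P (Suc (l + m))) ?\<phi>"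
      using bilinear_map_comp[OF IH P_Suc(7)] .
    have image: "ts (l + m) (image_mset (\<lambda>(u, v). (cc l m t u, v)) X) = msum (P (Suc (l + m))) ?\<phi> X"
      if "X \<in> sums m" for X
    proof -
      have i: "image_mset (\<lambda>(u, v). (cc l m t u, v)) X \<in> sums (l + m)"
        using that linear_mapD(1)[OF IH] by auto
      have "ts (l + m) (image_mset (\<lambda>(u, v). (cc l m t u, v)) X) =
          msum (P (Suc (l + m))) (\<lambda>p. ts (l + m) {#(\<lambda>(u, v). (cc l m t u, v)) p#}) X"
        unfolding ts_conv_msum[OF i]
        by (rule P.msum_image_mset) (use i in \<open>auto intro!: ts_closed\<close>)
      also have "\<dots> = msum (P (Suc (l + m))) ?\<phi> X"
        by (rule P.msum_cong) (use that in \<open>auto intro!: ts_closed linear_mapD(1)[OF IH] dest!: subsetD\<close>)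
      finally show ?thesis .
    qed
    have cc: "cc l (Suc m) t s = msum (P (Suc (l + m))) ?\<phi> (the_sum s)" if "s \<in> carrier (P (Suc m))" for s
      using image[OF the_sum_facts(1)[OF that]] by simp
    have lin: "linear_map B (P (Suc m)) (P (Suc (l + m))) (\<lambda>s. msum (P (Suc (l + m))) ?\<phi> (the_sum s))"
      by (rule induced_linear_map[OF P.ordered_module_axioms \<phi>])
    have "linear_map B (P (Suc m)) (P (l + Suc m)) (cc l (Suc m) t)"
      using lin preorder_on_carrier[OF P.mle_preorder] unfolding linear_map_def
      by (auto simp: cc simp del: tensor_concat.simps)
    moreover have "cc l (Suc m) t (ts m X) = ts (l + m) (image_mset (\<lambda>(u, v). (cc l m t u, v)) X)"
      if "X \<in> sums m" for X
      using cc[OF ts_closed[OF that]] msum_ts[OF P.ordered_module_axioms \<phi> that] image[OF that] by simp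
    ultimately show ?thesis by blast
  qed
  show lin: "linear_map B (P m) (P (l + m)) (cc l m t)" for m
  proof (induction m)
    case 0
    show ?case
      using t P.mle_smult[OF _ preorder_on_refl[OF P.mle_preorder t]]
      by (auto simp: linear_map_def P0_carrier P0_add P0_smult P0_zero P0_mle P.smult_l_distr P.smult_assoc)
  qed (use Suc in blast)
  show "cc l (Suc m) t (ts m X) = ts (l + m) (image_mset (\<lambda>(u, v). (cc l m t u, v)) X)" if "X \<in> sums m"
    using Suc[OF lin] that by blast
qed

lemmas concat = linear_mapD[OF concat_linear(1)]

lemma concat_0: "cc l 0 t (Scalar b) = b \<odot>\<^bsub>P l\<^esub> t"
  by simp

lemma P_Suc_induct [consumes 1, case_names add zero pure]:
  assumes t: "t \<in> carrier (P (Suc l))"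
    and add: "\<And>x y. \<lbrakk>x \<in> carrier (P (Suc l)); y \<in> carrier (P (Suc l)); Q x; Q y\<rbrakk> \<Longrightarrow> Q (x \<oplus>\<^bsub>P (Suc l)\<^esub> y)"
    and zero: "Q \<zero>\<^bsub>P (Suc l)\<^esub>"
    and pure: "\<And>u v. \<lbrakk>u \<in> carrier (P l); v \<in> carrier V\<rbrakk> \<Longrightarrow> Q (ts l {#(u, v)#})"
  shows "Q t"
proof -
  have "Q (ts l X)" if "X \<in> sums l" for X
    using that
  proof (induction X)
    case empty
    then show ?case using zero by (simp add: P_Suc(5))
  next
    case (add p X)
    obtain u v where p: "p = (u, v)" "u \<in> carrier (P l)" "v \<in> carrier V"
      using add.prems by auto
    have "ts l (add_mset p X) = ts l {#p#} \<oplus>\<^bsub>P (Suc l)\<^esub> ts l X"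
      using P_Suc(4)[of "{#p#}" l X] add.prems by simp
    moreover have "Q (ts l {#p#} \<oplus>\<^bsub>P (Suc l)\<^esub> ts l X)"
      by (rule assms(2)) (use add pure p in \<open>auto intro!: ts_closed\<close>)
    ultimately show ?case
      by simp
  qed
  then show ?thesis
    using the_sum_facts[OF t] by metis
qed

lemma concat_pure:
  assumes "t \<in> carrier (P l)" "u \<in> carrier (P m)" "v \<in> carrier V"
  shows "cc l (Suc m) t (ts m {#(u, v)#}) = ts (l + m) {#(cc l m t u, v)#}"
  using concat_linear(2)[OF assms(1), of "{#(u, v)#}" m] assms by simp

declare tensor_concat.simps [simp del]

lemma concat_add_left:
  assumes "t \<in> carrier (P l)" "t' \<in> carrier (P l)" "s \<in> carrier (P m)"
  shows "cc l m (t \<oplus>\<^bsub>P l\<^esub> t') s = cc l m t s \<oplus>\<^bsub>P (l + m)\<^esub> cc l m t' s"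
  using assms(3)
proof (induction m arbitrary: s)
  case 0
  then show ?case
    using assms by (auto simp: P0_carrier concat_0 P.smult_r_distr)
next
  case (Suc m)
  note c = assms(1,2) P.a_closed[OF assms(1,2)]
  show ?case
    using Suc.prems
  proof (induction s rule: P_Suc_induct)
    case (add x y)
    then show ?case
      using c by (simp add: concat(1,2) P.a_ac del: add_Suc_right)
  next
    case zero
    then show ?case
      using c by (simp add: concat(4) del: add_Suc_right)
  next
    case (pure u v)
    then show ?case
      using c by (simp add: concat_pure Suc.IH pure_tensor(2) concat(1))
  qed
qed

lemma concat_smult_left:
  assumes "t \<in> carrier (P l)" "b \<in> carrier B" "s \<in> carrier (P m)"
  shows "cc l m (b \<odot>\<^bsub>P l\<^esub> t) s = b \<odot>\<^bsub>P (l + m)\<^esub> cc l m t s"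
  using assms(3)
proof (induction m arbitrary: s)
  case 0
  then show ?case
    using assms by (auto simp: P0_carrier concat_0 P.smult_assoc[symmetric] m_comm)
next
  case (Suc m)
  note c = assms(1,2) P.smult_closed[OF assms(2,1)]
  show ?case
    using Suc.prems
  proof (induction s rule: P_Suc_induct)
    case (add x y)
    then show ?case
      using c by (simp add: concat(1,2) P.smult_r_distr del: add_Suc_right)
  next
    case zero
    then show ?case
      using c by (simp add: concat(4) del: add_Suc_right)
  next
    case (pure u v)
    then show ?case
      using c by (simp add: concat_pure Suc.IH pure_tensor(4) concat(1))
  qed
qed

lemma concat_zero_left:
  assumes "s \<in> carrier (P m)"
  shows "cc l m \<zero>\<^bsub>P l\<^esub> s = \<zero>\<^bsub>P (l + m)\<^esub>"
  using concat_smult_left[OF P.zero_closed zero_closed assms] assms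
  by (simp add: concat(1))

lemma concat_assoc:
  assumes "t \<in> carrier (P l)" "s \<in> carrier (P m)" "r \<in> carrier (P k)"
  shows "cc (l + m) k (cc l m t s) r = cc l (m + k) t (cc m k s r)"
  using assms(3)
proof (induction k arbitrary: r)
  case 0
  then show ?case
    using assms by (auto simp: P0_carrier concat_0 concat(3))
next
  case (Suc k)
  note c = assms(1,2) concat(1)[OF assms(1,2)]
  show ?case
    using Suc.prems
  proof (induction r rule: P_Suc_induct)
    case (add x y)
    then show ?case
      using c concat(2)[of t l "cc m (Suc k) s x" "m + Suc k" "cc m (Suc k) s y"]
      by (simp add: concat(1,2) add.assoc del: add_Suc_right)
  next
    case zero
    then show ?case
      using c by (simp add: concat(4) add.assoc del: add_Suc_right)
  next
    case (pure u v)
    then show ?case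
      using c by (simp add: concat_pure Suc.IH concat(1) add.assoc)
  qed
qed

lemma concat_one_left:
  assumes "s \<in> carrier (P m)"
  shows "cc 0 m (Scalar \<one>) s = s"
  using assms
proof (induction m arbitrary: s)
  case 0
  then show ?case
    by (auto simp: P0_carrier concat_0 P0_smult)
next
  case (Suc m)
  have c: "Scalar \<one> \<in> carrier (P 0)"
    by (simp add: P0_carrier)
  show ?case
    using Suc.prems
  proof (induction s rule: P_Suc_induct)
    case (add x y)
    then show ?case
      using concat(2)[OF c, of x "Suc m" y] by simp
  next
    case zero
    then show ?case
      using concat(4)[OF c, of "Suc m"] by simp
  next
    case (pure u v)
    then show ?case
      using c by (simp add: concat_pure Suc.IH)
  qed
qed

end

section \<open>Finite sums\<close>

lemma finsum_hom:
  assumes "abelian_monoid G" "abelian_monoid H"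
    and "\<And>x. x \<in> carrier G \<Longrightarrow> h x \<in> carrier H" and "h \<zero>\<^bsub>G\<^esub> = \<zero>\<^bsub>H\<^esub>"
    and "\<And>x y. x \<in> carrier G \<Longrightarrow> y \<in> carrier G \<Longrightarrow> h (x \<oplus>\<^bsub>G\<^esub> y) = h x \<oplus>\<^bsub>H\<^esub> h y"
    and "\<And>i. i \<in> I \<Longrightarrow> f i \<in> carrier G"
  shows "h (finsum G f I) = finsum H (\<lambda>i. h (f i)) I"
proof -
  interpret G: abelian_monoid G by fact
  interpret H: abelian_monoid H by fact
  show ?thesis
    using assms(6)
  proof (induction I rule: infinite_finite_induct)
    case (insert i I)
    then have "finsum G f (insert i I) = f i \<oplus>\<^bsub>G\<^esub> finsum G f I"
      by (intro G.finsum_insert) auto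
    moreover have "finsum H (\<lambda>i. h (f i)) (insert i I) = h (f i) \<oplus>\<^bsub>H\<^esub> finsum H (\<lambda>i. h (f i)) I"
      using insert assms(3) by (intro H.finsum_insert) auto
    ultimately show ?case
      using insert assms(5)[of "f i" "finsum G f I"] by (simp add: G.finsum_closed)
  qed (simp_all add: assms(4))
qed

lemma finsum_mono_rel:
  assumes G: "abelian_monoid G" and r: "preorder_on (carrier G) r" "add_compat G r"
    and "\<And>i. i \<in> I \<Longrightarrow> (f i, g i) \<in> r"
  shows "(finsum G f I, finsum G g I) \<in> r"
proof -
  interpret G: abelian_monoid G by fact
  show ?thesis
    using assms(4)
  proof (induction I rule: infinite_finite_induct)
    case (insert i I)
    have "f j \<in> carrier G \<and> g j \<in> carrier G" if "j \<in> insert i I" for j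
      using preorder_on_carrier[OF r(1) insert.prems[OF that]] .
    then have "finsum G f (insert i I) = f i \<oplus>\<^bsub>G\<^esub> finsum G f I"
      "finsum G g (insert i I) = g i \<oplus>\<^bsub>G\<^esub> finsum G g I"
      using insert by (intro G.finsum_insert; auto)+
    then show ?case
      using insert add_compat2[OF G r] by simp
  qed (simp_all add: preorder_on_refl[OF r(1)])
qed


section \<open>Graded algebras as direct sums\<close>

text \<open>
  Both the tensor algebra (graded by degree) and the polynomial semiring (graded by monomials) are
  direct sums of components over a cancellative monoid, with a convolution product. All their laws
  follow from those for homogeneous elements, since these generate additively and the product is
  biadditive. For a cancellative monoid in which every element splits in finitely many ways,
  \<open>l - k\<close> is the complement of a summand \<open>k\<close> of \<open>l\<close>.
\<close>

locale graded_algebra = K: semiring K + Kc: comm_monoid K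
  for K :: "('k, 'x) ring_scheme" +
  fixes G :: "'g::cancel_comm_monoid_add \<Rightarrow> ('k, 'm, 'y) module_scheme"
    and c :: "'g \<Rightarrow> 'g \<Rightarrow> 'm \<Rightarrow> 'm \<Rightarrow> 'm" and u :: 'm
    and A :: "('k, 'g \<Rightarrow> 'm, 'z) module_scheme"
  assumes G_monoid: "abelian_monoid (G l)"
    and G_smult: "\<lbrakk>a \<in> carrier K; x \<in> carrier (G l)\<rbrakk> \<Longrightarrow> a \<odot>\<^bsub>G l\<^esub> x \<in> carrier (G l)"
      "\<lbrakk>a \<in> carrier K; b \<in> carrier K; x \<in> carrier (G l)\<rbrakk> \<Longrightarrow>
        (a \<oplus>\<^bsub>K\<^esub> b) \<odot>\<^bsub>G l\<^esub> x = a \<odot>\<^bsub>G l\<^esub> x \<oplus>\<^bsub>G l\<^esub> b \<odot>\<^bsub>G l\<^esub> x"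
      "\<lbrakk>a \<in> carrier K; x \<in> carrier (G l); y \<in> carrier (G l)\<rbrakk> \<Longrightarrow>
        a \<odot>\<^bsub>G l\<^esub> (x \<oplus>\<^bsub>G l\<^esub> y) = a \<odot>\<^bsub>G l\<^esub> x \<oplus>\<^bsub>G l\<^esub> a \<odot>\<^bsub>G l\<^esub> y"
      "\<lbrakk>a \<in> carrier K; b \<in> carrier K; x \<in> carrier (G l)\<rbrakk> \<Longrightarrow>
        (a \<otimes>\<^bsub>K\<^esub> b) \<odot>\<^bsub>G l\<^esub> x = a \<odot>\<^bsub>G l\<^esub> (b \<odot>\<^bsub>G l\<^esub> x)"
      "x \<in> carrier (G l) \<Longrightarrow> \<one>\<^bsub>K\<^esub> \<odot>\<^bsub>G l\<^esub> x = x"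
      "x \<in> carrier (G l) \<Longrightarrow> \<zero>\<^bsub>K\<^esub> \<odot>\<^bsub>G l\<^esub> x = \<zero>\<^bsub>G l\<^esub>"
      "a \<in> carrier K \<Longrightarrow> a \<odot>\<^bsub>G l\<^esub> \<zero>\<^bsub>G l\<^esub> = \<zero>\<^bsub>G l\<^esub>"
    and c_closed: "\<lbrakk>x \<in> carrier (G k); y \<in> carrier (G j)\<rbrakk> \<Longrightarrow> c k j x y \<in> carrier (G (k + j))"
    and c_add: "\<lbrakk>x \<in> carrier (G k); x' \<in> carrier (G k); y \<in> carrier (G j)\<rbrakk> \<Longrightarrow>
        c k j (x \<oplus>\<^bsub>G k\<^esub> x') y = c k j x y \<oplus>\<^bsub>G (k + j)\<^esub> c k j x' y"
      "\<lbrakk>x \<in> carrier (G k); y \<in> carrier (G j); y' \<in> carrier (G j)\<rbrakk> \<Longrightarrow>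
        c k j x (y \<oplus>\<^bsub>G j\<^esub> y') = c k j x y \<oplus>\<^bsub>G (k + j)\<^esub> c k j x y'"
    and c_smult: "\<lbrakk>a \<in> carrier K; x \<in> carrier (G k); y \<in> carrier (G j)\<rbrakk> \<Longrightarrow>
        c k j (a \<odot>\<^bsub>G k\<^esub> x) y = a \<odot>\<^bsub>G (k + j)\<^esub> c k j x y"
      "\<lbrakk>a \<in> carrier K; x \<in> carrier (G k); y \<in> carrier (G j)\<rbrakk> \<Longrightarrow>
        c k j x (a \<odot>\<^bsub>G j\<^esub> y) = a \<odot>\<^bsub>G (k + j)\<^esub> c k j x y"
    and c_zero: "y \<in> carrier (G j) \<Longrightarrow> c k j \<zero>\<^bsub>G k\<^esub> y = \<zero>\<^bsub>G (k + j)\<^esub>"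
      "x \<in> carrier (G k) \<Longrightarrow> c k j x \<zero>\<^bsub>G j\<^esub> = \<zero>\<^bsub>G (k + j)\<^esub>"
    and c_assoc: "\<lbrakk>x \<in> carrier (G k); y \<in> carrier (G j); z \<in> carrier (G i)\<rbrakk> \<Longrightarrow>
        c (k + j) i (c k j x y) z = c k (j + i) x (c j i y z)"
    and u_closed: "u \<in> carrier (G 0)"
    and c_unit: "x \<in> carrier (G k) \<Longrightarrow> c 0 k u x = x" "x \<in> carrier (G k) \<Longrightarrow> c k 0 x u = x"
    and splits_finite: "finite {k :: 'g. \<exists>j. k + j = l}"
    and A_carrier: "carrier A = {f. (\<forall>l. f l \<in> carrier (G l)) \<and> finite {l. f l \<noteq> \<zero>\<^bsub>G l\<^esub>}}"
    and A_mult: "\<lbrakk>f \<in> carrier A; g \<in> carrier A\<rbrakk> \<Longrightarrow>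
      (f \<otimes>\<^bsub>A\<^esub> g) l = (\<Oplus>\<^bsub>G l\<^esub>k\<in>{k. \<exists>j. k + j = l}. c k (l - k) (f k) (g (l - k)))"
    and A_one: "\<one>\<^bsub>A\<^esub> = (\<lambda>l. if l = 0 then u else \<zero>\<^bsub>G l\<^esub>)"
    and A_zero: "\<zero>\<^bsub>A\<^esub> = (\<lambda>l. \<zero>\<^bsub>G l\<^esub>)"
    and A_add: "\<lbrakk>f \<in> carrier A; g \<in> carrier A\<rbrakk> \<Longrightarrow> f \<oplus>\<^bsub>A\<^esub> g = (\<lambda>l. f l \<oplus>\<^bsub>G l\<^esub> g l)"
    and A_smult: "\<lbrakk>a \<in> carrier K; f \<in> carrier A\<rbrakk> \<Longrightarrow> a \<odot>\<^bsub>A\<^esub> f = (\<lambda>l. a \<odot>\<^bsub>G l\<^esub> f l)"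

sublocale graded_algebra \<subseteq> G: abelian_monoid "G l" for l
  by (rule G_monoid)

context graded_algebra
begin

text \<open>
  The homogeneous element of degree \<open>l\<close> with component \<open>x\<close>.
\<close>

definition hom :: "'g \<Rightarrow> 'm \<Rightarrow> 'g \<Rightarrow> 'm"
  where "hom l x = (\<lambda>k. if k = l then x else \<zero>\<^bsub>G k\<^esub>)"

lemma A_apply: "f \<in> carrier A \<Longrightarrow> f l \<in> carrier (G l)"
  by (simp add: A_carrier)

lemma A_finite: "f \<in> carrier A \<Longrightarrow> finite {l. f l \<noteq> \<zero>\<^bsub>G l\<^esub>}"
  by (simp add: A_carrier)

lemma A_one_hom: "\<one>\<^bsub>A\<^esub> = hom 0 u"
  by (auto simp: A_one hom_def)

lemma hom_closed: "x \<in> carrier (G l) \<Longrightarrow> hom l x \<in> carrier A"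
  by (auto simp: A_carrier hom_def intro: finite_subset[of _ "{l}"])

lemma hom_zero: "hom l \<zero>\<^bsub>G l\<^esub> = \<zero>\<^bsub>A\<^esub>"
  by (auto simp: hom_def A_zero)

lemma A_monoid: "abelian_monoid A"
proof (rule abelian_monoidI)
  fix f g assume fg: "f \<in> carrier A" "g \<in> carrier A"
  have "{l. f l \<oplus>\<^bsub>G l\<^esub> g l \<noteq> \<zero>\<^bsub>G l\<^esub>} \<subseteq> {l. f l \<noteq> \<zero>\<^bsub>G l\<^esub>} \<union> {l. g l \<noteq> \<zero>\<^bsub>G l\<^esub>}"
    by auto
  then show "f \<oplus>\<^bsub>A\<^esub> g \<in> carrier A"
    using fg A_finite[OF fg(1)] A_finite[OF fg(2)]
    by (auto simp: A_add[OF fg]) (auto simp: A_carrier dest: finite_subset)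
  then show "f \<oplus>\<^bsub>A\<^esub> g = g \<oplus>\<^bsub>A\<^esub> f"
    using fg by (simp add: A_add A_apply G.a_comm)
next
  show "\<zero>\<^bsub>A\<^esub> \<in> carrier A"
    by (simp add: A_zero A_carrier)
  then show "\<zero>\<^bsub>A\<^esub> \<oplus>\<^bsub>A\<^esub> f = f" if "f \<in> carrier A" for f
    using that by (simp add: A_add A_apply) (simp add: A_zero A_apply)
next
  have cl: "f \<oplus>\<^bsub>A\<^esub> g \<in> carrier A" if fg: "f \<in> carrier A" "g \<in> carrier A" for f g
  proof -
    have "{l. f l \<oplus>\<^bsub>G l\<^esub> g l \<noteq> \<zero>\<^bsub>G l\<^esub>} \<subseteq> {l. f l \<noteq> \<zero>\<^bsub>G l\<^esub>} \<union> {l. g l \<noteq> \<zero>\<^bsub>G l\<^esub>}"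
      by auto
    then show ?thesis
      using fg A_finite[OF fg(1)] A_finite[OF fg(2)]
      by (auto simp: A_add[OF fg]) (auto simp: A_carrier dest: finite_subset)
  qed
  show "f \<oplus>\<^bsub>A\<^esub> g \<oplus>\<^bsub>A\<^esub> h = f \<oplus>\<^bsub>A\<^esub> (g \<oplus>\<^bsub>A\<^esub> h)"
    if "f \<in> carrier A" "g \<in> carrier A" "h \<in> carrier A" for f g h
    using that cl[of f g] cl[of g h] by (simp add: A_add) (simp add: A_apply G.a_assoc)
qed

end

sublocale graded_algebra \<subseteq> A: abelian_monoid A
  by (rule A_monoid)

context graded_algebra
begin

lemma hom_add:
  assumes "x \<in> carrier (G l)" "y \<in> carrier (G l)"
  shows "hom l (x \<oplus>\<^bsub>G l\<^esub> y) = hom l x \<oplus>\<^bsub>A\<^esub> hom l y"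
  using assms by (simp add: A_add hom_closed) (auto simp: hom_def)

lemma hom_smult: "\<lbrakk>a \<in> carrier K; x \<in> carrier (G l)\<rbrakk> \<Longrightarrow> a \<odot>\<^bsub>A\<^esub> hom l x = hom l (a \<odot>\<^bsub>G l\<^esub> x)"
  by (simp add: A_smult hom_closed) (auto simp: hom_def G_smult)

lemma graded_induct [consumes 1, case_names add hom]:
  assumes f: "f \<in> carrier A"
    and add: "\<And>f g. \<lbrakk>f \<in> carrier A; g \<in> carrier A; Q f; Q g\<rbrakk> \<Longrightarrow> Q (f \<oplus>\<^bsub>A\<^esub> g)"
    and hom: "\<And>l x. x \<in> carrier (G l) \<Longrightarrow> Q (hom l x)"
  shows "Q f"
proof -
  have "f \<in> carrier A \<Longrightarrow> {l. f l \<noteq> \<zero>\<^bsub>G l\<^esub>} \<subseteq> I \<Longrightarrow> Q f" if "finite I" for I f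
    using that
  proof (induction I arbitrary: f)
    case empty
    then have "f = \<zero>\<^bsub>A\<^esub>"
      by (auto simp: A_zero)
    then show ?case
      using hom[OF G.zero_closed, of undefined] by (simp add: hom_zero)
  next
    case (insert i I)
    define g where "g = (\<lambda>l. if l = i then \<zero>\<^bsub>G l\<^esub> else f l)"
    have "{l. g l \<noteq> \<zero>\<^bsub>G l\<^esub>} \<subseteq> I"
      using insert.prems by (auto simp: g_def)
    moreover from this have g: "g \<in> carrier A"
      using insert.prems(1) finite_subset[OF _ insert.hyps(1)] by (simp add: A_carrier g_def)
    ultimately have "Q g"
      by (intro insert.IH)
    then have "Q (g \<oplus>\<^bsub>A\<^esub> hom i (f i))"
      using insert.prems by (intro add hom g hom_closed A_apply)
    also have "g \<oplus>\<^bsub>A\<^esub> hom i (f i) = f"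
      using insert.prems g by (simp add: A_add hom_closed A_apply) (auto simp: g_def hom_def A_apply)
    finally show ?case .
  qed
  then show ?thesis
    using A_finite[OF f] f by blast
qed

lemma mult_add_left:
  assumes "f \<in> carrier A" "f' \<in> carrier A" "g \<in> carrier A"
  shows "(f \<oplus>\<^bsub>A\<^esub> f') \<otimes>\<^bsub>A\<^esub> g = (\<lambda>l. (f \<otimes>\<^bsub>A\<^esub> g) l \<oplus>\<^bsub>G l\<^esub> (f' \<otimes>\<^bsub>A\<^esub> g) l)"
proof
  fix l
  have "((f \<oplus>\<^bsub>A\<^esub> f') \<otimes>\<^bsub>A\<^esub> g) l = (\<Oplus>\<^bsub>G l\<^esub>k\<in>{k. \<exists>j. k + j = l}.
      c k (l - k) (f k) (g (l - k)) \<oplus>\<^bsub>G l\<^esub> c k (l - k) (f' k) (g (l - k)))"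
    unfolding A_mult[OF A.a_closed[OF assms(1,2)] assms(3)]
    by (rule G.finsum_cong') (use assms c_add(1) in \<open>auto simp: A_add A_apply c_closed\<close>)
  also have "\<dots> = (f \<otimes>\<^bsub>A\<^esub> g) l \<oplus>\<^bsub>G l\<^esub> (f' \<otimes>\<^bsub>A\<^esub> g) l"
    using assms by (subst G.finsum_addf) (auto simp: A_mult c_closed A_apply)
  finally show "((f \<oplus>\<^bsub>A\<^esub> f') \<otimes>\<^bsub>A\<^esub> g) l = (f \<otimes>\<^bsub>A\<^esub> g) l \<oplus>\<^bsub>G l\<^esub> (f' \<otimes>\<^bsub>A\<^esub> g) l" .
qed

lemma mult_add_right:
  assumes "f \<in> carrier A" "g \<in> carrier A" "g' \<in> carrier A"
  shows "f \<otimes>\<^bsub>A\<^esub> (g \<oplus>\<^bsub>A\<^esub> g') = (\<lambda>l. (f \<otimes>\<^bsub>A\<^esub> g) l \<oplus>\<^bsub>G l\<^esub> (f \<otimes>\<^bsub>A\<^esub> g') l)"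
proof
  fix l
  have "(f \<otimes>\<^bsub>A\<^esub> (g \<oplus>\<^bsub>A\<^esub> g')) l = (\<Oplus>\<^bsub>G l\<^esub>k\<in>{k. \<exists>j. k + j = l}.
      c k (l - k) (f k) (g (l - k)) \<oplus>\<^bsub>G l\<^esub> c k (l - k) (f k) (g' (l - k)))"
    unfolding A_mult[OF assms(1) A.a_closed[OF assms(2,3)]]
    by (rule G.finsum_cong') (use assms c_add(2) in \<open>auto simp: A_add A_apply c_closed\<close>)
  also have "\<dots> = (f \<otimes>\<^bsub>A\<^esub> g) l \<oplus>\<^bsub>G l\<^esub> (f \<otimes>\<^bsub>A\<^esub> g') l"
    using assms by (subst G.finsum_addf) (auto simp: A_mult c_closed A_apply)
  finally show "(f \<otimes>\<^bsub>A\<^esub> (g \<oplus>\<^bsub>A\<^esub> g')) l = (f \<otimes>\<^bsub>A\<^esub> g) l \<oplus>\<^bsub>G l\<^esub> (f \<otimes>\<^bsub>A\<^esub> g') l" .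
qed

text \<open>
  Only the splitting \<open>l = k + j\<close> contributes to the convolution of two homogeneous elements.
\<close>

lemma hom_mult:
  assumes x: "x \<in> carrier (G k)" and y: "y \<in> carrier (G j)"
  shows "hom k x \<otimes>\<^bsub>A\<^esub> hom j y = hom (k + j) (c k j x y)"
proof
  fix l
  have conv: "c i (l - i) (hom k x i) (hom j y (l - i)) =
      (if k = i then (if l = k + j then c k j x y else \<zero>\<^bsub>G l\<^esub>) else \<zero>\<^bsub>G l\<^esub>)" if "\<exists>m. i + m = l" for i
    using that x y by (auto simp: hom_def c_zero)
  have "(hom k x \<otimes>\<^bsub>A\<^esub> hom j y) l = (\<Oplus>\<^bsub>G l\<^esub>i\<in>{i. \<exists>m. i + m = l}.
      if k = i then (if l = k + j then c k j x y else \<zero>\<^bsub>G l\<^esub>) else \<zero>\<^bsub>G l\<^esub>)"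
    unfolding A_mult[OF hom_closed[OF x] hom_closed[OF y]]
    by (rule G.finsum_cong') (use conv c_closed[OF x y] in auto)
  also have "\<dots> = hom (k + j) (c k j x y) l"
  proof (cases "l = k + j")
    case True
    then show ?thesis
      using G.finsum_singleton[of k "{i. \<exists>m. i + m = l}" "\<lambda>_. c k j x y" l] splits_finite[of l] c_closed[OF x y]
      by (auto simp: hom_def)
  next
    case False
    then have "(\<Oplus>\<^bsub>G l\<^esub>i\<in>{i. \<exists>m. i + m = l}.
      if k = i then (if l = k + j then c k j x y else \<zero>\<^bsub>G l\<^esub>) else \<zero>\<^bsub>G l\<^esub>) = (\<Oplus>\<^bsub>G l\<^esub>i\<in>{i. \<exists>m. i + m = l}. \<zero>\<^bsub>G l\<^esub>)"
      by (intro G.finsum_cong') auto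
    then show ?thesis
      using False by (simp add: hom_def)
  qed
  finally show "(hom k x \<otimes>\<^bsub>A\<^esub> hom j y) l = hom (k + j) (c k j x y) l" .
qed

text \<open>
  Finiteness of the support of a product is read off from the homogeneous case by biadditivity.
  The distributive laws are therefore first stated componentwise.
\<close>

lemma mult_closed:
  assumes "f \<in> carrier A" "g \<in> carrier A"
  shows "f \<otimes>\<^bsub>A\<^esub> g \<in> carrier A"
proof -
  have hom: "hom k x \<otimes>\<^bsub>A\<^esub> g \<in> carrier A" if "x \<in> carrier (G k)" for k x
    using assms(2)
  proof (induction g rule: graded_induct)
    case (add f g)
    then have "hom k x \<otimes>\<^bsub>A\<^esub> (f \<oplus>\<^bsub>A\<^esub> g) = (hom k x \<otimes>\<^bsub>A\<^esub> f) \<oplus>\<^bsub>A\<^esub> (hom k x \<otimes>\<^bsub>A\<^esub> g)"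
      using that by (simp add: A_add[of "hom k x \<otimes>\<^bsub>A\<^esub> f"] mult_add_right hom_closed)
    then show ?case using add by simp
  qed (simp add: hom_mult that hom_closed c_closed)
  show ?thesis
    using assms(1)
  proof (induction f rule: graded_induct)
    case (add f f')
    then have "(f \<oplus>\<^bsub>A\<^esub> f') \<otimes>\<^bsub>A\<^esub> g = (f \<otimes>\<^bsub>A\<^esub> g) \<oplus>\<^bsub>A\<^esub> (f' \<otimes>\<^bsub>A\<^esub> g)"
      using assms(2) by (simp add: A_add[of "f \<otimes>\<^bsub>A\<^esub> g"] mult_add_left)
    then show ?case using add by simp
  qed (rule hom)
qed

lemma mult_distr:
  "\<lbrakk>f \<in> carrier A; f' \<in> carrier A; g \<in> carrier A\<rbrakk> \<Longrightarrow> (f \<oplus>\<^bsub>A\<^esub> f') \<otimes>\<^bsub>A\<^esub> g = f \<otimes>\<^bsub>A\<^esub> g \<oplus>\<^bsub>A\<^esub> f' \<otimes>\<^bsub>A\<^esub> g"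
  "\<lbrakk>f \<in> carrier A; g \<in> carrier A; g' \<in> carrier A\<rbrakk> \<Longrightarrow> f \<otimes>\<^bsub>A\<^esub> (g \<oplus>\<^bsub>A\<^esub> g') = f \<otimes>\<^bsub>A\<^esub> g \<oplus>\<^bsub>A\<^esub> f \<otimes>\<^bsub>A\<^esub> g'"
  by (simp_all add: mult_add_left mult_add_right A_add[of "f \<otimes>\<^bsub>A\<^esub> g"] mult_closed)

lemma smult_closed: "\<lbrakk>a \<in> carrier K; f \<in> carrier A\<rbrakk> \<Longrightarrow> a \<odot>\<^bsub>A\<^esub> f \<in> carrier A"
proof -
  assume a: "a \<in> carrier K" and f: "f \<in> carrier A"
  have "{l. a \<odot>\<^bsub>G l\<^esub> f l \<noteq> \<zero>\<^bsub>G l\<^esub>} \<subseteq> {l. f l \<noteq> \<zero>\<^bsub>G l\<^esub>}"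
    using a by (auto simp: G_smult)
  then show ?thesis
    using a f A_finite[OF f] by (auto simp: A_smult A_carrier G_smult dest: finite_subset)
qed

lemma smult_add: "\<lbrakk>a \<in> carrier K; f \<in> carrier A; g \<in> carrier A\<rbrakk> \<Longrightarrow>
    a \<odot>\<^bsub>A\<^esub> (f \<oplus>\<^bsub>A\<^esub> g) = a \<odot>\<^bsub>A\<^esub> f \<oplus>\<^bsub>A\<^esub> a \<odot>\<^bsub>A\<^esub> g"
  using smult_closed[of a f] smult_closed[of a g] A.a_closed[of f g]
  by (simp add: A_smult A_add) (simp add: A_add[symmetric] A_smult, simp add: A_add G_smult A_apply)

lemma A_semiring: "semiring A"
proof -
  have assoc: "f \<otimes>\<^bsub>A\<^esub> g \<otimes>\<^bsub>A\<^esub> h = f \<otimes>\<^bsub>A\<^esub> (g \<otimes>\<^bsub>A\<^esub> h)"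
    if f: "f \<in> carrier A" and g: "g \<in> carrier A" and h: "h \<in> carrier A" for f g h
    using f
  proof (induction f rule: graded_induct)
    case f: (hom k x)
    show ?case
      using g
    proof (induction g rule: graded_induct)
      case g: (hom j y)
      show ?case
        using h
      proof (induction h rule: graded_induct)
        case (hom i z)
        then show ?case
          using f g by (simp add: hom_mult c_closed c_assoc add.assoc)
      qed (use f g in \<open>simp add: mult_distr mult_closed hom_closed\<close>)
    qed (use f h in \<open>simp add: mult_distr mult_closed hom_closed\<close>)
  qed (use g h in \<open>simp add: mult_distr mult_closed\<close>)
  have one: "\<one>\<^bsub>A\<^esub> \<otimes>\<^bsub>A\<^esub> f = f \<and> f \<otimes>\<^bsub>A\<^esub> \<one>\<^bsub>A\<^esub> = f" if "f \<in> carrier A" for f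
    using that
    by (induction f rule: graded_induct)
      (simp_all add: A_one_hom mult_distr hom_closed u_closed hom_mult c_unit)
  have null: "\<zero>\<^bsub>A\<^esub> \<otimes>\<^bsub>A\<^esub> f = \<zero>\<^bsub>A\<^esub> \<and> f \<otimes>\<^bsub>A\<^esub> \<zero>\<^bsub>A\<^esub> = \<zero>\<^bsub>A\<^esub>" if "f \<in> carrier A" for f
    using that
  proof (induction f rule: graded_induct)
    case (hom l x)
    have "hom 0 \<zero>\<^bsub>G 0\<^esub> \<otimes>\<^bsub>A\<^esub> hom l x = \<zero>\<^bsub>A\<^esub>" "hom l x \<otimes>\<^bsub>A\<^esub> hom 0 \<zero>\<^bsub>G 0\<^esub> = \<zero>\<^bsub>A\<^esub>"
      using hom by (simp_all add: hom_mult c_zero, simp_all add: hom_zero)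
    then show ?case
      unfolding hom_zero by blast
  qed (simp add: mult_distr)
  show ?thesis
    by unfold_locales (use assoc one null in \<open>auto simp: mult_closed mult_distr A_one_hom hom_closed u_closed\<close>)
qed

theorem graded_semialgebra: "semialgebra K A"
proof -
  have mult_l: "(a \<odot>\<^bsub>A\<^esub> f) \<otimes>\<^bsub>A\<^esub> g = a \<odot>\<^bsub>A\<^esub> (f \<otimes>\<^bsub>A\<^esub> g)" and mult_r: "f \<otimes>\<^bsub>A\<^esub> (a \<odot>\<^bsub>A\<^esub> g) = a \<odot>\<^bsub>A\<^esub> (f \<otimes>\<^bsub>A\<^esub> g)"
    if a: "a \<in> carrier K" and f: "f \<in> carrier A" and g: "g \<in> carrier A" for a f g
  proof -
    have "(a \<odot>\<^bsub>A\<^esub> f) \<otimes>\<^bsub>A\<^esub> g = a \<odot>\<^bsub>A\<^esub> (f \<otimes>\<^bsub>A\<^esub> g) \<and> f \<otimes>\<^bsub>A\<^esub> (a \<odot>\<^bsub>A\<^esub> g) = a \<odot>\<^bsub>A\<^esub> (f \<otimes>\<^bsub>A\<^esub> g)"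
      using f
    proof (induction f rule: graded_induct)
      case f: (hom k x)
      show ?case
        using g
        by (induction g rule: graded_induct)
          (use a f in \<open>simp_all add: mult_distr smult_add hom_closed hom_smult hom_mult c_smult G_smult(1)
            c_closed mult_closed smult_closed\<close>)
    qed (use a g in \<open>simp add: mult_distr smult_add mult_closed smult_closed\<close>)
    then show "(a \<odot>\<^bsub>A\<^esub> f) \<otimes>\<^bsub>A\<^esub> g = a \<odot>\<^bsub>A\<^esub> (f \<otimes>\<^bsub>A\<^esub> g)" "f \<otimes>\<^bsub>A\<^esub> (a \<odot>\<^bsub>A\<^esub> g) = a \<odot>\<^bsub>A\<^esub> (f \<otimes>\<^bsub>A\<^esub> g)"
      by auto
  qed
  have sm: "(a \<oplus>\<^bsub>K\<^esub> b) \<odot>\<^bsub>A\<^esub> f = a \<odot>\<^bsub>A\<^esub> f \<oplus>\<^bsub>A\<^esub> b \<odot>\<^bsub>A\<^esub> f" "(a \<otimes>\<^bsub>K\<^esub> b) \<odot>\<^bsub>A\<^esub> f = a \<odot>\<^bsub>A\<^esub> (b \<odot>\<^bsub>A\<^esub> f)"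
    if "a \<in> carrier K" "b \<in> carrier K" "f \<in> carrier A" for a b f
    using that smult_closed[of a f] smult_closed[of b f] by (auto simp: A_smult A_add G_smult A_apply)
  have zero: "\<zero>\<^bsub>K\<^esub> \<odot>\<^bsub>A\<^esub> f = \<zero>\<^bsub>A\<^esub>" "\<one>\<^bsub>K\<^esub> \<odot>\<^bsub>A\<^esub> f = f" if "f \<in> carrier A" for f
    using that by (auto simp: A_smult A_zero G_smult A_apply)
  have zero': "a \<odot>\<^bsub>A\<^esub> \<zero>\<^bsub>A\<^esub> = \<zero>\<^bsub>A\<^esub>" if "a \<in> carrier K" for a
    using that by (auto simp: A_smult) (simp add: A_zero G_smult)
  show ?thesis
    unfolding semialgebra_def
    using K.semiring_axioms Kc.comm_monoid_axioms A_semiring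
    by (auto simp: smult_closed sm smult_add mult_l mult_r zero zero')
qed

end

text \<open>
  Maps on the components add up to a map on the direct sum, since supports are finite; that it is
  multiplicative needs to be verified on homogeneous elements only.
\<close>

locale graded_hom = graded_algebra K G c u A + C: semialg K C
  for K :: "('k, 'x) ring_scheme" and G :: "'g::cancel_comm_monoid_add \<Rightarrow> ('k, 'm, 'y) module_scheme"
    and c u and A :: "('k, 'g \<Rightarrow> 'm, 'z) module_scheme" and C :: "('k, 'c, 'w) module_scheme" +
  fixes F :: "'g \<Rightarrow> 'm \<Rightarrow> 'c"
  assumes F_closed: "x \<in> carrier (G l) \<Longrightarrow> F l x \<in> carrier C"
    and F_add: "\<lbrakk>x \<in> carrier (G l); y \<in> carrier (G l)\<rbrakk> \<Longrightarrow> F l (x \<oplus>\<^bsub>G l\<^esub> y) = F l x \<oplus>\<^bsub>C\<^esub> F l y"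
    and F_zero: "F l \<zero>\<^bsub>G l\<^esub> = \<zero>\<^bsub>C\<^esub>"
    and F_smult: "\<lbrakk>a \<in> carrier K; x \<in> carrier (G l)\<rbrakk> \<Longrightarrow> F l (a \<odot>\<^bsub>G l\<^esub> x) = a \<odot>\<^bsub>C\<^esub> F l x"
    and F_mult: "\<lbrakk>x \<in> carrier (G k); y \<in> carrier (G j)\<rbrakk> \<Longrightarrow> F (k + j) (c k j x y) = F k x \<otimes>\<^bsub>C\<^esub> F j y"
    and F_one: "F 0 u = \<one>\<^bsub>C\<^esub>"
begin

definition ext :: "('g \<Rightarrow> 'm) \<Rightarrow> 'c"
  where "ext f = (\<Oplus>\<^bsub>C\<^esub>l\<in>{l. f l \<noteq> \<zero>\<^bsub>G l\<^esub>}. F l (f l))"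

lemma ext_superset:
  assumes "f \<in> carrier A" "finite I" "{l. f l \<noteq> \<zero>\<^bsub>G l\<^esub>} \<subseteq> I"
  shows "ext f = (\<Oplus>\<^bsub>C\<^esub>l\<in>I. F l (f l))"
  unfolding ext_def
  by (rule C.A.add.finprod_mono_neutral_cong_left) (use assms in \<open>auto simp: F_zero F_closed A_apply\<close>)

lemma ext_closed: "f \<in> carrier A \<Longrightarrow> ext f \<in> carrier C"
  by (auto simp: ext_def A_apply F_closed intro!: C.A.finsum_closed)

lemma ext_add:
  assumes "f \<in> carrier A" "g \<in> carrier A"
  shows "ext (f \<oplus>\<^bsub>A\<^esub> g) = ext f \<oplus>\<^bsub>C\<^esub> ext g"
proof -
  let ?I = "{l. f l \<noteq> \<zero>\<^bsub>G l\<^esub>} \<union> {l. g l \<noteq> \<zero>\<^bsub>G l\<^esub>}"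
  have fin: "finite ?I"
    using assms A_finite by auto
  have "ext (f \<oplus>\<^bsub>A\<^esub> g) = (\<Oplus>\<^bsub>C\<^esub>l\<in>?I. F l ((f \<oplus>\<^bsub>A\<^esub> g) l))"
    by (rule ext_superset[OF A.a_closed[OF assms] fin]) (use assms in \<open>auto simp: A_add\<close>)
  also have "\<dots> = (\<Oplus>\<^bsub>C\<^esub>l\<in>?I. F l (f l) \<oplus>\<^bsub>C\<^esub> F l (g l))"
    by (rule C.A.finsum_cong') (use assms in \<open>auto simp: A_add A_apply F_add F_closed\<close>)
  also have "\<dots> = (\<Oplus>\<^bsub>C\<^esub>l\<in>?I. F l (f l)) \<oplus>\<^bsub>C\<^esub> (\<Oplus>\<^bsub>C\<^esub>l\<in>?I. F l (g l))"
    by (rule C.A.finsum_addf) (use assms in \<open>auto simp: A_apply F_closed\<close>)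
  also have "\<dots> = ext f \<oplus>\<^bsub>C\<^esub> ext g"
    using ext_superset[OF assms(1) fin] ext_superset[OF assms(2) fin] by simp
  finally show ?thesis .
qed

lemma ext_hom:
  assumes x: "x \<in> carrier (G l)"
  shows "ext (hom l x) = F l x"
proof -
  have "ext (hom l x) = (\<Oplus>\<^bsub>C\<^esub>k\<in>{l}. F k (hom l x k))"
    by (rule ext_superset[OF hom_closed[OF x]]) (auto simp: hom_def)
  also have "\<dots> = F l x"
    using F_closed[OF x] by (subst C.A.finsum_insert) (auto simp: hom_def)
  finally show ?thesis .
qed

lemma ext_zero: "ext \<zero>\<^bsub>A\<^esub> = \<zero>\<^bsub>C\<^esub>"
  by (simp add: ext_def A_zero)

lemma ext_one: "ext \<one>\<^bsub>A\<^esub> = \<one>\<^bsub>C\<^esub>"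
  by (simp add: A_one_hom ext_hom u_closed F_one)

lemma ext_smult: "\<lbrakk>a \<in> carrier K; f \<in> carrier A\<rbrakk> \<Longrightarrow> ext (a \<odot>\<^bsub>A\<^esub> f) = a \<odot>\<^bsub>C\<^esub> ext f"
proof -
  assume a: "a \<in> carrier K"
  show "f \<in> carrier A \<Longrightarrow> ?thesis"
    by (induction f rule: graded_induct)
      (use a in \<open>simp_all add: smult_add ext_add smult_closed C.smult_r_distr ext_closed hom_smult ext_hom
        G_smult(1) F_smult\<close>)
qed

lemma ext_mult: "\<lbrakk>f \<in> carrier A; g \<in> carrier A\<rbrakk> \<Longrightarrow> ext (f \<otimes>\<^bsub>A\<^esub> g) = ext f \<otimes>\<^bsub>C\<^esub> ext g"
proof (induction f rule: graded_induct)
  case f: (hom k x)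
  show ?case
    using f(2)
    by (induction g rule: graded_induct)
      (use f(1) in \<open>simp_all add: mult_distr ext_add mult_closed C.A.r_distr ext_closed hom_closed hom_mult
        ext_hom c_closed F_closed F_mult\<close>)
qed (simp add: mult_distr ext_add mult_closed C.A.l_distr ext_closed)

lemma ext_mono:
  assumes r: "preorder_on (carrier C) r" "add_compat C r"
    and f: "f \<in> carrier A" "g \<in> carrier A" "\<And>l. (F l (f l), F l (g l)) \<in> r"
  shows "(ext f, ext g) \<in> r"
proof -
  let ?I = "{l. f l \<noteq> \<zero>\<^bsub>G l\<^esub>} \<union> {l. g l \<noteq> \<zero>\<^bsub>G l\<^esub>}"
  have fin: "finite ?I"
    using f A_finite by auto
  show ?thesis
    using finsum_mono_rel[OF C.A.abelian_monoid_axioms r, of ?I] f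
      ext_superset[OF f(1) fin] ext_superset[OF f(2) fin] by simp
qed

end

section \<open>The tensor algebra\<close>

context tensor_powers
begin

abbreviation T where "T \<equiv> tensor_algebra B n"
abbreviation tv where "tv \<equiv> tensor_vec B n"

lemma T_carrier: "carrier T = {f. (\<forall>l. f l \<in> carrier (P l)) \<and> finite {l. f l \<noteq> \<zero>\<^bsub>P l\<^esub>}}"
  by (simp add: tensor_algebra_def Let_def)

lemma tensor_algebra_graded: "graded_algebra B P cc (Scalar \<one>) T"
proof -
  have splits: "{k. \<exists>j. k + j = l} = {..l}" for l :: nat
    by (auto simp: le_iff_add)
  interpret T: semiring B by (rule semiring_axioms)
  interpret T: comm_monoid B by (rule comm_monoid_axioms)
  show ?thesis
    by unfold_locales
      (auto simp: T_carrier splits P.smult_l_distr P.smult_r_distr P.smult_assoc concat concat_add_left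
        concat_smult_left concat_zero_left concat_assoc concat_one_left concat_0 P0_carrier,
       auto simp: tensor_algebra_def Let_def)
qed

end

sublocale tensor_powers \<subseteq> T: graded_algebra B "tensor_power B n" "tensor_concat B n" "Scalar \<one>" "tensor_algebra B n"
  by (rule tensor_algebra_graded)

sublocale tensor_powers \<subseteq> T: semialg B "tensor_algebra B n"
  by unfold_locales (rule T.graded_semialgebra)

context tensor_powers
begin

lemma T_mle_iff: "(f, g) \<in> mle T \<longleftrightarrow> f \<in> carrier T \<and> g \<in> carrier T \<and> (\<forall>l. (f l, g l) \<in> mle (P l))"
  unfolding T_carrier by (simp add: tensor_algebra_def Let_def)

lemma T_mle_carrier: "mle T \<subseteq> carrier T \<times> carrier T"
  by (auto simp: T_mle_iff)

lemma T_mle_smult: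
  assumes "(a, b) \<in> ble B" "f \<in> carrier T"
  shows "(a \<odot>\<^bsub>T\<^esub> f, b \<odot>\<^bsub>T\<^esub> f) \<in> mle T"
  using assms preorder_on_carrier[OF ble_preorder assms(1)]
  by (auto simp: T_mle_iff T.smult_closed)
    (simp add: T.A_smult P.mle_smult T.A_apply preorder_on_refl[OF P.mle_preorder])

lemma Scalar_one_closed: "Scalar \<one> \<in> carrier (P 0)"
  by (simp add: P0_carrier)

lemma tensor_vec_hom: "tv v = T.hom 1 (ts 0 {#(Scalar \<one>, v)#})"
  by (auto simp: tensor_vec_def T.hom_def)

lemma tensor_vec_closed [simp]: "v \<in> carrier V \<Longrightarrow> tv v \<in> carrier T"
  unfolding tensor_vec_hom
  by (intro T.hom_closed) (simp add: pure_tensor(1) Scalar_one_closed)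

lemma tensor_vec_add: "u \<in> carrier V \<Longrightarrow> v \<in> carrier V \<Longrightarrow> tv (u \<oplus>\<^bsub>V\<^esub> v) = tv u \<oplus>\<^bsub>T\<^esub> tv v"
  unfolding tensor_vec_hom
  using pure_tensor(1,3)[OF Scalar_one_closed] by (simp add: T.hom_add)

lemma tensor_vec_smult: "b \<in> carrier B \<Longrightarrow> v \<in> carrier V \<Longrightarrow> tv (b \<odot>\<^bsub>V\<^esub> v) = b \<odot>\<^bsub>T\<^esub> tv v"
  unfolding tensor_vec_hom
  using pure_tensor(1,5) Scalar_one_closed by (simp add: T.hom_smult)

lemma tensor_vec_zero: "tv \<zero>\<^bsub>V\<^esub> = \<zero>\<^bsub>T\<^esub>"
  unfolding tensor_vec_hom
  using pure_tensor(7)[OF Scalar_one_closed] T.hom_zero[of 1] by simp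

text \<open>
  Vectors are elements of \<open>B \<otimes> B\<^sup>n\<close> in degree one, so that multiplication by a vector from the
  right is one more tensor factor.
\<close>

lemma hom_mult_tensor_vec:
  assumes "t \<in> carrier (P l)" "v \<in> carrier V"
  shows "T.hom l t \<otimes>\<^bsub>T\<^esub> tv v = T.hom (Suc l) (ts l {#(t, v)#})"
proof -
  have "ts 0 {#(Scalar \<one>, v)#} \<in> carrier (P 1)"
    using assms pure_tensor(1) Scalar_one_closed by simp
  then have "T.hom l t \<otimes>\<^bsub>T\<^esub> tv v = T.hom (l + 1) (cc l 1 t (ts 0 {#(Scalar \<one>, v)#}))"
    unfolding tensor_vec_hom using assms by (intro T.hom_mult)
  also have "cc l 1 t (ts 0 {#(Scalar \<one>, v)#}) = ts l {#(t, v)#}"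
    using concat_pure[OF assms(1) Scalar_one_closed assms(2)] assms by (simp add: concat_0)
  finally show ?thesis
    by simp
qed

text \<open>
  A homogeneous element of positive degree is a sum of products of an element of the preceding degree
  with a vector. Hence the basis vectors generate the tensor algebra as an algebra.
\<close>

lemma T_induct [consumes 1, case_names add mult smult one basis]:
  assumes x: "x \<in> carrier T"
    and add: "\<And>x y. \<lbrakk>x \<in> carrier T; y \<in> carrier T; Q x; Q y\<rbrakk> \<Longrightarrow> Q (x \<oplus>\<^bsub>T\<^esub> y)"
    and mult: "\<And>x y. \<lbrakk>x \<in> carrier T; y \<in> carrier T; Q x; Q y\<rbrakk> \<Longrightarrow> Q (x \<otimes>\<^bsub>T\<^esub> y)"
    and smult: "\<And>b x. \<lbrakk>b \<in> carrier B; x \<in> carrier T; Q x\<rbrakk> \<Longrightarrow> Q (b \<odot>\<^bsub>T\<^esub> x)"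
    and one: "Q \<one>\<^bsub>T\<^esub>"
    and basis: "\<And>i. i \<in> {1..n} \<Longrightarrow> Q (tv (basis i))"
  shows "Q x"
proof -
  have zero: "Q \<zero>\<^bsub>T\<^esub>"
    using smult[OF zero_closed _ one] by simp
  have vec: "Q (tv v)" if "v \<in> carrier V" for v
    using that
    by (induction v rule: V_induct) (use add smult zero basis in \<open>auto simp: tensor_vec_add tensor_vec_smult tensor_vec_zero\<close>)
  have hom: "Q (T.hom l t)" if "t \<in> carrier (P l)" for l t
    using that
  proof (induction l arbitrary: t)
    case 0
    then obtain b where "b \<in> carrier B" "t = b \<odot>\<^bsub>P 0\<^esub> Scalar \<one>"
      by (auto simp: P0_carrier P0_smult)
    then have "T.hom 0 t = b \<odot>\<^bsub>T\<^esub> \<one>\<^bsub>T\<^esub>"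
      by (simp add: T.A_one_hom T.hom_smult Scalar_one_closed)
    then show ?case
      using smult[OF \<open>b \<in> carrier B\<close> _ one] by simp
  next
    case (Suc l)
    from Suc.prems show ?case
    proof (induction t rule: P_Suc_induct)
      case (add x y)
      then show ?case
        using assms(2)[of "T.hom (Suc l) x" "T.hom (Suc l) y"] by (simp add: T.hom_add T.hom_closed)
    next
      case zero
      then show ?case
        using \<open>Q \<zero>\<^bsub>T\<^esub>\<close> T.hom_zero[of "Suc l"] by simp
    next
      case (pure u v)
      then show ?case
        using mult[of "T.hom l u" "tv v"] Suc.IH[of u] vec[of v]
        by (simp add: hom_mult_tensor_vec T.hom_closed)
    qed
  qed
  show ?thesis
    using x by (induction x rule: T.graded_induct) (use add hom in auto)
qed

end

subsection \<open>Its universal property\<close>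

text \<open>
  A target is a \<open>B\<close>-algebra with a partial order \<open>r\<close> for which \<open>a \<le> b\<close> in \<open>B\<close> implies
  \<open>a x \<le> b x\<close>, with chosen elements \<open>g\<^sub>1, \<dots>, g\<^sub>n\<close>. Taking equality or the natural order
  of an idempotent semiring for \<open>r\<close> gives the two cases of interest.
\<close>

locale tensor_target = tensor_powers B n + C: semialg B C
  for B :: "('b, 'z) oblueprint_scheme" (structure) and n :: nat and C :: "('b, 'c, 'w) module_scheme" +
  fixes r :: "('c \<times> 'c) set" and g :: "nat \<Rightarrow> 'c"
  assumes r_order: "partial_order_on (carrier C) r"
    and r_add: "add_compat C r"
    and r_mult: "mult_compat C r"
    and r_smult: "\<lbrakk>(a, b) \<in> ble B; x \<in> carrier C\<rbrakk> \<Longrightarrow> (a \<odot>\<^bsub>C\<^esub> x, b \<odot>\<^bsub>C\<^esub> x) \<in> r"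
    and g_closed: "i \<in> {1..n} \<Longrightarrow> g i \<in> carrier C"
begin

lemma r_preorder: "preorder_on (carrier C) r"
  using r_order by (simp add: partial_order_on_def)

abbreviation L :: "('b, 'c) omodule"
  where "L \<equiv> \<lparr>carrier = carrier C, mult = mult C, one = \<one>\<^bsub>C\<^esub>, zero = \<zero>\<^bsub>C\<^esub>, add = add C,
     smult = smult C, mle = r\<rparr>"

lemma L_module: "ordered_module B L"
proof -
  interpret L: abelian_monoid L
    by (rule abelian_monoidI) (auto simp: C.A.a_ac)
  show ?thesis
  proof (unfold_locales; simp?)
    fix a b x y assume *: "(a, b) \<in> ble B" "(x, y) \<in> r"
    have "a \<in> carrier B" "y \<in> carrier C"
      using * preorder_on_carrier[OF ble_preorder] preorder_on_carrier[OF r_preorder] by blast+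
    then show "(a \<odot>\<^bsub>C\<^esub> x, b \<odot>\<^bsub>C\<^esub> y) \<in> r"
      using C.smult_compat[OF r_mult r_preorder *(2), of a] r_smult[OF *(1), of y]
        preorder_on_trans[OF r_preorder] by blast
  qed (auto simp: C.smult_l_distr C.smult_r_distr C.smult_assoc r_order
        intro!: add_compatI dest: add_compatD[OF r_add])
qed

definition vec_map :: "(nat \<Rightarrow> 'b) \<Rightarrow> 'c"
  where "vec_map v = (\<Oplus>\<^bsub>C\<^esub>i\<in>{1..n}. v i \<odot>\<^bsub>C\<^esub> g i)"

lemma vec_map_term: "v \<in> carrier V \<Longrightarrow> i \<in> {1..n} \<Longrightarrow> v i \<odot>\<^bsub>C\<^esub> g i \<in> carrier C"
  using V_apply_closed g_closed by blast

lemma vec_map_closed: "v \<in> carrier V \<Longrightarrow> vec_map v \<in> carrier C"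
  unfolding vec_map_def using vec_map_term by (intro C.A.finsum_closed) auto

lemma vec_map_linear: "linear_map B V L vec_map"
  unfolding linear_map_def
proof (intro conjI ballI)
  fix u v assume u: "u \<in> carrier V" and v: "v \<in> carrier V"
  have "vec_map (u \<oplus>\<^bsub>V\<^esub> v) = (\<Oplus>\<^bsub>C\<^esub>i\<in>{1..n}. u i \<odot>\<^bsub>C\<^esub> g i \<oplus>\<^bsub>C\<^esub> v i \<odot>\<^bsub>C\<^esub> g i)"
    unfolding vec_map_def
    by (rule C.A.finsum_cong') (use u v V_apply_closed g_closed in \<open>auto simp: V_apply C.smult_l_distr\<close>)
  also have "\<dots> = vec_map u \<oplus>\<^bsub>C\<^esub> vec_map v"
    unfolding vec_map_def using vec_map_term u v by (intro C.A.finsum_addf) auto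
  finally show "vec_map (u \<oplus>\<^bsub>V\<^esub> v) = vec_map u \<oplus>\<^bsub>L\<^esub> vec_map v"
    by simp
next
  fix b v assume b: "b \<in> carrier B" and v: "v \<in> carrier V"
  have "vec_map (b \<odot>\<^bsub>V\<^esub> v) = (\<Oplus>\<^bsub>C\<^esub>i\<in>{1..n}. b \<odot>\<^bsub>C\<^esub> (v i \<odot>\<^bsub>C\<^esub> g i))"
    unfolding vec_map_def
    by (rule C.A.finsum_cong') (use b v V_apply_closed g_closed in \<open>auto simp: V_apply C.smult_assoc\<close>)
  also have "\<dots> = b \<odot>\<^bsub>C\<^esub> vec_map v"
    unfolding vec_map_def
    by (rule finsum_hom[OF C.A.abelian_monoid_axioms C.A.abelian_monoid_axioms, symmetric])
      (use b v vec_map_term in \<open>auto simp: C.smult_r_distr\<close>)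
  finally show "vec_map (b \<odot>\<^bsub>V\<^esub> v) = b \<odot>\<^bsub>L\<^esub> vec_map v"
    by simp
next
  have "vec_map \<zero>\<^bsub>V\<^esub> = (\<Oplus>\<^bsub>C\<^esub>i\<in>{1..n}. \<zero>\<^bsub>C\<^esub>)"
    unfolding vec_map_def by (rule C.A.finsum_cong') (use g_closed in \<open>auto simp: V_apply\<close>)
  then show "vec_map \<zero>\<^bsub>V\<^esub> = \<zero>\<^bsub>L\<^esub>"
    by simp
next
  fix p assume p: "p \<in> mle V"
  show "case p of (u, v) \<Rightarrow> (vec_map u, vec_map v) \<in> mle L"
    using p unfolding vec_map_def
    by (auto simp: free_module_def g_closed
        intro!: finsum_mono_rel[OF C.A.abelian_monoid_axioms r_preorder r_add] r_smult)
qed (simp add: vec_map_closed)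

lemma vec_map_basis:
  assumes "i \<in> {1..n}"
  shows "vec_map (basis i) = g i"
proof -
  have "vec_map (basis i) = (\<Oplus>\<^bsub>C\<^esub>j\<in>{1..n}. if i = j then g j else \<zero>\<^bsub>C\<^esub>)"
    unfolding vec_map_def
    by (rule C.A.finsum_cong') (use g_closed in \<open>auto simp: basis_vec_def\<close>)
  also have "\<dots> = g i"
    by (rule C.A.finsum_singleton) (use assms g_closed in auto)
  finally show ?thesis .
qed

text \<open>
  The map \<open>v\<^sub>1 \<otimes> \<dots> \<otimes> v\<^sub>l \<mapsto> \<psi>(v\<^sub>1) \<cdots> \<psi>(v\<^sub>l)\<close>, where \<open>\<psi>\<close> is the linear extension of
  \<open>e\<^sub>i \<mapsto> g\<^sub>i\<close>.
\<close>

primrec power_map :: "nat \<Rightarrow> 'b tensor \<Rightarrow> 'c"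
  where
    "power_map 0 t = the_scalar t \<odot>\<^bsub>C\<^esub> \<one>\<^bsub>C\<^esub>"
  | "power_map (Suc l) t = msum L (\<lambda>(u, v). power_map l u \<otimes>\<^bsub>C\<^esub> vec_map v) (the_sum t)"

lemma mult_bilinear:
  assumes "linear_map B (P l) L f"
  shows "bilinear_map B (P l) V L (\<lambda>(u, v). f u \<otimes>\<^bsub>C\<^esub> vec_map v)"
  using linear_mapD[OF assms] linear_mapD[OF vec_map_linear] mult_compat2[OF r_preorder r_mult]
  unfolding bilinear_map_def
  by (auto simp: C.A.l_distr C.A.r_distr C.smult_mult_l C.smult_mult_r)

lemma power_map_linear: "linear_map B (P l) L (power_map l)"
proof (induction l)
  case 0
  then show ?case
    using r_smult by (auto simp: linear_map_def P0_carrier P0_add P0_smult P0_zero P0_mle C.smult_l_distr C.smult_assoc)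
next
  case (Suc l)
  show ?case
    unfolding power_map.simps by (rule induced_linear_map[OF L_module mult_bilinear[OF Suc]])
qed

lemmas power_map = linear_mapD[OF power_map_linear, simplified]

lemma power_map_pure:
  assumes "u \<in> carrier (P l)" "v \<in> carrier V"
  shows "power_map (Suc l) (ts l {#(u, v)#}) = power_map l u \<otimes>\<^bsub>C\<^esub> vec_map v"
proof -
  interpret L: ordered_module B L by (rule L_module)
  show ?thesis
    using assms msum_ts[OF L_module mult_bilinear[OF power_map_linear], of "{#(u, v)#}" l]
      power_map(1) vec_map_closed by simp
qed

declare power_map.simps(2) [simp del]

lemma power_map_concat:
  assumes t: "t \<in> carrier (P l)" and s: "s \<in> carrier (P m)"
  shows "power_map (l + m) (cc l m t s) = power_map l t \<otimes>\<^bsub>C\<^esub> power_map m s"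
  using s
proof (induction m arbitrary: s)
  case 0
  then show ?case
    using t power_map(1)[OF t] by (auto simp: P0_carrier concat_0 power_map(3) C.smult_mult_r)
next
  case (Suc m)
  from Suc.prems show ?case
  proof (induction s rule: P_Suc_induct)
    case (add x y)
    then show ?case
      using concat(1)[OF t, of x "Suc m"] concat(1)[OF t, of y "Suc m"] power_map(1)[OF t]
      by (simp add: concat(2)[OF t] power_map(1,2) C.A.r_distr del: add_Suc_right)
  next
    case zero
    then show ?case
      using power_map(1)[OF t] by (simp add: concat(4)[OF t] power_map(4) del: add_Suc_right)
  next
    case (pure u v)
    then show ?case
      using t Suc.IH[of u] by (simp add: concat_pure power_map_pure concat(1) power_map(1) vec_map_closed C.A.m_assoc)
  qed
qed

end

sublocale tensor_target \<subseteq> up: graded_hom B "tensor_power B n" "tensor_concat B n" "Scalar \<one>" "tensor_algebra B n" C power_map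
  by unfold_locales (auto simp: power_map power_map_concat)

context tensor_target
begin

abbreviation lift :: "(nat \<Rightarrow> 'b tensor) \<Rightarrow> 'c" where "lift \<equiv> up.ext"

lemma lift_tensor_vec:
  assumes "v \<in> carrier V"
  shows "lift (tv v) = vec_map v"
proof -
  have "lift (tv v) = power_map (Suc 0) (ts 0 {#(Scalar \<one>, v)#})"
    unfolding tensor_vec_hom using pure_tensor(1)[OF Scalar_one_closed assms] by (simp add: up.ext_hom)
  then show ?thesis
    using power_map_pure[OF Scalar_one_closed assms] vec_map_closed[OF assms] by simp
qed

lemma lift_basis: "i \<in> {1..n} \<Longrightarrow> lift (tv (basis i)) = g i"
  by (simp add: lift_tensor_vec basis_closed vec_map_basis)

lemma lift_mono: "(x, y) \<in> mle T \<Longrightarrow> (lift x, lift y) \<in> r"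
  by (rule up.ext_mono[OF r_preorder r_add]) (auto simp: T_mle_iff power_map(5))

end

section \<open>Orders on semirings\<close>

text \<open>
  Equality, and the natural order of an idempotent semiring, are the two orders against which the
  universal property is used.
\<close>

definition nat_order :: "('a, 'z) ring_scheme \<Rightarrow> ('a \<times> 'a) set"
  where "nat_order A = {(x, y). x \<in> carrier A \<and> y \<in> carrier A \<and> x \<oplus>\<^bsub>A\<^esub> y = y}"

lemma Id_on_compat:
  assumes "semiring A"
  shows "partial_order_on (carrier A) (Id_on (carrier A))" "add_compat A (Id_on (carrier A))"
    "mult_compat A (Id_on (carrier A))"
proof -
  interpret semiring A by fact
  show "partial_order_on (carrier A) (Id_on (carrier A))"
    by (auto simp: partial_order_on_def preorder_on_def refl_on_def trans_def antisym_def)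
  show "add_compat A (Id_on (carrier A))" "mult_compat A (Id_on (carrier A))"
    by (auto intro!: add_compatI mult_compatI)
qed

lemma nat_order_compat:
  assumes A: "semiring A" and idem: "\<And>x. x \<in> carrier A \<Longrightarrow> x \<oplus>\<^bsub>A\<^esub> x = x"
  shows "partial_order_on (carrier A) (nat_order A)" "add_compat A (nat_order A)"
    "mult_compat A (nat_order A)"
proof -
  interpret semiring A by fact
  show "partial_order_on (carrier A) (nat_order A)"
    unfolding partial_order_on_def
  proof
    show "preorder_on (carrier A) (nat_order A)"
    proof (rule preorder_onI)
      fix x y z assume "(x, y) \<in> nat_order A" "(y, z) \<in> nat_order A"
      then have *: "x \<in> carrier A" "y \<in> carrier A" "z \<in> carrier A" "x \<oplus>\<^bsub>A\<^esub> y = y" "y \<oplus>\<^bsub>A\<^esub> z = z"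
        by (auto simp: nat_order_def)
      then have "x \<oplus>\<^bsub>A\<^esub> z = z"
        by (metis a_assoc)
      then show "(x, z) \<in> nat_order A"
        using * by (simp add: nat_order_def)
    qed (auto simp: nat_order_def idem)
    show "antisym (nat_order A)"
      by (rule antisymI) (auto simp: nat_order_def, metis a_comm)
  qed
  show "add_compat A (nat_order A)"
  proof (rule add_compatI)
    fix x y z assume "(x, y) \<in> nat_order A" "z \<in> carrier A"
    then have *: "x \<in> carrier A" "y \<in> carrier A" "z \<in> carrier A" "x \<oplus>\<^bsub>A\<^esub> y = y"
      by (auto simp: nat_order_def)
    have "(x \<oplus>\<^bsub>A\<^esub> z) \<oplus>\<^bsub>A\<^esub> (y \<oplus>\<^bsub>A\<^esub> z) = (x \<oplus>\<^bsub>A\<^esub> y) \<oplus>\<^bsub>A\<^esub> (z \<oplus>\<^bsub>A\<^esub> z)"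
      using *(1-3) by (simp add: a_ac)
    also have "\<dots> = y \<oplus>\<^bsub>A\<^esub> z"
      by (simp only: *(4) idem[OF *(3)])
    finally show "(x \<oplus>\<^bsub>A\<^esub> z, y \<oplus>\<^bsub>A\<^esub> z) \<in> nat_order A"
      using * by (simp add: nat_order_def)
  qed
  show "mult_compat A (nat_order A)"
    by (rule mult_compatI) (auto simp: nat_order_def l_distr[symmetric] r_distr[symmetric])
qed

lemma discrete_blue_ordered:
  assumes "semiring R" "comm_monoid R"
  shows "ordered_semiring (discrete_blue R)"
proof -
  interpret R: semiring R by fact
  interpret Rc: comm_monoid R by fact
  have s: "semiring (discrete_blue R)"
    by (rule semiring_image[OF assms(1), where h = "\<lambda>x. x"]) (auto simp: discrete_blue_def)
  moreover have "comm_monoid (discrete_blue R)"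
    by (rule comm_monoid_image[OF assms(2), where h = "\<lambda>x. x"]) (auto simp: discrete_blue_def)
  moreover have "ble (discrete_blue R) = Id_on (carrier (discrete_blue R))"
    by (simp add: discrete_blue_def)
  ultimately show ?thesis
    using Id_on_compat[OF s] by (simp add: ordered_semiring_def ordered_semiring_axioms_def)
qed


section \<open>Monomial blueprints\<close>

locale pointed_monoid = comm_monoid D for D (structure) +
  fixes z
  assumes z_closed: "z \<in> carrier D"
    and z_absorbs: "x \<in> carrier D \<Longrightarrow> z \<otimes> x = z"
begin

abbreviation M where "M \<equiv> monoid_blue D z"
abbreviation fm where "fm \<equiv> formal z"
abbreviation ms where "ms \<equiv> {X. set_mset X \<subseteq> carrier D - {z}}"

definition times :: "'a multiset \<Rightarrow> 'a multiset \<Rightarrow> 'a multiset"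
  where "times X Y = (\<Sum>x\<in>#X. \<Sum>y\<in>#Y. fm (x \<otimes> y))"

lemma M_simps: "carrier M = ms" "X \<otimes>\<^bsub>M\<^esub> Y = times X Y" "\<one>\<^bsub>M\<^esub> = fm \<one>" "\<zero>\<^bsub>M\<^esub> = {#}"
  "X \<oplus>\<^bsub>M\<^esub> Y = X + Y" "ble M = Id_on ms"
  by (simp_all add: monoid_blue_def times_def)

lemma formal_closed: "x \<in> carrier D \<Longrightarrow> fm x \<in> ms"
  by (simp add: formal_def)

lemma times_add: "times (X + Y) Z = times X Z + times Y Z" "times X (Y + Z) = times X Y + times X Z"
  by (simp_all add: times_def sum_mset.distrib)

lemma times_empty: "times {#} Y = {#}" "times X {#} = {#}"
  by (simp_all add: times_def)

lemma times_formal: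
  assumes "x \<in> carrier D" "y \<in> carrier D"
  shows "times (fm x) (fm y) = fm (x \<otimes> y)"
  using assms z_absorbs z_closed m_comm[of x z] by (auto simp: formal_def times_def)

lemma formal_induct [consumes 1, case_names zero add]:
  assumes "X \<in> ms" and "Q {#}" and "\<And>x X. \<lbrakk>x \<in> carrier D; X \<in> ms; Q X\<rbrakk> \<Longrightarrow> Q (fm x + X)"
  shows "Q X"
  using assms(1)
proof (induction X)
  case (add x X)
  then have "x \<noteq> z" by auto
  then show ?case
    using assms(3)[of x X] add by (simp add: formal_def)
qed (rule assms(2))

lemma times_closed:
  assumes "X \<in> ms" "Y \<in> ms"
  shows "times X Y \<in> ms"
proof -
  have "times (fm x) Y \<in> ms" if "x \<in> carrier D" for x
    using assms(2)
    by (induction Y rule: formal_induct)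
      (use that formal_closed in \<open>simp_all add: times_empty times_add times_formal\<close>)
  with assms(1) show ?thesis
    by (induction X rule: formal_induct) (simp_all add: times_empty times_add)
qed

lemma times_comm:
  assumes "X \<in> ms" "Y \<in> ms"
  shows "times X Y = times Y X"
proof -
  have "times (fm x) Y = times Y (fm x)" if "x \<in> carrier D" for x
    using assms(2)
    by (induction Y rule: formal_induct) (use that in \<open>simp_all add: times_empty times_add times_formal m_comm\<close>)
  with assms(1) show ?thesis
    by (induction X rule: formal_induct) (simp_all add: times_empty times_add)
qed

text \<open>
  Formal sums are sums of symbols \<open>1.x\<close>, so that biadditivity reduces the claim to these.
\<close>

lemma times_assoc:
  assumes X: "X \<in> ms" and Y: "Y \<in> ms" and Z: "Z \<in> ms"
  shows "times (times X Y) Z = times X (times Y Z)"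
proof -
  have 1: "times (times (fm x) (fm y)) Z = times (fm x) (times (fm y) Z)"
    if "x \<in> carrier D" "y \<in> carrier D" for x y
    using Z
    by (induction Z rule: formal_induct) (use that in \<open>simp_all add: times_empty times_add times_formal m_assoc\<close>)
  have 2: "times (times (fm x) Y) Z = times (fm x) (times Y Z)" if "x \<in> carrier D" for x
    using Y by (induction Y rule: formal_induct) (use that 1 in \<open>simp_all add: times_empty times_add\<close>)
  show ?thesis
    using X by (induction X rule: formal_induct) (use 2 in \<open>simp_all add: times_empty times_add\<close>)
qed

lemma times_one: "X \<in> ms \<Longrightarrow> times (fm \<one>) X = X"
  by (induction X rule: formal_induct) (simp_all add: times_empty times_add times_formal)

lemma M_semiring: "semiring M"
proof -
  interpret M: abelian_monoid M
    by (rule abelian_monoidI) (auto simp: M_simps)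
  show ?thesis
    by unfold_locales
      (use times_closed times_assoc times_one times_comm[OF _ formal_closed[OF one_closed]] formal_closed[OF one_closed]
       in \<open>simp_all only: M_simps times_add times_empty\<close>)
qed

lemma M_comm: "comm_monoid M"
proof -
  interpret M: semiring M by (rule M_semiring)
  show ?thesis
    by unfold_locales (use times_comm in \<open>simp only: M_simps\<close>)
qed

end

text \<open>
  A monomial blueprint built from the multiplicative monoid of a semiring \<open>K\<close> with relations that
  hold in \<open>K\<close> with respect to an order \<open>rK\<close>. Summing up a formal sum in \<open>K\<close> gives a map \<open>val\<close>
  back to \<open>K\<close>.
\<close>

locale monomial_blueprint = K: semiring K + Kc: comm_monoid K
  for K :: "('k, 'x) ring_scheme" and H :: "('k multiset \<times> 'k multiset) set" and rK :: "('k \<times> 'k) set"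
    and B :: "('k multiset set, 'y) oblueprint_scheme" +
  assumes H_carrier: "H \<subseteq> carrier (monoid_blue K \<zero>\<^bsub>K\<^esub>) \<times> carrier (monoid_blue K \<zero>\<^bsub>K\<^esub>)"
    and rK_order: "partial_order_on (carrier K) rK"
    and rK_add: "add_compat K rK" and rK_mult: "mult_compat K rK"
    and H_rK: "(X, Y) \<in> H \<Longrightarrow> (msum K (\<lambda>x. x) X, msum K (\<lambda>x. x) Y) \<in> rK"
    and B_fields: "carrier B = carrier (blue_quot_gen (monoid_blue K \<zero>\<^bsub>K\<^esub>) H)"
      "mult B = mult (blue_quot_gen (monoid_blue K \<zero>\<^bsub>K\<^esub>) H)"
      "one B = one (blue_quot_gen (monoid_blue K \<zero>\<^bsub>K\<^esub>) H)"
      "zero B = zero (blue_quot_gen (monoid_blue K \<zero>\<^bsub>K\<^esub>) H)"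
      "add B = add (blue_quot_gen (monoid_blue K \<zero>\<^bsub>K\<^esub>) H)"
      "ble B = ble (blue_quot_gen (monoid_blue K \<zero>\<^bsub>K\<^esub>) H)"
begin

sublocale pointed_monoid K "\<zero>\<^bsub>K\<^esub>"
  by unfold_locales auto

definition rel :: "('k multiset \<times> 'k multiset) set"
  where "rel = gen_ring_preorder M (ble M) H"

lemma ble_M: "ble M \<subseteq> carrier M \<times> carrier M"
  by (auto simp: M_simps)

lemmas rel_facts =
  gen_ring_preorder_preorder[OF M_semiring ble_M H_carrier, folded rel_def]
  gen_ring_preorder_add[OF M_semiring ble_M H_carrier, folded rel_def]
  gen_ring_preorder_mult[OF M_semiring ble_M H_carrier, folded rel_def]
  gen_ring_preorder_rels[OF M_semiring ble_M H_carrier, folded rel_def]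

abbreviation cl where "cl \<equiv> cls rel"

lemma cl_eq_iff: "X \<in> ms \<Longrightarrow> cl X = cl Y \<longleftrightarrow> (X, Y) \<in> rel \<and> (Y, X) \<in> rel"
  using cls_eq_iff[OF rel_facts(1)] by (simp add: M_simps)

lemma B_quot: "blue_quot_gen M H = blue_quot M rel"
  by (simp add: blue_quot_gen_def rel_def)

lemma B_carrier: "carrier B = cl ` ms"
  and B_zero: "\<zero>\<^bsub>B\<^esub> = cl {#}"
  and B_one: "\<one>\<^bsub>B\<^esub> = cl (fm \<one>\<^bsub>K\<^esub>)"
  and B_ble: "ble B = (\<lambda>(X, Y). (cl X, cl Y)) ` rel"
  by (simp_all add: B_fields B_quot blue_quot_def ring_quot_def oblueprint.defs ring.defs M_simps)

lemma B_add: "X \<in> ms \<Longrightarrow> Y \<in> ms \<Longrightarrow> cl X \<oplus>\<^bsub>B\<^esub> cl Y = cl (X + Y)"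
  using lift2_cls[OF rel_facts(1), of X Y "add M"]
    add_compat2[OF semiring.axioms(1)[OF M_semiring] rel_facts(1,2)]
  by (simp add: B_fields B_quot blue_quot_def ring_quot_def oblueprint.defs ring.defs M_simps)

lemma B_mult: "X \<in> ms \<Longrightarrow> Y \<in> ms \<Longrightarrow> cl X \<otimes>\<^bsub>B\<^esub> cl Y = cl (times X Y)"
  using lift2_cls[OF rel_facts(1), of X Y "mult M"] mult_compat2[OF rel_facts(1,3)]
  by (simp add: B_fields B_quot blue_quot_def ring_quot_def oblueprint.defs ring.defs M_simps)

lemma B_ble_iff: "X \<in> ms \<Longrightarrow> Y \<in> ms \<Longrightarrow> (cl X, cl Y) \<in> ble B \<longleftrightarrow> (X, Y) \<in> rel"
  unfolding B_ble using cls_image_mem_iff[OF rel_facts(1)] by (simp add: M_simps)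

lemma B_ble_order: "partial_order_on (carrier B) (ble B)"
  unfolding B_ble B_carrier using partial_order_cls_image[OF rel_facts(1)] by (simp add: M_simps)

lemma B_bleE:
  assumes "(x, y) \<in> ble B"
  obtains X Y where "X \<in> ms" "Y \<in> ms" "x = cl X" "y = cl Y" "(X, Y) \<in> rel"
proof -
  obtain X Y where XY: "(X, Y) \<in> rel" "x = cl X" "y = cl Y"
    using assms unfolding B_ble by auto
  then show ?thesis
    using that[of X Y] preorder_on_carrier[OF rel_facts(1) XY(1)] by (simp add: M_simps)
qed

lemma B_semiring: "semiring B"
  by (rule semiring_image[OF M_semiring, where h = cl])
    (use B_carrier B_add B_mult B_zero B_one in \<open>simp_all add: M_simps\<close>)

lemma B_comm: "comm_monoid B"
  by (rule comm_monoid_image[OF M_comm, where h = cl])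
    (use B_carrier B_mult B_one in \<open>simp_all add: M_simps\<close>)

lemma B_ordered: "ordered_semiring B"
proof -
  interpret semiring B by (rule B_semiring)
  interpret comm_monoid B by (rule B_comm)
  show ?thesis
  proof unfold_locales
    show "partial_order_on (carrier B) (ble B)"
      by (rule B_ble_order)
    show "add_compat B (ble B)"
    proof (rule add_compatI)
      fix x y z assume "(x, y) \<in> ble B" and z: "z \<in> carrier B"
      then obtain X Y where X: "X \<in> ms" "Y \<in> ms" "x = cl X" "y = cl Y" "(X, Y) \<in> rel"
        using B_bleE by blast
      obtain Z where Z: "Z \<in> ms" "z = cl Z"
        using z unfolding B_carrier by blast
      have "(X + Z, Y + Z) \<in> rel"
        using add_compatD[OF rel_facts(2) X(5), of Z] Z by (simp add: M_simps)
      then show "(x \<oplus>\<^bsub>B\<^esub> z, y \<oplus>\<^bsub>B\<^esub> z) \<in> ble B"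
        using X Z by (simp add: B_add B_ble_iff)
    qed
    show "mult_compat B (ble B)"
    proof (rule mult_compatI)
      fix x y z assume "(x, y) \<in> ble B" and z: "z \<in> carrier B"
      then obtain X Y where X: "X \<in> ms" "Y \<in> ms" "x = cl X" "y = cl Y" "(X, Y) \<in> rel"
        using B_bleE by blast
      obtain Z where Z: "Z \<in> ms" "z = cl Z"
        using z unfolding B_carrier by blast
      have "(times X Z, times Y Z) \<in> rel" "(times Z X, times Z Y) \<in> rel"
        using mult_compatD[OF rel_facts(3) X(5), of Z] Z by (simp_all add: M_simps)
      then show "(x \<otimes>\<^bsub>B\<^esub> z, y \<otimes>\<^bsub>B\<^esub> z) \<in> ble B" "(z \<otimes>\<^bsub>B\<^esub> x, z \<otimes>\<^bsub>B\<^esub> y) \<in> ble B"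
        using X Z times_closed[OF X(1) Z(1)] times_closed[OF X(2) Z(1)]
          times_closed[OF Z(1) X(1)] times_closed[OF Z(1) X(2)]
        unfolding X(3,4) Z(2) by (simp_all only: B_mult B_ble_iff)
    qed
  qed
qed

definition elt :: "'k \<Rightarrow> 'k multiset set"
  where "elt k = mon_elt K H k"

lemma elt_cl: "elt k = cl (fm k)"
  by (simp add: elt_def mon_elt_def rel_def)

lemma elt_closed: "k \<in> carrier K \<Longrightarrow> elt k \<in> carrier B"
  using formal_closed by (auto simp: elt_cl B_carrier)

lemma elt_mult: "k \<in> carrier K \<Longrightarrow> l \<in> carrier K \<Longrightarrow> elt (k \<otimes>\<^bsub>K\<^esub> l) = elt k \<otimes>\<^bsub>B\<^esub> elt l"
  using formal_closed[of k] formal_closed[of l] by (simp only: elt_cl B_mult times_formal)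

lemma elt_one: "elt \<one>\<^bsub>K\<^esub> = \<one>\<^bsub>B\<^esub>"
  by (simp add: elt_cl B_one)

lemma elt_zero: "elt \<zero>\<^bsub>K\<^esub> = \<zero>\<^bsub>B\<^esub>"
  by (simp add: elt_cl B_zero formal_def)

lemma B_induct [consumes 1, case_names zero add]:
  assumes b: "b \<in> carrier B" and "Q \<zero>\<^bsub>B\<^esub>"
    and "\<And>k b. \<lbrakk>k \<in> carrier K; b \<in> carrier B; Q b\<rbrakk> \<Longrightarrow> Q (elt k \<oplus>\<^bsub>B\<^esub> b)"
  shows "Q b"
proof -
  obtain X where X: "X \<in> ms" "b = cl X"
    using b B_carrier by auto
  have "Q (cl X)"
    using X(1)
  proof (induction X rule: formal_induct)
    case zero
    then show ?case using assms(2) by (simp add: B_zero)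
  next
    case (add x X)
    then show ?case
      using assms(3)[of x "cl X"] formal_closed[of x] B_carrier by (simp add: elt_cl B_add)
  qed
  then show ?thesis using X by simp
qed

abbreviation total where "total \<equiv> msum K (\<lambda>x. x)"

lemma total_closed: "X \<in> ms \<Longrightarrow> total X \<in> carrier K"
  by (auto intro!: K.msum_closed)

lemma total_add: "X \<in> ms \<Longrightarrow> Y \<in> ms \<Longrightarrow> total (X + Y) = total X \<oplus>\<^bsub>K\<^esub> total Y"
  by (rule K.msum_union) auto

lemma total_formal: "k \<in> carrier K \<Longrightarrow> total (fm k) = k"
  by (simp add: formal_def)

lemma total_times:
  assumes X: "X \<in> ms" and Y: "Y \<in> ms"
  shows "total (times X Y) = total X \<otimes>\<^bsub>K\<^esub> total Y"
proof -
  have 1: "total (times (fm x) Y) = x \<otimes>\<^bsub>K\<^esub> total Y" if x: "x \<in> carrier K" for x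
    using Y
  proof (induction Y rule: formal_induct)
    case (add y Y)
    have "total (times (fm x) (fm y) + times (fm x) Y) = total (times (fm x) (fm y)) \<oplus>\<^bsub>K\<^esub> total (times (fm x) Y)"
      by (rule total_add) (intro times_closed formal_closed x add)+
    moreover have "total (fm y + Y) = y \<oplus>\<^bsub>K\<^esub> total Y"
      using total_add[OF formal_closed[OF add(1)] add(2)] add by (simp add: total_formal)
    ultimately show ?case
      using add x total_closed[OF add(2)] by (simp add: times_add times_formal total_formal K.r_distr)
  qed (simp add: times_empty x)
  show ?thesis
    using X
  proof (induction X rule: formal_induct)
    case (add x X)
    have "total (times (fm x) Y + times X Y) = total (times (fm x) Y) \<oplus>\<^bsub>K\<^esub> total (times X Y)"
      by (rule total_add) (intro times_closed formal_closed Y add)+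
    moreover have "total (fm x + X) = x \<oplus>\<^bsub>K\<^esub> total X"
      using total_add[OF formal_closed[OF add(1)] add(2)] add by (simp add: total_formal)
    ultimately show ?case
      using add 1 total_closed[OF add(2)] total_closed[OF Y] by (simp add: times_add K.l_distr)
  qed (simp add: times_empty total_closed[OF Y])
qed

lemma rK_preorder: "preorder_on (carrier K) rK"
  using rK_order by (simp add: partial_order_on_def)

text \<open>
  The order of the blueprint is generated by relations that hold in \<open>K\<close> after summation, hence
  summation is monotone; in particular it is constant on classes.
\<close>

lemma total_mono:
  assumes "(X, Y) \<in> rel"
  shows "(total X, total Y) \<in> rK"
proof -
  define r where "r = {(X, Y). X \<in> ms \<and> Y \<in> ms \<and> (total X, total Y) \<in> rK}"
  have "rel \<subseteq> r"
    unfolding rel_def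
  proof (rule gen_ring_preorder_least)
    show "preorder_on (carrier M) r"
      unfolding r_def M_simps by (rule pullback_preorder[OF rK_preorder total_closed])
    show "add_compat M r"
      by (rule add_compatI)
        (auto simp: r_def M_simps total_add total_closed intro: add_compatD[OF rK_add])
    show "mult_compat M r"
    proof (rule mult_compatI)
      fix X Y Z assume "(X, Y) \<in> r" "Z \<in> carrier M"
      then have *: "X \<in> ms" "Y \<in> ms" "Z \<in> ms" "(total X, total Y) \<in> rK"
        by (auto simp: r_def M_simps)
      show "(X \<otimes>\<^bsub>M\<^esub> Z, Y \<otimes>\<^bsub>M\<^esub> Z) \<in> r" "(Z \<otimes>\<^bsub>M\<^esub> X, Z \<otimes>\<^bsub>M\<^esub> Y) \<in> r"
        using times_closed[OF *(1,3)] times_closed[OF *(2,3)] times_closed[OF *(3,1)] times_closed[OF *(3,2)]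
          total_times[OF *(1,3)] total_times[OF *(2,3)] total_times[OF *(3,1)] total_times[OF *(3,2)]
          mult_compatD[OF rK_mult *(4) total_closed[OF *(3)]]
        by (simp_all add: r_def M_simps)
    qed
    show "ble M \<subseteq> r"
      using preorder_on_refl[OF rK_preorder total_closed] by (auto simp: r_def M_simps)
    show "H \<subseteq> r"
      using H_carrier H_rK by (auto simp: r_def M_simps)
  qed
  then show ?thesis
    using assms by (auto simp: r_def)
qed

definition val :: "'k multiset set \<Rightarrow> 'k"
  where "val b = total (inv_into ms cl b)"

lemma val_cl:
  assumes X: "X \<in> ms"
  shows "val (cl X) = total X"
  unfolding val_def
proof (rule factor_through_image[where q = cl and k = total, OF X])
  fix Y assume "Y \<in> ms" "cl Y = cl X"
  then have "(total X, total Y) \<in> rK" "(total Y, total X) \<in> rK"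
    using cl_eq_iff[of Y X] total_mono by auto
  then show "total Y = total X"
    using antisymD[OF partial_order_onD(3)[OF rK_order]] by blast
qed

lemma val_elt: "k \<in> carrier K \<Longrightarrow> val (elt k) = k"
  using val_cl[OF formal_closed] by (simp add: elt_cl total_formal)

lemma val_closed: "b \<in> carrier B \<Longrightarrow> val b \<in> carrier K"
  using val_cl total_closed unfolding B_carrier by auto

lemma val_add: "a \<in> carrier B \<Longrightarrow> b \<in> carrier B \<Longrightarrow> val (a \<oplus>\<^bsub>B\<^esub> b) = val a \<oplus>\<^bsub>K\<^esub> val b"
  unfolding B_carrier by (auto simp: B_add val_cl total_add)

lemma val_mult: "a \<in> carrier B \<Longrightarrow> b \<in> carrier B \<Longrightarrow> val (a \<otimes>\<^bsub>B\<^esub> b) = val a \<otimes>\<^bsub>K\<^esub> val b"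
  using times_closed val_cl total_times B_mult unfolding B_carrier by fastforce

lemma val_one: "val \<one>\<^bsub>B\<^esub> = \<one>\<^bsub>K\<^esub>"
  using val_elt[of "\<one>\<^bsub>K\<^esub>"] by (simp add: elt_one)

lemma val_zero: "val \<zero>\<^bsub>B\<^esub> = \<zero>\<^bsub>K\<^esub>"
  using val_elt[of "\<zero>\<^bsub>K\<^esub>"] by (simp add: elt_zero)

lemma val_mono: "(a, b) \<in> ble B \<Longrightarrow> (val a, val b) \<in> rK"
  by (erule B_bleE) (simp add: val_cl total_mono)

lemma ble_two_terms:
  assumes "(fm b, fm k + fm l) \<in> H" "b \<in> carrier K" "k \<in> carrier K" "l \<in> carrier K"
  shows "(elt b, elt k \<oplus>\<^bsub>B\<^esub> elt l) \<in> ble B"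
proof -
  have "(fm b, fm k + fm l) \<in> rel"
    using assms(1) rel_facts(4) by blast
  moreover have "fm k + fm l \<in> ms"
    using formal_closed[OF assms(3)] formal_closed[OF assms(4)] by simp
  ultimately show ?thesis
    using formal_closed[OF assms(2)] formal_closed[OF assms(3)] formal_closed[OF assms(4)]
    by (simp only: elt_cl B_add B_ble_iff)
qed

end

section \<open>Homomorphisms of algebras\<close>

definition algebra_hom :: "('k, 'x) ring_scheme \<Rightarrow> ('k, 'a, 'z) module_scheme \<Rightarrow> ('k, 'c, 'y) module_scheme \<Rightarrow>
    ('a \<Rightarrow> 'c) \<Rightarrow> bool"
  where "algebra_hom K A C f \<longleftrightarrow>
    (\<forall>x\<in>carrier A. f x \<in> carrier C) \<and>
    (\<forall>x\<in>carrier A. \<forall>y\<in>carrier A. f (x \<oplus>\<^bsub>A\<^esub> y) = f x \<oplus>\<^bsub>C\<^esub> f y) \<and>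
    (\<forall>x\<in>carrier A. \<forall>y\<in>carrier A. f (x \<otimes>\<^bsub>A\<^esub> y) = f x \<otimes>\<^bsub>C\<^esub> f y) \<and>
    (\<forall>k\<in>carrier K. \<forall>x\<in>carrier A. f (k \<odot>\<^bsub>A\<^esub> x) = k \<odot>\<^bsub>C\<^esub> f x) \<and>
    f \<zero>\<^bsub>A\<^esub> = \<zero>\<^bsub>C\<^esub> \<and> f \<one>\<^bsub>A\<^esub> = \<one>\<^bsub>C\<^esub>"

lemma algebra_homD:
  assumes "algebra_hom K A C f"
  shows "x \<in> carrier A \<Longrightarrow> f x \<in> carrier C"
    and "x \<in> carrier A \<Longrightarrow> y \<in> carrier A \<Longrightarrow> f (x \<oplus>\<^bsub>A\<^esub> y) = f x \<oplus>\<^bsub>C\<^esub> f y"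
    and "x \<in> carrier A \<Longrightarrow> y \<in> carrier A \<Longrightarrow> f (x \<otimes>\<^bsub>A\<^esub> y) = f x \<otimes>\<^bsub>C\<^esub> f y"
    and "k \<in> carrier K \<Longrightarrow> x \<in> carrier A \<Longrightarrow> f (k \<odot>\<^bsub>A\<^esub> x) = k \<odot>\<^bsub>C\<^esub> f x"
    and "f \<zero>\<^bsub>A\<^esub> = \<zero>\<^bsub>C\<^esub>" and "f \<one>\<^bsub>A\<^esub> = \<one>\<^bsub>C\<^esub>"
  using assms by (simp_all add: algebra_hom_def)

lemma algebra_hom_comp:
  assumes "algebra_hom K A C f" "algebra_hom K C D g"
  shows "algebra_hom K A D (\<lambda>x. g (f x))"
  using algebra_homD[OF assms(1)] algebra_homD[OF assms(2)] by (simp add: algebra_hom_def)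

lemma algebra_iso_of_inverse_homs:
  assumes "semialgebra K A" "semialgebra K C" and f: "algebra_hom K A C f" and g: "algebra_hom K C A g"
    and gf: "\<And>x. x \<in> carrier A \<Longrightarrow> g (f x) = x" and fg: "\<And>y. y \<in> carrier C \<Longrightarrow> f (g y) = y"
  shows "f \<in> algebra_iso K A C"
proof -
  have "bij_betw f (carrier A) (carrier C)"
    by (rule bij_betw_byWitness[of _ g]) (use gf fg algebra_homD(1)[OF f] algebra_homD(1)[OF g] in auto)
  then show ?thesis
    using assms(1,2) f by (auto simp: algebra_iso_def ring_iso_def ring_hom_def algebra_hom_def)
qed


section \<open>The exterior algebra and its order\<close>

locale exterior_algebra = tensor_powers B n
  for B :: "('b, 'z) f1pm_algebra_scheme" (structure) and n :: nat +
  assumes eps_closed: "eps B \<in> carrier B"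
begin

abbreviation E0 where "E0 \<equiv> exterior_preorder B n"
abbreviation E where "E \<equiv> exterior B n"
abbreviation e where "e i \<equiv> tv (basis i)"

lemma e_closed: "e i \<in> carrier T"
  by (simp add: basis_closed)

lemma exterior_rels_carrier: "exterior_rels B n \<union> (exterior_rels B n)\<inverse> \<subseteq> carrier T \<times> carrier T"
  unfolding exterior_rels_def Let_def
  using e_closed eps_closed by auto

lemmas E0_facts =
  gen_ring_preorder_preorder[OF T.A.semiring_axioms T_mle_carrier exterior_rels_carrier, folded exterior_preorder_def]
  gen_ring_preorder_add[OF T.A.semiring_axioms T_mle_carrier exterior_rels_carrier, folded exterior_preorder_def]
  gen_ring_preorder_mult[OF T.A.semiring_axioms T_mle_carrier exterior_rels_carrier, folded exterior_preorder_def]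
  gen_ring_preorder_order[OF T.A.semiring_axioms T_mle_carrier exterior_rels_carrier, folded exterior_preorder_def]
  gen_ring_preorder_rels[OF T.A.semiring_axioms T_mle_carrier exterior_rels_carrier, folded exterior_preorder_def]

lemmas E_defs = exterior_def exterior_ambient_def omodule_quot_def module_quot_def ring_quot_def
  omodule.defs module.defs ring.defs

abbreviation q0 where "q0 \<equiv> cls E0"

lemma E_carrier: "carrier E = q0 ` carrier T"
  and E_zero: "\<zero>\<^bsub>E\<^esub> = q0 \<zero>\<^bsub>T\<^esub>"
  and E_one: "\<one>\<^bsub>E\<^esub> = q0 \<one>\<^bsub>T\<^esub>"
  and E_mle: "mle E = (\<lambda>(x, y). (q0 x, q0 y)) ` E0"
  by (simp_all add: E_defs)

lemma E_add: "x \<in> carrier T \<Longrightarrow> y \<in> carrier T \<Longrightarrow> q0 x \<oplus>\<^bsub>E\<^esub> q0 y = q0 (x \<oplus>\<^bsub>T\<^esub> y)"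
  using lift2_cls[OF E0_facts(1), of x y "add T"] add_compat2[OF T.A.abelian_monoid_axioms E0_facts(1,2)]
  by (simp add: E_defs)

lemma E_mult: "x \<in> carrier T \<Longrightarrow> y \<in> carrier T \<Longrightarrow> q0 x \<otimes>\<^bsub>E\<^esub> q0 y = q0 (x \<otimes>\<^bsub>T\<^esub> y)"
  using lift2_cls[OF E0_facts(1), of x y "mult T"] mult_compat2[OF E0_facts(1,3)]
  by (simp add: E_defs)

lemma E_smult: "b \<in> carrier B \<Longrightarrow> x \<in> carrier T \<Longrightarrow> b \<odot>\<^bsub>E\<^esub> q0 x = q0 (b \<odot>\<^bsub>T\<^esub> x)"
  using lift1_cls[OF E0_facts(1), of x "smult T b"] T.smult_compat[OF E0_facts(3,1)]
  by (simp add: E_defs)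

lemma E_mle_iff: "x \<in> carrier T \<Longrightarrow> y \<in> carrier T \<Longrightarrow> (q0 x, q0 y) \<in> mle E \<longleftrightarrow> (x, y) \<in> E0"
  unfolding E_mle by (rule cls_image_mem_iff[OF E0_facts(1)])

lemma E_semialgebra: "semialgebra B E"
  by (rule semialgebra_image[OF T.semialgebra semiring_axioms comm_monoid_axioms E_carrier, where \<iota> = "\<lambda>b. b"])
    (simp_all add: E_add E_mult E_smult E_zero E_one)

end

sublocale exterior_algebra \<subseteq> E: semialg B "exterior B n"
  by unfold_locales (rule E_semialgebra)

context exterior_algebra
begin

lemma E_mle_order: "partial_order_on (carrier E) (mle E)"
  unfolding E_mle E_carrier by (rule partial_order_cls_image[OF E0_facts(1)])

lemma E_mle_preorder: "preorder_on (carrier E) (mle E)"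
  using E_mle_order by (simp add: partial_order_on_def)

lemma E_mleE:
  assumes "(x, y) \<in> mle E"
  obtains x' y' where "x' \<in> carrier T" "y' \<in> carrier T" "x = q0 x'" "y = q0 y'" "(x', y') \<in> E0"
  using assms preorder_on_carrier[OF E0_facts(1)] that unfolding E_mle by auto

text \<open>
  The order on the exterior algebra comes from a preorder on the tensor algebra that was closed under
  products. This will make the product of the hull and of the idem well defined.
\<close>

lemma E_mle_mult: "mult_compat E (mle E)"
proof (rule mult_compatI)
  fix x y z assume "(x, y) \<in> mle E" and z: "z \<in> carrier E"
  then obtain x' y' where x: "x' \<in> carrier T" "y' \<in> carrier T" "x = q0 x'" "y = q0 y'" "(x', y') \<in> E0"
    using E_mleE by blast
  obtain z' where z': "z' \<in> carrier T" "z = q0 z'"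
    using z unfolding E_carrier by blast
  show "(x \<otimes>\<^bsub>E\<^esub> z, y \<otimes>\<^bsub>E\<^esub> z) \<in> mle E" "(z \<otimes>\<^bsub>E\<^esub> x, z \<otimes>\<^bsub>E\<^esub> y) \<in> mle E"
    using x z' mult_compatD[OF E0_facts(3) x(5) z'(1)] by (simp_all add: E_mult E_mle_iff)
qed

lemma E_mle_smult: "(a, b) \<in> ble B \<Longrightarrow> x \<in> carrier E \<Longrightarrow> (a \<odot>\<^bsub>E\<^esub> x, b \<odot>\<^bsub>E\<^esub> x) \<in> mle E"
  using subsetD[OF E0_facts(4) T_mle_smult[of a b]] preorder_on_carrier[OF ble_preorder, of a b]
  unfolding E_carrier by (auto simp: E_smult E_mle_iff)

lemma e_square: "i \<in> {1..n} \<Longrightarrow> q0 (e i) \<otimes>\<^bsub>E\<^esub> q0 (e i) = \<zero>\<^bsub>E\<^esub>"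
proof -
  assume i: "i \<in> {1..n}"
  have "(e i \<otimes>\<^bsub>T\<^esub> e i, \<zero>\<^bsub>T\<^esub>) \<in> exterior_rels B n"
    using i unfolding exterior_rels_def Let_def by blast
  then have "q0 (e i \<otimes>\<^bsub>T\<^esub> e i) = q0 \<zero>\<^bsub>T\<^esub>"
    using E0_facts(5) by (intro cls_eqI[OF E0_facts(1)]) auto
  then show ?thesis
    by (simp add: E_mult e_closed E_zero)
qed

lemma e_anticommute:
  "i \<in> {1..n} \<Longrightarrow> j \<in> {1..n} \<Longrightarrow> i \<noteq> j \<Longrightarrow>
    q0 (e i) \<otimes>\<^bsub>E\<^esub> q0 (e j) = eps B \<odot>\<^bsub>E\<^esub> (q0 (e j) \<otimes>\<^bsub>E\<^esub> q0 (e i))"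
proof -
  assume ij: "i \<in> {1..n}" "j \<in> {1..n}" "i \<noteq> j"
  have "(e i \<otimes>\<^bsub>T\<^esub> e j, eps B \<odot>\<^bsub>T\<^esub> (e j \<otimes>\<^bsub>T\<^esub> e i)) \<in> exterior_rels B n"
    using ij unfolding exterior_rels_def Let_def by blast
  then have "q0 (e i \<otimes>\<^bsub>T\<^esub> e j) = q0 (eps B \<odot>\<^bsub>T\<^esub> (e j \<otimes>\<^bsub>T\<^esub> e i))"
    using E0_facts(5) by (intro cls_eqI[OF E0_facts(1)]) auto
  then show ?thesis
    by (simp add: E_mult E_smult e_closed eps_closed)
qed

end


section \<open>Quotients of the exterior algebra of a monomial blueprint\<close>

text \<open>
  The hull and the idem of the exterior algebra are treated together. The preorder on scalars is
  generated by \<open>Hb\<close> and the one on the exterior algebra by \<open>Hm\<close>. The assumption on sums of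
  scalars says that \<open>k \<mapsto> 1.k\<close> becomes additive, so that the quotient is an algebra over \<open>K\<close>
  itself.
\<close>

locale exterior_quotient = exterior_algebra B n + mb: monomial_blueprint K H rK B
  for K :: "('k, 'x) ring_scheme" and H rK and B :: "('k multiset set, 'z) f1pm_algebra_scheme" (structure) and n +
  fixes \<kappa> :: 'k and Hb :: "('k multiset set \<times> 'k multiset set) set"
    and Hm :: "((nat \<Rightarrow> 'k multiset set tensor) set \<times> (nat \<Rightarrow> 'k multiset set tensor) set) set"
  assumes eps_elt: "eps B = mb.elt \<kappa>" and \<kappa>: "\<kappa> \<in> carrier K"
    and Hb_carrier: "Hb \<subseteq> carrier B \<times> carrier B"
    and Hm_carrier: "Hm \<subseteq> carrier (exterior B n) \<times> carrier (exterior B n)"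
    and Hm_mult: "mult_compat (exterior B n) Hm"
    and Hb_Hm: "\<lbrakk>(a, b) \<in> Hb; x \<in> carrier (exterior B n)\<rbrakk> \<Longrightarrow>
      (a \<odot>\<^bsub>exterior B n\<^esub> x, b \<odot>\<^bsub>exterior B n\<^esub> x) \<in> gen_additive_preorder B (exterior B n) Hm"
    and elt_add_le: "\<lbrakk>k \<in> carrier K; l \<in> carrier K\<rbrakk> \<Longrightarrow>
      (mb.elt (k \<oplus>\<^bsub>K\<^esub> l), mb.elt k \<oplus> mb.elt l) \<in> gen_ring_preorder B (ble B) Hb"
    and elt_add_ge: "\<lbrakk>k \<in> carrier K; l \<in> carrier K\<rbrakk> \<Longrightarrow>
      (mb.elt k \<oplus> mb.elt l, mb.elt (k \<oplus>\<^bsub>K\<^esub> l)) \<in> gen_ring_preorder B (ble B) Hb"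
begin

definition \<beta> where "\<beta> = gen_ring_preorder B (ble B) Hb"
definition \<rho> where "\<rho> = gen_additive_preorder B E Hm"

lemma ble_carrier: "ble B \<subseteq> carrier B \<times> carrier B"
  using preorder_on_carrier[OF ble_preorder] by auto

lemmas \<beta>_facts =
  gen_ring_preorder_preorder[OF semiring_axioms ble_carrier Hb_carrier, folded \<beta>_def]
  gen_ring_preorder_add[OF semiring_axioms ble_carrier Hb_carrier, folded \<beta>_def]
  gen_ring_preorder_mult[OF semiring_axioms ble_carrier Hb_carrier, folded \<beta>_def]

lemma
  shows \<rho>_preorder: "preorder_on (carrier E) \<rho>" and \<rho>_add: "add_compat E \<rho>" and \<rho>_mle: "mle E \<subseteq> \<rho>"
    and \<rho>_smult: "\<lbrakk>(a, b) \<in> ble B; (x, y) \<in> \<rho>\<rbrakk> \<Longrightarrow> (a \<odot>\<^bsub>E\<^esub> x, b \<odot>\<^bsub>E\<^esub> y) \<in> \<rho>" and \<rho>_Hm: "Hm \<subseteq> \<rho>"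
proof -
  have "additive_preorder B E \<rho> \<and> Hm \<subseteq> \<rho>"
    unfolding \<rho>_def
    by (intro conjI gen_additive_preorder_additive gen_additive_preorder_rels)
      (use Hm_carrier ble_carrier preorder_on_carrier[OF E_mle_preorder] in auto)
  then show "preorder_on (carrier E) \<rho>" "add_compat E \<rho>" "mle E \<subseteq> \<rho>" "Hm \<subseteq> \<rho>"
    "\<lbrakk>(a, b) \<in> ble B; (x, y) \<in> \<rho>\<rbrakk> \<Longrightarrow> (a \<odot>\<^bsub>E\<^esub> x, b \<odot>\<^bsub>E\<^esub> y) \<in> \<rho>"
    by (auto simp: additive_preorder_def)
qed

lemma \<rho>_least: "additive_preorder B E r \<Longrightarrow> Hm \<subseteq> r \<Longrightarrow> \<rho> \<subseteq> r"
  unfolding \<rho>_def by (rule gen_additive_preorder_least)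

lemmas \<rho>_trans = preorder_on_trans[OF \<rho>_preorder]
  and \<rho>_refl = preorder_on_refl[OF \<rho>_preorder]
  and \<rho>_carrier = preorder_on_carrier[OF \<rho>_preorder]

text \<open>
  The preorder is generated additively, but since its generators are stable under the product, so
  is the preorder; this is why the quotient carries a product.
\<close>

lemma \<rho>_mult: "mult_compat E \<rho>"
proof -
  define r where "r = {(x, y). (x, y) \<in> \<rho> \<and> (\<forall>z\<in>carrier E. (x \<otimes>\<^bsub>E\<^esub> z, y \<otimes>\<^bsub>E\<^esub> z) \<in> \<rho> \<and> (z \<otimes>\<^bsub>E\<^esub> x, z \<otimes>\<^bsub>E\<^esub> y) \<in> \<rho>)}"
  have "\<rho> \<subseteq> r"
  proof (rule \<rho>_least)
    have "preorder_on (carrier E) r"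
    proof (rule preorder_onI)
      fix x y z assume "(x, y) \<in> r" "(y, z) \<in> r"
      then show "(x, z) \<in> r"
        unfolding r_def using \<rho>_trans by blast
    qed (use \<rho>_carrier \<rho>_refl in \<open>auto simp: r_def\<close>)
    moreover have "add_compat E r"
    proof (rule add_compatI)
      fix x y z assume *: "(x, y) \<in> r" "z \<in> carrier E"
      have c: "x \<in> carrier E" "y \<in> carrier E"
        using * \<rho>_carrier by (auto simp: r_def)
      have "((x \<oplus>\<^bsub>E\<^esub> z) \<otimes>\<^bsub>E\<^esub> w, (y \<oplus>\<^bsub>E\<^esub> z) \<otimes>\<^bsub>E\<^esub> w) \<in> \<rho> \<and> (w \<otimes>\<^bsub>E\<^esub> (x \<oplus>\<^bsub>E\<^esub> z), w \<otimes>\<^bsub>E\<^esub> (y \<oplus>\<^bsub>E\<^esub> z)) \<in> \<rho>"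
        if "w \<in> carrier E" for w
        using * c that by (auto simp: r_def E.A.l_distr E.A.r_distr intro!: add_compatD[OF \<rho>_add])
      moreover have "(x \<oplus>\<^bsub>E\<^esub> z, y \<oplus>\<^bsub>E\<^esub> z) \<in> \<rho>"
        using * by (auto simp: r_def intro!: add_compatD[OF \<rho>_add])
      ultimately show "(x \<oplus>\<^bsub>E\<^esub> z, y \<oplus>\<^bsub>E\<^esub> z) \<in> r"
        by (simp add: r_def)
    qed
    moreover have "mle E \<subseteq> r"
      using \<rho>_mle mult_compatD[OF E_mle_mult] by (auto simp: r_def)
    moreover have "(a \<odot>\<^bsub>E\<^esub> x, b \<odot>\<^bsub>E\<^esub> y) \<in> r" if ab: "(a, b) \<in> ble B" and xy: "(x, y) \<in> r" for a b x y
    proof -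
      have c: "x \<in> carrier E" "y \<in> carrier E" "a \<in> carrier B" "b \<in> carrier B"
        using xy \<rho>_carrier ab ble_carrier by (auto simp: r_def)
      show ?thesis
        using xy c \<rho>_smult[OF ab] by (auto simp: r_def E.smult_mult_l E.smult_mult_r)
    qed
    ultimately show "additive_preorder B E r"
      by (auto simp: additive_preorder_def)
    show "Hm \<subseteq> r"
      using \<rho>_Hm mult_compatD[OF Hm_mult] by (auto simp: r_def)
  qed
  then show ?thesis
    by (intro mult_compatI) (auto simp: r_def)
qed

text \<open>
  The action of the scalars factors through the quotient of \<open>B\<close>: the pairs of scalars that act by
  related elements form a preorder of the kind among which \<open>\<beta>\<close> is least.
\<close>

lemma \<beta>_acts:
  assumes "(a, b) \<in> \<beta>" "x \<in> carrier E"
  shows "(a \<odot>\<^bsub>E\<^esub> x, b \<odot>\<^bsub>E\<^esub> x) \<in> \<rho>"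
proof -
  define r where "r = {(a, b). a \<in> carrier B \<and> b \<in> carrier B \<and> (\<forall>x\<in>carrier E. (a \<odot>\<^bsub>E\<^esub> x, b \<odot>\<^bsub>E\<^esub> x) \<in> \<rho>)}"
  have "\<beta> \<subseteq> r"
    unfolding \<beta>_def
  proof (rule gen_ring_preorder_least)
    show "preorder_on (carrier B) r"
    proof (rule preorder_onI)
      fix a b c assume "(a, b) \<in> r" "(b, c) \<in> r"
      then show "(a, c) \<in> r"
        unfolding r_def using \<rho>_trans by blast
    qed (use \<rho>_refl in \<open>auto simp: r_def\<close>)
    show "add_compat B r"
      by (rule add_compatI) (auto simp: r_def E.smult_l_distr intro!: add_compatD[OF \<rho>_add])
    show "mult_compat B r"
    proof (rule mult_compatI)
      fix a b c assume *: "(a, b) \<in> r" "c \<in> carrier B"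
      show "(a \<otimes> c, b \<otimes> c) \<in> r"
        using * by (auto simp: r_def E.smult_assoc)
      then show "(c \<otimes> a, c \<otimes> b) \<in> r"
        using * m_comm by (auto simp: r_def)
    qed
    show "ble B \<subseteq> r"
      using ble_carrier E_mle_smult \<rho>_mle by (auto simp: r_def)
    show "Hb \<subseteq> r"
      using Hb_carrier Hb_Hm[folded \<rho>_def] by (auto simp: r_def)
  qed
  then show ?thesis
    using assms by (auto simp: r_def)
qed

text \<open>
  A scalar is a sum of elements \<open>1.k\<close>, and \<open>\<beta>\<close> identifies it with the single element
  \<open>1.k\<close> for the sum \<open>k\<close> of these in \<open>K\<close>. So the quotient has no scalars besides those of \<open>K\<close>.
\<close>

lemma \<beta>_elt_val: "b \<in> carrier B \<Longrightarrow> (b, mb.elt (mb.val b)) \<in> \<beta> \<and> (mb.elt (mb.val b), b) \<in> \<beta>"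
proof (induction b rule: mb.B_induct)
  case zero
  then show ?case
    using preorder_on_refl[OF \<beta>_facts(1)] by (simp add: mb.val_zero mb.elt_zero)
next
  case (add k b)
  have v: "mb.val b \<in> carrier K" "mb.val (mb.elt k \<oplus> b) = k \<oplus>\<^bsub>K\<^esub> mb.val b"
    using add by (simp_all add: mb.val_closed mb.val_add mb.elt_closed mb.val_elt)
  note c = mb.elt_closed[OF add(1)]
  have "(mb.elt k \<oplus> b, mb.elt k \<oplus> mb.elt (mb.val b)) \<in> \<beta>" "(mb.elt k \<oplus> mb.elt (mb.val b), mb.elt k \<oplus> b) \<in> \<beta>"
    using add.IH preorder_on_refl[OF \<beta>_facts(1) c]
    by (auto intro: add_compat2[OF abelian_monoid_axioms \<beta>_facts(1,2)])
  then show ?case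
    unfolding v(2) using elt_add_le[OF add(1) v(1)] elt_add_ge[OF add(1) v(1)] preorder_on_trans[OF \<beta>_facts(1)]
    unfolding \<beta>_def[symmetric] by blast
qed

text \<open>
  The hull or idem of the exterior algebra as an algebra over \<open>K\<close>; \<open>q\<close> is the projection of
  the tensor algebra onto it.
\<close>

definition W where "W = along_quot (\<lambda>k. cls \<beta> (mb.elt k)) (blue_module_quot E \<rho>)"

definition q where "q x = cls \<rho> (q0 x)"

lemmas W_defs = W_def along_quot_def blue_module_quot_def omodule_quot_def module_quot_def ring_quot_def
  omodule.defs module.defs ring.defs q_def

lemma W_carrier: "carrier W = q ` carrier T"
  and W_zero: "\<zero>\<^bsub>W\<^esub> = q \<zero>\<^bsub>T\<^esub>"
  and W_one: "\<one>\<^bsub>W\<^esub> = q \<one>\<^bsub>T\<^esub>"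
  by (simp_all add: W_defs E_carrier E_zero E_one image_image)

lemma q0_closed: "x \<in> carrier T \<Longrightarrow> q0 x \<in> carrier E"
  by (simp add: E_carrier)

lemma W_add: "x \<in> carrier T \<Longrightarrow> y \<in> carrier T \<Longrightarrow> q x \<oplus>\<^bsub>W\<^esub> q y = q (x \<oplus>\<^bsub>T\<^esub> y)"
  using lift2_cls[OF \<rho>_preorder, of "q0 x" "q0 y" "add E"] add_compat2[OF E.A.abelian_monoid_axioms \<rho>_preorder \<rho>_add]
  by (simp add: W_defs q0_closed E_add)

lemma W_mult: "x \<in> carrier T \<Longrightarrow> y \<in> carrier T \<Longrightarrow> q x \<otimes>\<^bsub>W\<^esub> q y = q (x \<otimes>\<^bsub>T\<^esub> y)"
  using lift2_cls[OF \<rho>_preorder, of "q0 x" "q0 y" "mult E"] mult_compat2[OF \<rho>_preorder \<rho>_mult]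
  by (simp add: W_defs q0_closed E_mult)

lemma q_\<beta>: "(a, b) \<in> \<beta> \<Longrightarrow> (b, a) \<in> \<beta> \<Longrightarrow> x \<in> carrier T \<Longrightarrow> q (a \<odot>\<^bsub>T\<^esub> x) = q (b \<odot>\<^bsub>T\<^esub> x)"
  using \<beta>_acts[of a b "q0 x"] \<beta>_acts[of b a "q0 x"] preorder_on_carrier[OF \<beta>_facts(1), of a b]
  unfolding q_def by (intro cls_eqI[OF \<rho>_preorder]) (auto simp: E_smult q0_closed)

lemma W_smult:
  assumes k: "k \<in> carrier K" and x: "x \<in> carrier T"
  shows "k \<odot>\<^bsub>W\<^esub> q x = q (mb.elt k \<odot>\<^bsub>T\<^esub> x)"
proof -
  have "k \<odot>\<^bsub>W\<^esub> q x = (\<Union>b\<in>cls \<beta> (mb.elt k). lift1 \<rho> (smult E b) (cls \<rho> (q0 x)))"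
    by (simp add: W_defs)
  also have "\<dots> = (\<Union>b\<in>cls \<beta> (mb.elt k). q (mb.elt k \<odot>\<^bsub>T\<^esub> x))"
  proof (rule SUP_cong[OF refl])
    fix b assume b: "b \<in> cls \<beta> (mb.elt k)"
    then have *: "(b, mb.elt k) \<in> \<beta>" "(mb.elt k, b) \<in> \<beta>"
      by (auto simp: cls_def)
    have bc: "b \<in> carrier B"
      using preorder_on_carrier[OF \<beta>_facts(1) *(1)] by simp
    have "lift1 \<rho> (smult E b) (cls \<rho> (q0 x)) = cls \<rho> (b \<odot>\<^bsub>E\<^esub> q0 x)"
      using lift1_cls[OF \<rho>_preorder, of "q0 x" "smult E b"] E.smult_compat[OF \<rho>_mult \<rho>_preorder _ bc] x
      by (simp add: q0_closed)
    also have "\<dots> = q (mb.elt k \<odot>\<^bsub>T\<^esub> x)"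
      using q_\<beta>[OF * x] bc x by (simp add: q_def E_smult)
    finally show "lift1 \<rho> (smult E b) (cls \<rho> (q0 x)) = q (mb.elt k \<odot>\<^bsub>T\<^esub> x)" .
  qed
  also have "\<dots> = q (mb.elt k \<odot>\<^bsub>T\<^esub> x)"
    using cls_self[OF \<beta>_facts(1) mb.elt_closed[OF k]] by blast
  finally show ?thesis .
qed

lemma W_semialgebra: "semialgebra K W"
proof (rule semialgebra_image[OF T.semialgebra mb.K.semiring_axioms mb.Kc.comm_monoid_axioms W_carrier, where \<iota> = mb.elt])
  show "q (mb.elt (k \<oplus>\<^bsub>K\<^esub> l) \<odot>\<^bsub>T\<^esub> x) = q ((mb.elt k \<oplus> mb.elt l) \<odot>\<^bsub>T\<^esub> x)"
    if "k \<in> carrier K" "l \<in> carrier K" "x \<in> carrier T" for k l x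
    by (rule q_\<beta>) (use that elt_add_le elt_add_ge in \<open>simp_all add: \<beta>_def\<close>)
qed (simp_all add: W_add W_mult W_zero W_one W_smult mb.elt_closed mb.elt_mult mb.elt_one mb.elt_zero)

end

sublocale exterior_quotient \<subseteq> W: semialg K W
  by unfold_locales (rule W_semialgebra)

context exterior_quotient
begin

lemma q_closed: "x \<in> carrier T \<Longrightarrow> q x \<in> carrier W"
  by (simp add: W_carrier)

lemma W_induct [consumes 1, case_names add mult smult one basis]:
  assumes w: "w \<in> carrier W"
    and add: "\<And>x y. \<lbrakk>x \<in> carrier W; y \<in> carrier W; Q x; Q y\<rbrakk> \<Longrightarrow> Q (x \<oplus>\<^bsub>W\<^esub> y)"
    and mult: "\<And>x y. \<lbrakk>x \<in> carrier W; y \<in> carrier W; Q x; Q y\<rbrakk> \<Longrightarrow> Q (x \<otimes>\<^bsub>W\<^esub> y)"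
    and smult: "\<And>k x. \<lbrakk>k \<in> carrier K; x \<in> carrier W; Q x\<rbrakk> \<Longrightarrow> Q (k \<odot>\<^bsub>W\<^esub> x)"
    and one: "Q \<one>\<^bsub>W\<^esub>"
    and basis: "\<And>i. i \<in> {1..n} \<Longrightarrow> Q (q (e i))"
  shows "Q w"
proof -
  have "Q (q x)" if "x \<in> carrier T" for x
    using that
  proof (induction x rule: T_induct)
    case (add x y)
    then show ?case using assms(2)[of "q x" "q y"] by (simp add: W_add q_closed)
  next
    case (mult x y)
    then show ?case using assms(3)[of "q x" "q y"] by (simp add: W_mult q_closed)
  next
    case (smult b x)
    have "q (b \<odot>\<^bsub>T\<^esub> x) = mb.val b \<odot>\<^bsub>W\<^esub> q x"
      using smult q_\<beta>[of b "mb.elt (mb.val b)" x] \<beta>_elt_val[of b] by (simp add: W_smult mb.val_closed)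
    then show ?case
      using smult assms(4)[of "mb.val b" "q x"] by (simp add: q_closed mb.val_closed)
  qed (use one basis in \<open>simp_all add: W_one\<close>)
  then show ?thesis
    using w by (auto simp: W_carrier)
qed

lemma W_square: "i \<in> {1..n} \<Longrightarrow> q (e i) \<otimes>\<^bsub>W\<^esub> q (e i) = \<zero>\<^bsub>W\<^esub>"
  using e_square[of i] by (simp add: W_mult e_closed W_zero) (simp add: q_def E_mult[symmetric] E_zero[symmetric] e_closed)

lemma W_anticommute:
  assumes "i \<in> {1..n}" "j \<in> {1..n}" "i \<noteq> j"
  shows "q (e i) \<otimes>\<^bsub>W\<^esub> q (e j) = \<kappa> \<odot>\<^bsub>W\<^esub> (q (e j) \<otimes>\<^bsub>W\<^esub> q (e i))"
  using e_anticommute[OF assms] eps_closed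
  by (simp add: W_mult e_closed W_smult \<kappa> eps_elt[symmetric])
    (simp add: q_def E_mult E_smult e_closed)

text \<open>
  The universal property. The condition on \<open>Hm\<close> says that the relations imposed on the exterior
  algebra hold under every order-preserving additive map to the target.
\<close>

lemma W_universal:
  fixes C :: "('k, 'c, 'w) module_scheme" and r :: "('c \<times> 'c) set"
  assumes C: "semialgebra K C"
    and r: "partial_order_on (carrier C) r" "add_compat C r" "mult_compat C r"
    and rK: "\<And>k l x. \<lbrakk>(k, l) \<in> rK; x \<in> carrier C\<rbrakk> \<Longrightarrow> (k \<odot>\<^bsub>C\<^esub> x, l \<odot>\<^bsub>C\<^esub> x) \<in> r"
    and g: "\<And>i. i \<in> {1..n} \<Longrightarrow> g i \<in> carrier C"
    and square: "\<And>i. i \<in> {1..n} \<Longrightarrow> g i \<otimes>\<^bsub>C\<^esub> g i = \<zero>\<^bsub>C\<^esub>"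
    and anticommute: "\<And>i j. \<lbrakk>i \<in> {1..n}; j \<in> {1..n}; i \<noteq> j\<rbrakk> \<Longrightarrow> g i \<otimes>\<^bsub>C\<^esub> g j = \<kappa> \<odot>\<^bsub>C\<^esub> (g j \<otimes>\<^bsub>C\<^esub> g i)"
    and Hm: "\<And>h x y. \<lbrakk>\<And>x y. (x, y) \<in> mle E \<Longrightarrow> (h x, h y) \<in> r; \<And>x. x \<in> carrier E \<Longrightarrow> h x \<in> carrier C;
      \<And>x y. \<lbrakk>x \<in> carrier E; y \<in> carrier E\<rbrakk> \<Longrightarrow> h (x \<oplus>\<^bsub>E\<^esub> y) = h x \<oplus>\<^bsub>C\<^esub> h y;
      (x, y) \<in> Hm\<rbrakk> \<Longrightarrow> (h x, h y) \<in> r"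
  obtains h where "algebra_hom K W C h" "\<And>i. i \<in> {1..n} \<Longrightarrow> h (q (e i)) = g i"
proof -
  interpret C: semialg K C by unfold_locales fact
  \<comment> \<open>The target as an algebra over the blueprint, by restriction of scalars along \<open>mb.val\<close>.\<close>
  define D :: "('k multiset set, 'c) module" where
    "D = \<lparr>carrier = carrier C, mult = mult C, one = \<one>\<^bsub>C\<^esub>, zero = \<zero>\<^bsub>C\<^esub>, add = add C,
       smult = (\<lambda>b x. mb.val b \<odot>\<^bsub>C\<^esub> x)\<rparr>"
  have D: "carrier D = carrier C" "mult D = mult C" "\<one>\<^bsub>D\<^esub> = \<one>\<^bsub>C\<^esub>" "\<zero>\<^bsub>D\<^esub> = \<zero>\<^bsub>C\<^esub>" "add D = add C"
    "b \<odot>\<^bsub>D\<^esub> x = mb.val b \<odot>\<^bsub>C\<^esub> x" for b x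
    by (simp_all add: D_def)
  have "semialgebra B D"
    by (rule semialgebra_image[OF C semiring_axioms comm_monoid_axioms, where h = "\<lambda>x. x" and \<iota> = mb.val])
      (simp_all add: D mb.val_closed mb.val_add mb.val_mult mb.val_one mb.val_zero)
  then interpret D: semialg B D
    by unfold_locales
  interpret tt: tensor_target B n D r g
    by unfold_locales
      (use r g rK mb.val_mono in \<open>auto simp: D partial_order_on_def add_compat_def mult_compat_def\<close>)
  note r_pre = tt.r_preorder[unfolded D]
  note lift = tt.up.ext_closed[unfolded D] tt.up.ext_add[unfolded D] tt.up.ext_mult[unfolded D]
    tt.up.ext_smult[unfolded D] tt.up.ext_zero[unfolded D] tt.up.ext_one[unfolded D]
  \<comment> \<open>The lift to the tensor algebra respects the order of the exterior algebra.\<close>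
  define r1 where "r1 = {(x, y). x \<in> carrier T \<and> y \<in> carrier T \<and> (tt.lift x, tt.lift y) \<in> r}"
  have "E0 \<subseteq> r1"
    unfolding exterior_preorder_def
  proof (rule gen_ring_preorder_least)
    show "preorder_on (carrier T) r1"
      unfolding r1_def by (rule pullback_preorder[OF r_pre lift(1)])
    show "add_compat T r1"
      by (rule add_compatI) (auto simp: r1_def lift intro!: add_compatD[OF r(2)])
    show "mult_compat T r1"
      by (rule mult_compatI) (auto simp: r1_def lift intro!: mult_compatD[OF r(3)])
    show "mle T \<subseteq> r1"
      using tt.lift_mono T_mle_carrier by (auto simp: r1_def)
    have "tt.lift x = tt.lift y" if "(x, y) \<in> exterior_rels B n" for x y
    proof -
      have sq: "tt.lift (e i \<otimes>\<^bsub>T\<^esub> e i) = tt.lift \<zero>\<^bsub>T\<^esub>" if "i \<in> {1..n}" for i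
        using that by (simp add: lift e_closed tt.lift_basis square)
      have ac: "tt.lift (e i \<otimes>\<^bsub>T\<^esub> e j) = tt.lift (eps B \<odot>\<^bsub>T\<^esub> (e j \<otimes>\<^bsub>T\<^esub> e i))"
        if "i \<in> {1..n}" "j \<in> {1..n}" "i \<noteq> j" for i j
        using anticommute[OF that] that eps_closed \<kappa>
        by (simp add: lift e_closed tt.lift_basis) (simp add: eps_elt mb.val_elt)
      show ?thesis
        using that unfolding exterior_rels_def Let_def by (auto intro: sq ac)
    qed
    then have "(x, y) \<in> r1 \<and> (y, x) \<in> r1" if "(x, y) \<in> exterior_rels B n" for x y
      using that exterior_rels_carrier preorder_on_refl[OF r_pre lift(1)] by (auto simp: r1_def)
    then show "exterior_rels B n \<union> (exterior_rels B n)\<inverse> \<subseteq> r1"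
      by auto
  qed
  then have E0: "(tt.lift x, tt.lift y) \<in> r" if "(x, y) \<in> E0" for x y
    using that by (auto simp: r1_def)
  have anti: "x = y" if "(x, y) \<in> r" "(y, x) \<in> r" for x y
    using partial_order_onD(3)[OF r(1)] that by (auto simp: antisym_def)
  \<comment> \<open>Descent to the exterior algebra, and then to its quotient by \<open>\<rho>\<close>.\<close>
  define h0 where "h0 X = tt.lift (inv_into (carrier T) q0 X)" for X
  have h0: "h0 (q0 x) = tt.lift x" if x: "x \<in> carrier T" for x
    unfolding h0_def
  proof (rule factor_through_image[where q = q0 and k = tt.lift, OF x])
    fix y assume "y \<in> carrier T" "q0 y = q0 x"
    then show "tt.lift y = tt.lift x"
      using cls_eq_iff[OF E0_facts(1), of y x] E0 anti by auto
  qed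
  have h0_mono: "(h0 x, h0 y) \<in> r" if "(x, y) \<in> mle E" for x y
    using that by (elim E_mleE) (simp add: h0 E0)
  have h0_closed: "h0 x \<in> carrier C" if "x \<in> carrier E" for x
    using that by (auto simp: E_carrier h0 lift)
  have h0_add: "h0 (x \<oplus>\<^bsub>E\<^esub> y) = h0 x \<oplus>\<^bsub>C\<^esub> h0 y" if "x \<in> carrier E" "y \<in> carrier E" for x y
    using that by (auto simp: E_carrier h0 E_add lift)
  have h0_smult: "h0 (b \<odot>\<^bsub>E\<^esub> x) = mb.val b \<odot>\<^bsub>C\<^esub> h0 x" if "b \<in> carrier B" "x \<in> carrier E" for b x
    using that by (auto simp: E_carrier h0 E_smult lift)
  define r2 where "r2 = {(x, y). x \<in> carrier E \<and> y \<in> carrier E \<and> (h0 x, h0 y) \<in> r}"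
  have "\<rho> \<subseteq> r2"
  proof (rule \<rho>_least)
    have "preorder_on (carrier E) r2"
      unfolding r2_def by (rule pullback_preorder[OF r_pre h0_closed])
    moreover have "add_compat E r2"
      by (rule add_compatI) (auto simp: r2_def h0_add h0_closed intro!: add_compatD[OF r(2)])
    moreover have "mle E \<subseteq> r2"
      using h0_mono preorder_on_carrier[OF E_mle_preorder] by (auto simp: r2_def)
    moreover have "(a \<odot>\<^bsub>E\<^esub> x, b \<odot>\<^bsub>E\<^esub> y) \<in> r2" if ab: "(a, b) \<in> ble B" and xy: "(x, y) \<in> r2" for a b x y
    proof -
      have c: "a \<in> carrier B" "b \<in> carrier B" "x \<in> carrier E" "y \<in> carrier E" "(h0 x, h0 y) \<in> r"
        using ab ble_carrier xy by (auto simp: r2_def)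
      have "(mb.val a \<odot>\<^bsub>C\<^esub> h0 x, mb.val a \<odot>\<^bsub>C\<^esub> h0 y) \<in> r"
        by (rule C.smult_compat[OF r(3) r_pre c(5) mb.val_closed[OF c(1)]])
      moreover have "(mb.val a \<odot>\<^bsub>C\<^esub> h0 y, mb.val b \<odot>\<^bsub>C\<^esub> h0 y) \<in> r"
        by (rule rK[OF mb.val_mono[OF ab] h0_closed[OF c(4)]])
      ultimately have "(mb.val a \<odot>\<^bsub>C\<^esub> h0 x, mb.val b \<odot>\<^bsub>C\<^esub> h0 y) \<in> r"
        by (rule preorder_on_trans[OF r_pre])
      then show ?thesis
        using c by (simp add: r2_def h0_smult)
    qed
    ultimately show "additive_preorder B E r2"
      by (auto simp: additive_preorder_def)
    have "(h0 x, h0 y) \<in> r" if "(x, y) \<in> Hm" for x y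
      by (rule Hm[OF h0_mono h0_closed h0_add that])
    then show "Hm \<subseteq> r2"
      using Hm_carrier by (auto simp: r2_def)
  qed
  then have \<rho>: "(h0 x, h0 y) \<in> r" if "(x, y) \<in> \<rho>" for x y
    using that by (auto simp: r2_def)
  define h where "h X = tt.lift (inv_into (carrier T) q X)" for X
  have h: "h (q x) = tt.lift x" if x: "x \<in> carrier T" for x
    unfolding h_def
  proof (rule factor_through_image[where q = q and k = tt.lift, OF x])
    fix y assume y: "y \<in> carrier T" "q y = q x"
    then have "(q0 y, q0 x) \<in> \<rho>" "(q0 x, q0 y) \<in> \<rho>"
      using cls_eq_iff[OF \<rho>_preorder q0_closed, of y "q0 x"] by (auto simp: q_def)
    then show "tt.lift y = tt.lift x"
      using \<rho> anti h0 y x by metis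
  qed
  have "algebra_hom K W C h"
    unfolding algebra_hom_def
    by (auto simp: W_carrier W_add W_mult W_smult W_zero W_one h lift mb.elt_closed mb.val_elt)
  moreover have "h (q (e i)) = g i" if "i \<in> {1..n}" for i
    using that by (simp add: h e_closed tt.lift_basis)
  ultimately show ?thesis
    using that by blast
qed

text \<open>
  Endomorphisms are determined by their values on the generators.
\<close>

lemma W_hom_eq:
  assumes f: "algebra_hom K W W f" and gen: "\<And>i. i \<in> {1..n} \<Longrightarrow> f (q (e i)) = q (e i)"
    and w: "w \<in> carrier W"
  shows "f w = w"
  using w by (induction w rule: W_induct) (use algebra_homD[OF f] gen in auto)

end

section \<open>Formal sums and their values\<close>

context semiring
begin

lemma sum_formal_closed:
  assumes "finite I" "\<And>i. i \<in> I \<Longrightarrow> a i \<in> carrier R"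
  shows "(\<Sum>i\<in>I. formal \<zero> (a i)) \<in> {X. set_mset X \<subseteq> carrier R - {\<zero>}}"
  using assms by (induction I) (auto simp: formal_def)

lemma msum_sum_formal:
  assumes "finite I" "\<And>i. i \<in> I \<Longrightarrow> a i \<in> carrier R"
  shows "msum R (\<lambda>x. x) (\<Sum>i\<in>I. formal \<zero> (a i)) = (\<Oplus>i\<in>I. a i)"
  using assms
proof (induction I)
  case (insert i I)
  have "msum R (\<lambda>x. x) (formal \<zero> (a i) + (\<Sum>i\<in>I. formal \<zero> (a i))) =
      msum R (\<lambda>x. x) (formal \<zero> (a i)) \<oplus> msum R (\<lambda>x. x) (\<Sum>i\<in>I. formal \<zero> (a i))"
    by (rule msum_union) (use insert.prems sum_formal_closed[OF insert.hyps(1), of a] in \<open>auto simp: formal_def split: if_splits\<close>)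
  then show ?case
    using insert by (auto simp: formal_def finsum_insert Pi_def)
qed simp

lemma finsum_two:
  assumes "a 1 \<in> carrier R" "a 2 \<in> carrier R"
  shows "(\<Oplus>i\<in>{1..2::nat}. a i) = a 1 \<oplus> a 2"
proof -
  have "{1..2::nat} = {1, 2}"
    by auto
  then show ?thesis
    using assms by (simp add: finsum_insert)
qed

end

lemma sum_two: "(\<Sum>i\<in>{1..2::nat}. f i) = f 1 + (f 2 :: 'a::comm_monoid_add)"
  by (simp add: numeral_2_eq_2 atLeastAtMostSuc_conv add.commute)


section \<open>Anticommuting elements\<close>

locale ring_semialg = semialg K A + cring K
  for K :: "('k, 'x) ring_scheme" (structure) and A :: "('k, 'a, 'z) module_scheme"
begin

lemma add_neg: "x \<in> carrier A \<Longrightarrow> x \<oplus>\<^bsub>A\<^esub> (\<ominus> \<one>) \<odot>\<^bsub>A\<^esub> x = \<zero>\<^bsub>A\<^esub>"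
  using smult_l_distr[of \<one> "\<ominus> \<one>" x] by (simp add: r_neg)

lemma eq_neg_of_add_eq_zero:
  assumes "x \<in> carrier A" "y \<in> carrier A" "x \<oplus>\<^bsub>A\<^esub> y = \<zero>\<^bsub>A\<^esub>"
  shows "x = (\<ominus> \<one>) \<odot>\<^bsub>A\<^esub> y"
proof -
  have "x = x \<oplus>\<^bsub>A\<^esub> (y \<oplus>\<^bsub>A\<^esub> (\<ominus> \<one>) \<odot>\<^bsub>A\<^esub> y)"
    using assms by (simp add: add_neg)
  also have "\<dots> = (\<ominus> \<one>) \<odot>\<^bsub>A\<^esub> y"
    using assms by (simp add: A.a_assoc[symmetric])
  finally show ?thesis .
qed

text \<open>
  Scalars from a ring provide negatives.
\<close>

lemma A_ring: "ring A"
proof (rule ringI)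
  show "abelian_group A"
  proof (rule abelian_groupI)
    fix x assume "x \<in> carrier A"
    then show "\<exists>y\<in>carrier A. y \<oplus>\<^bsub>A\<^esub> x = \<zero>\<^bsub>A\<^esub>"
      using add_neg[of x] by (intro bexI[of _ "(\<ominus> \<one>) \<odot>\<^bsub>A\<^esub> x"]) (auto simp: A.a_comm)
  qed (auto simp: A.a_ac)
qed (auto simp: A.monoid_axioms A.l_distr A.r_distr)

text \<open>
  In \<open>(x + s)\<^sup>2\<close>, where \<open>x\<close> is one term and \<open>s\<close> the sum of the others, the mixed products cancel
  because \<open>x\<close> anticommutes with every term of \<open>s\<close>.
\<close>

lemma square_of_anticommuting_sum:
  assumes "finite J" and c: "\<And>i. i \<in> J \<Longrightarrow> c i \<in> carrier A"
    and square: "\<And>i. i \<in> J \<Longrightarrow> c i \<otimes>\<^bsub>A\<^esub> c i = \<zero>\<^bsub>A\<^esub>"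
    and anti: "\<And>i j. i \<in> J \<Longrightarrow> j \<in> J \<Longrightarrow> i \<noteq> j \<Longrightarrow> c i \<otimes>\<^bsub>A\<^esub> c j = (\<ominus> \<one>) \<odot>\<^bsub>A\<^esub> (c j \<otimes>\<^bsub>A\<^esub> c i)"
    and a: "\<And>i. i \<in> J \<Longrightarrow> a i \<in> carrier K"
  shows "(\<Oplus>\<^bsub>A\<^esub>i\<in>J. a i \<odot>\<^bsub>A\<^esub> c i) \<otimes>\<^bsub>A\<^esub> (\<Oplus>\<^bsub>A\<^esub>i\<in>J. a i \<odot>\<^bsub>A\<^esub> c i) = \<zero>\<^bsub>A\<^esub>"
  using assms(1) subset_refl[of J]
proof (induction J rule: finite_subset_induct')
  case (insert k I)
  let ?s = "\<Oplus>\<^bsub>A\<^esub>i\<in>I. a i \<odot>\<^bsub>A\<^esub> c i" and ?x = "a k \<odot>\<^bsub>A\<^esub> c k"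
  have ac: "a i \<odot>\<^bsub>A\<^esub> c i \<in> carrier A" if "i \<in> J" for i
    using that a c by simp
  have s: "?s \<in> carrier A"
    using insert ac by (intro A.finsum_closed) auto
  have x: "?x \<in> carrier A"
    using insert ac by auto
  have sum: "(\<Oplus>\<^bsub>A\<^esub>i\<in>insert k I. a i \<odot>\<^bsub>A\<^esub> c i) = ?x \<oplus>\<^bsub>A\<^esub> ?s"
    using insert ac by (intro A.finsum_insert) auto
  have "?x \<otimes>\<^bsub>A\<^esub> ?s = (\<Oplus>\<^bsub>A\<^esub>i\<in>I. ?x \<otimes>\<^bsub>A\<^esub> (a i \<odot>\<^bsub>A\<^esub> c i))"
    by (rule finsum_hom[OF A.abelian_monoid_axioms A.abelian_monoid_axioms])
      (use x insert ac in \<open>auto simp: A.r_distr\<close>)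
  also have "\<dots> = (\<Oplus>\<^bsub>A\<^esub>i\<in>I. (\<ominus> \<one>) \<odot>\<^bsub>A\<^esub> ((a i \<odot>\<^bsub>A\<^esub> c i) \<otimes>\<^bsub>A\<^esub> ?x))"
  proof (rule A.finsum_cong')
    fix i assume i: "i \<in> I"
    then have J: "i \<in> J" "k \<in> J" "k \<noteq> i"
      using insert by auto
    have "?x \<otimes>\<^bsub>A\<^esub> (a i \<odot>\<^bsub>A\<^esub> c i) = (a k \<otimes> a i) \<odot>\<^bsub>A\<^esub> (c k \<otimes>\<^bsub>A\<^esub> c i)"
      using J a c by (simp add: smult_mult_l smult_mult_r smult_assoc[symmetric] K.m_comm)
    also have "c k \<otimes>\<^bsub>A\<^esub> c i = (\<ominus> \<one>) \<odot>\<^bsub>A\<^esub> (c i \<otimes>\<^bsub>A\<^esub> c k)"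
      using J by (intro anti)
    also have "(a k \<otimes> a i) \<odot>\<^bsub>A\<^esub> \<dots> = ((\<ominus> \<one>) \<otimes> (a k \<otimes> a i)) \<odot>\<^bsub>A\<^esub> (c i \<otimes>\<^bsub>A\<^esub> c k)"
      using J a c by (simp add: smult_assoc[symmetric] K.m_comm)
    also have "\<dots> = (\<ominus> \<one>) \<odot>\<^bsub>A\<^esub> ((a i \<odot>\<^bsub>A\<^esub> c i) \<otimes>\<^bsub>A\<^esub> ?x)"
      using J a c by (simp add: smult_mult_l smult_mult_r smult_assoc)
    finally show "?x \<otimes>\<^bsub>A\<^esub> (a i \<odot>\<^bsub>A\<^esub> c i) = (\<ominus> \<one>) \<odot>\<^bsub>A\<^esub> ((a i \<odot>\<^bsub>A\<^esub> c i) \<otimes>\<^bsub>A\<^esub> ?x)" .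
  qed (use x insert ac in auto)
  also have "\<dots> = (\<ominus> \<one>) \<odot>\<^bsub>A\<^esub> (?s \<otimes>\<^bsub>A\<^esub> ?x)"
    by (rule finsum_hom[OF A.abelian_monoid_axioms A.abelian_monoid_axioms, symmetric])
      (use x insert ac in \<open>auto simp: A.l_distr smult_r_distr\<close>)
  finally have "?s \<otimes>\<^bsub>A\<^esub> ?x \<oplus>\<^bsub>A\<^esub> ?x \<otimes>\<^bsub>A\<^esub> ?s = \<zero>\<^bsub>A\<^esub>"
    using x s by (simp add: add_neg)
  moreover have "?x \<otimes>\<^bsub>A\<^esub> ?x = \<zero>\<^bsub>A\<^esub>"
    using insert a c square by (simp add: smult_mult_l smult_mult_r)
  ultimately show ?case
    using x s insert.IH unfolding sum by (simp add: A.l_distr A.r_distr A.a_ac)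
qed simp

end


section \<open>The hull over a commutative ring\<close>

locale ring_exterior_case = cring R for R :: "'r ring" (structure) + fixes n :: nat
begin

abbreviation K where "K \<equiv> discrete_blue R"

lemma K_carrier: "carrier K = carrier R"
  by (simp add: discrete_blue_def)

lemma semialgebra_discrete: "semialgebra K A \<longleftrightarrow> semialgebra R A"
proof
  assume A: "semialgebra K A"
  then interpret A: semialg K A
    by unfold_locales
  show "semialgebra R A"
    using A by (rule semialgebra_image[OF _ semiring_axioms comm_monoid_axioms, where h = "\<lambda>x. x" and \<iota> = "\<lambda>x. x"])
      (auto simp: discrete_blue_def A.smult_one[unfolded discrete_blue_def, simplified]
        A.smult_l_null[unfolded discrete_blue_def, simplified])
next
  assume "semialgebra R A"
  then show "semialgebra K A"
    using discrete_blue_ordered[OF semiring_axioms comm_monoid_axioms]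
    by (intro semialgebra_image[of R A K, where h = "\<lambda>x. x" and \<iota> = "\<lambda>x. x"])
      (auto simp: ordered_semiring_def discrete_blue_def semialg.smult_l_null[OF semialg.intro] semialg.smult_one[OF semialg.intro])
qed

end

sublocale ring_exterior_case \<subseteq> d: tensor_powers "discrete_blue R" n
  unfolding tensor_powers_def by (rule discrete_blue_ordered[OF semiring_axioms comm_monoid_axioms])

sublocale ring_exterior_case \<subseteq> mb: monomial_blueprint R "ring_mon_rels R" "Id_on (carrier R)" "ring_mon R"
proof
  have rels: "X \<in> carrier (monoid_blue R \<zero>) \<and> Y \<in> carrier (monoid_blue R \<zero>) \<and>
      (msum R (\<lambda>x. x) X, msum R (\<lambda>x. x) Y) \<in> Id_on (carrier R)"
    if XY: "(X, Y) \<in> ring_mon_rels R" for X Y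
  proof -
    obtain m :: nat and a where a: "\<And>i. i \<in> {1..m} \<Longrightarrow> a i \<in> carrier R"
      and X: "X = formal \<zero> (\<Oplus>i\<in>{1..m}. a i)" and Y: "Y = (\<Sum>i\<in>{1..m}. formal \<zero> (a i))"
      using XY unfolding ring_mon_rels_def Pi_def by blast
    have s: "(\<Oplus>i\<in>{1..m}. a i) \<in> carrier R"
      using a by (intro finsum_closed) auto
    then have "msum R (\<lambda>x. x) X = (\<Oplus>i\<in>{1..m}. a i)"
      by (simp add: X formal_def)
    then show ?thesis
      using s sum_formal_closed[of "{1..m}" a] msum_sum_formal[of "{1..m}" a] a
      by (simp add: X Y monoid_blue_def formal_def Id_on_iff)
  qed
  then show "ring_mon_rels R \<subseteq> carrier (monoid_blue R \<zero>) \<times> carrier (monoid_blue R \<zero>)"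
    by auto
  show "(msum R (\<lambda>x. x) X, msum R (\<lambda>x. x) Y) \<in> Id_on (carrier R)" if "(X, Y) \<in> ring_mon_rels R" for X Y
    using rels[OF that] by blast
qed (use Id_on_compat[OF semiring_axioms] in \<open>auto simp: ring_mon_def oblueprint.defs f1pm_algebra.defs\<close>)

context ring_exterior_case
begin

abbreviation B where "B \<equiv> ring_mon R"

lemma B_eps: "eps B = mb.elt (\<ominus> \<one>)"
  by (simp add: ring_mon_def oblueprint.defs f1pm_algebra.defs mb.elt_def)

text \<open>
  The relation of \<open>R\<^sup>m\<^sup>o\<^sup>n\<close> for the sum \<open>k + l\<close>. The hull turns it into an equality.
\<close>

lemma elt_add_ble: "k \<in> carrier R \<Longrightarrow> l \<in> carrier R \<Longrightarrow> (mb.elt (k \<oplus> l), mb.elt k \<oplus>\<^bsub>B\<^esub> mb.elt l) \<in> ble B"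
proof (rule mb.ble_two_terms)
  assume kl: "k \<in> carrier R" "l \<in> carrier R"
  let ?a = "\<lambda>i :: nat. if i = 1 then k else l"
  have "(formal \<zero> (\<Oplus>i\<in>{1..2}. ?a i), \<Sum>i\<in>{1..2}. formal \<zero> (?a i)) \<in> ring_mon_rels R"
    unfolding ring_mon_rels_def using kl by fastforce
  then show "(formal \<zero> (k \<oplus> l), formal \<zero> k + formal \<zero> l) \<in> ring_mon_rels R"
    using finsum_two[of ?a] sum_two[of "\<lambda>i. formal \<zero> (?a i)"] kl by simp
qed auto

end

sublocale ring_exterior_case \<subseteq> x: exterior_algebra "ring_mon R" n
  by (intro exterior_algebra.intro tensor_powers.intro mb.B_ordered, unfold_locales)
    (simp add: B_eps mb.elt_closed)

sublocale ring_exterior_case \<subseteq> h: exterior_quotient R "ring_mon_rels R" "Id_on (carrier R)" "ring_mon R" n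
    "\<ominus> \<one>" "ble (ring_mon R) \<union> (ble (ring_mon R))\<inverse>" "mle (exterior (ring_mon R) n) \<union> (mle (exterior (ring_mon R) n))\<inverse>"
proof
  let ?Hm = "mle x.E \<union> (mle x.E)\<inverse>"
  have bc: "ble B \<subseteq> carrier B \<times> carrier B"
    using preorder_on_carrier[OF x.ble_preorder] by auto
  then show Hb: "ble B \<union> (ble B)\<inverse> \<subseteq> carrier B \<times> carrier B"
    by auto
  show "?Hm \<subseteq> carrier x.E \<times> carrier x.E"
    using preorder_on_carrier[OF x.E_mle_preorder] by auto
  show "mult_compat x.E ?Hm"
    by (rule mult_compatI) (use mult_compatD[OF x.E_mle_mult] in auto)
  show "(a \<odot>\<^bsub>x.E\<^esub> x, b \<odot>\<^bsub>x.E\<^esub> x) \<in> gen_additive_preorder B x.E ?Hm"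
    if "(a, b) \<in> ble B \<union> (ble B)\<inverse>" "x \<in> carrier x.E" for a b x
    using that x.E_mle_smult[of a b x] x.E_mle_smult[of b a x] by (auto simp: gen_additive_preorder_def)
  note gen = gen_ring_preorder_rels[OF x.semiring_axioms bc Hb]
  show "(mb.elt (k \<oplus> l), mb.elt k \<oplus>\<^bsub>B\<^esub> mb.elt l) \<in> gen_ring_preorder B (ble B) (ble B \<union> (ble B)\<inverse>)"
    "(mb.elt k \<oplus>\<^bsub>B\<^esub> mb.elt l, mb.elt (k \<oplus> l)) \<in> gen_ring_preorder B (ble B) (ble B \<union> (ble B)\<inverse>)"
    if "k \<in> carrier R" "l \<in> carrier R" for k l
    using elt_add_ble[OF that] gen by auto
qed (simp_all add: B_eps)

context ring_exterior_case
begin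

lemma hull_algebra_eq: "exterior_hull_algebra R n = h.W"
  by (simp add: exterior_hull_algebra_def h.W_def h.\<beta>_def h.\<rho>_def hull_rel_def module_hull_def
      module_hull_rel_def mb.elt_def Let_def)

lemma hull_gen_eq: "exterior_hull_gen R n i = h.q (x.e i)"
  by (simp add: exterior_hull_gen_def h.q_def h.\<rho>_def module_hull_rel_def exterior_gen_def Let_def)

subsection \<open>The usual exterior algebra\<close>

abbreviation T where "T \<equiv> tensor_algebra K n"
abbreviation I where "I \<equiv> ring_exterior_ideal R n"
abbreviation X where "X \<equiv> ring_exterior R n"
abbreviation p where "p x \<equiv> I +>\<^bsub>T\<^esub> x"

lemma T_semialgebra: "semialgebra R T"
  using d.T.semialgebra semialgebra_discrete by blast

end

sublocale ring_exterior_case \<subseteq> T: ring_semialg R "tensor_algebra (discrete_blue R) n"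
  by unfold_locales (rule T_semialgebra)

sublocale ring_exterior_case \<subseteq> Tr: ring "tensor_algebra (discrete_blue R) n"
  by (rule T.A_ring)

context ring_exterior_case
begin

lemma squares_carrier: "{d.tv v \<otimes>\<^bsub>T\<^esub> d.tv v | v. v \<in> carrier d.V} \<subseteq> carrier T"
  by auto

lemma I_ideal: "ideal I T"
  unfolding ring_exterior_ideal_def Let_def by (rule Tr.genideal_ideal[OF squares_carrier])

end

sublocale ring_exterior_case \<subseteq> I: ideal "ring_exterior_ideal R n" "tensor_algebra (discrete_blue R) n"
  by (rule I_ideal)

context ring_exterior_case
begin

lemma X_fields: "carrier X = p ` carrier T" "\<zero>\<^bsub>X\<^esub> = p \<zero>\<^bsub>T\<^esub>" "\<one>\<^bsub>X\<^esub> = p \<one>\<^bsub>T\<^esub>"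
  and X_add: "x \<in> carrier T \<Longrightarrow> y \<in> carrier T \<Longrightarrow> p x \<oplus>\<^bsub>X\<^esub> p y = p (x \<oplus>\<^bsub>T\<^esub> y)"
  and X_mult: "x \<in> carrier T \<Longrightarrow> y \<in> carrier T \<Longrightarrow> p x \<otimes>\<^bsub>X\<^esub> p y = p (x \<otimes>\<^bsub>T\<^esub> y)"
  using I.a_rcos_sum[of x y] I.rcoset_mult_add[of x y] Tr.a_coset_add_zero[OF I.a_subset]
  by (auto simp: ring_exterior_def Let_def ring.defs module.defs FactRing_def A_RCOSETS_def' a_r_coset_def'
      I.a_Hcarr)

lemma p_eq_iff:
  assumes "x \<in> carrier T" "y \<in> carrier T"
  shows "p x = p y \<longleftrightarrow> (\<exists>i\<in>I. x = i \<oplus>\<^bsub>T\<^esub> y)"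
proof
  assume "p x = p y"
  then have "x \<in> p y"
    using I.a_rcos_self[OF assms(1)] by simp
  then show "\<exists>i\<in>I. x = i \<oplus>\<^bsub>T\<^esub> y"
    by (auto simp: a_r_coset_def')
next
  assume "\<exists>i\<in>I. x = i \<oplus>\<^bsub>T\<^esub> y"
  then have "x \<in> p y"
    by (auto simp: a_r_coset_def')
  then show "p x = p y"
    using I.a_repr_independence'[of x y] assms by simp
qed

lemma I_smult: "i \<in> I \<Longrightarrow> k \<in> carrier R \<Longrightarrow> k \<odot>\<^bsub>T\<^esub> i \<in> I"
  using T.smult_conv_mult[of k i] I.I_l_closed[of i "k \<odot>\<^bsub>T\<^esub> \<one>\<^bsub>T\<^esub>"] I.a_Hcarr by simp

lemma X_smult:
  assumes k: "k \<in> carrier R" and x: "x \<in> carrier T"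
  shows "k \<odot>\<^bsub>X\<^esub> p x = p (k \<odot>\<^bsub>T\<^esub> x)"
proof -
  have "p (k \<odot>\<^bsub>T\<^esub> y) = p (k \<odot>\<^bsub>T\<^esub> x)" if "y \<in> p x" for y
  proof -
    from that obtain i where i: "i \<in> I" "y = i \<oplus>\<^bsub>T\<^esub> x"
      by (auto simp: a_r_coset_def')
    then have "k \<odot>\<^bsub>T\<^esub> y = k \<odot>\<^bsub>T\<^esub> i \<oplus>\<^bsub>T\<^esub> k \<odot>\<^bsub>T\<^esub> x"
      using k x I.a_Hcarr by (simp add: T.smult_r_distr)
    then show ?thesis
      using i k x I_smult I.a_Hcarr by (subst p_eq_iff) auto
  qed
  moreover have "x \<in> p x"
    using I.a_rcos_self[OF x] .
  ultimately have "(\<Union>y\<in>p x. p (k \<odot>\<^bsub>T\<^esub> y)) = p (k \<odot>\<^bsub>T\<^esub> x)"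
    by blast
  then show ?thesis
    by (simp add: ring_exterior_def Let_def ring.defs module.defs)
qed

lemma X_semialgebra: "semialgebra R X"
  by (rule semialgebra_image[OF T_semialgebra semiring_axioms comm_monoid_axioms X_fields(1), where \<iota> = "\<lambda>k. k"])
    (simp_all add: X_fields X_add X_mult X_smult)

end

sublocale ring_exterior_case \<subseteq> X: ring_semialg R "ring_exterior R n"
  by unfold_locales (rule X_semialgebra)

sublocale ring_exterior_case \<subseteq> W: ring_semialg R h.W
  by unfold_locales

context ring_exterior_case
begin

abbreviation e where "e i \<equiv> d.tv (d.basis i)"

lemma e_closed: "e i \<in> carrier T"
  by (simp add: d.basis_closed)

lemma X_vector_square: "v \<in> carrier d.V \<Longrightarrow> p (d.tv v) \<otimes>\<^bsub>X\<^esub> p (d.tv v) = \<zero>\<^bsub>X\<^esub>"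
proof -
  assume v: "v \<in> carrier d.V"
  have "d.tv v \<otimes>\<^bsub>T\<^esub> d.tv v \<in> I"
    unfolding ring_exterior_ideal_def Let_def
    by (rule subsetD[OF Tr.genideal_self[OF squares_carrier]]) (use v in blast)
  then have "p (d.tv v \<otimes>\<^bsub>T\<^esub> d.tv v) = p \<zero>\<^bsub>T\<^esub>"
    using v by (subst p_eq_iff) (auto simp: I.a_Hcarr)
  then show ?thesis
    using v by (simp add: X_mult X_fields)
qed

text \<open>
  Polarisation: expand \<open>(e\<^sub>i + e\<^sub>j)\<^sup>2 = 0\<close>.
\<close>

lemma X_anticommute: "p (e i) \<otimes>\<^bsub>X\<^esub> p (e j) = (\<ominus> \<one>) \<odot>\<^bsub>X\<^esub> (p (e j) \<otimes>\<^bsub>X\<^esub> p (e i))"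
proof (rule X.eq_neg_of_add_eq_zero)
  have c: "p (e i) \<in> carrier X" "p (e j) \<in> carrier X"
    by (simp_all add: X_fields e_closed)
  then show "p (e i) \<otimes>\<^bsub>X\<^esub> p (e j) \<in> carrier X" "p (e j) \<otimes>\<^bsub>X\<^esub> p (e i) \<in> carrier X"
    by simp_all
  have "p (d.tv (d.basis i \<oplus>\<^bsub>d.V\<^esub> d.basis j)) = p (e i) \<oplus>\<^bsub>X\<^esub> p (e j)"
    by (simp add: d.tensor_vec_add d.basis_closed X_add)
  then have "(p (e i) \<oplus>\<^bsub>X\<^esub> p (e j)) \<otimes>\<^bsub>X\<^esub> (p (e i) \<oplus>\<^bsub>X\<^esub> p (e j)) = \<zero>\<^bsub>X\<^esub>"
    using X_vector_square[of "d.basis i \<oplus>\<^bsub>d.V\<^esub> d.basis j"] by (simp add: d.basis_closed)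
  then show "p (e i) \<otimes>\<^bsub>X\<^esub> p (e j) \<oplus>\<^bsub>X\<^esub> p (e j) \<otimes>\<^bsub>X\<^esub> p (e i) = \<zero>\<^bsub>X\<^esub>"
    using c X_vector_square[OF d.basis_closed] by (simp add: X.A.l_distr X.A.r_distr X.A.a_comm)
qed

subsection \<open>The map from the usual exterior algebra\<close>

lemma W_discrete: "semialgebra K h.W"
  using h.W_semialgebra semialgebra_discrete by blast

end

sublocale ring_exterior_case \<subseteq> t: tensor_target "discrete_blue R" n h.W "Id_on (carrier h.W)" "\<lambda>i. h.q (x.e i)"
proof -
  interpret W': semialg K h.W
    by unfold_locales (rule W_discrete)
  show "tensor_target K n h.W (Id_on (carrier h.W)) (\<lambda>i. h.q (x.e i))"
    by unfold_locales
      (use Id_on_compat[OF h.W.A.semiring_axioms] in \<open>auto simp: discrete_blue_def h.q_closed x.e_closed\<close>)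
qed

context ring_exterior_case
begin

lemma lift_vector_square:
  assumes "v \<in> carrier d.V"
  shows "t.lift (d.tv v \<otimes>\<^bsub>T\<^esub> d.tv v) = \<zero>\<^bsub>h.W\<^esub>"
proof -
  have "t.vec_map v \<otimes>\<^bsub>h.W\<^esub> t.vec_map v = \<zero>\<^bsub>h.W\<^esub>"
    unfolding t.vec_map_def
  proof (rule W.square_of_anticommuting_sum)
    show "v i \<in> carrier R" if "i \<in> {1..n}" for i
      using d.V_apply_closed[OF assms that] by (simp add: K_carrier)
    show "h.q (x.e i) \<otimes>\<^bsub>h.W\<^esub> h.q (x.e j) = (\<ominus> \<one>) \<odot>\<^bsub>h.W\<^esub> (h.q (x.e j) \<otimes>\<^bsub>h.W\<^esub> h.q (x.e i))"
      if "i \<in> {1..n}" "j \<in> {1..n}" "i \<noteq> j" for i j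
      by (rule h.W_anticommute[OF that])
  qed (simp_all add: h.W_square h.q_closed x.e_closed)
  then show ?thesis
    using assms by (simp add: t.up.ext_mult t.lift_tensor_vec)
qed

text \<open>
  The elements that the lift kills form an ideal. It contains the squares of all vectors, not only
  of the basis vectors, since the images of the latter anticommute.
\<close>

lemma lift_I: "x \<in> I \<Longrightarrow> t.lift x = \<zero>\<^bsub>h.W\<^esub>"
proof -
  let ?J = "{x \<in> carrier T. t.lift x = \<zero>\<^bsub>h.W\<^esub>}"
  have "ideal ?J T"
  proof (rule idealI)
    show "subgroup ?J (add_monoid T)"
    proof (rule Tr.add.subgroupI)
      show "?J \<noteq> {}"
        using t.up.ext_zero by (auto intro!: exI[of _ "\<zero>\<^bsub>T\<^esub>"])
      fix x assume x: "x \<in> ?J"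
      then have "t.lift (x \<oplus>\<^bsub>T\<^esub> \<ominus>\<^bsub>T\<^esub> x) = t.lift (\<ominus>\<^bsub>T\<^esub> x)"
        using t.up.ext_closed[of "\<ominus>\<^bsub>T\<^esub> x"] by (simp add: t.up.ext_add)
      then have "t.lift (\<ominus>\<^bsub>T\<^esub> x) = \<zero>\<^bsub>h.W\<^esub>"
        using x by (simp add: Tr.r_neg t.up.ext_zero)
      then show "\<ominus>\<^bsub>T\<^esub> x \<in> ?J"
        using x by simp
    qed (auto simp: t.up.ext_add)
  qed (auto simp: t.up.ext_mult t.up.ext_closed Tr.ring_axioms)
  then have "I \<subseteq> ?J"
    unfolding ring_exterior_ideal_def Let_def
    by (rule Tr.genideal_minimal) (auto simp: lift_vector_square)
  then show "x \<in> I \<Longrightarrow> t.lift x = \<zero>\<^bsub>h.W\<^esub>"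
    by blast
qed

definition f where "f Y = t.lift (inv_into (carrier T) (\<lambda>x. p x) Y)"

lemma f_p:
  assumes x: "x \<in> carrier T"
  shows "f (p x) = t.lift x"
  unfolding f_def
proof (rule factor_through_image[where q = "\<lambda>x. p x" and k = t.lift, OF x])
  fix y assume "y \<in> carrier T" "p y = p x"
  then obtain i where "i \<in> I" "y = i \<oplus>\<^bsub>T\<^esub> x"
    using p_eq_iff x by blast
  then show "t.lift y = t.lift x"
    using x lift_I[of i] t.up.ext_closed[OF x] by (simp add: t.up.ext_add I.a_Hcarr)
qed

lemma f_hom: "algebra_hom R X h.W f"
  unfolding algebra_hom_def
  by (auto simp: X_fields X_add X_mult X_smult f_p t.up.ext_closed t.up.ext_add t.up.ext_mult
      t.up.ext_zero t.up.ext_one t.up.ext_smult[unfolded K_carrier])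

lemma f_basis: "i \<in> {1..n} \<Longrightarrow> f (p (e i)) = h.q (x.e i)"
  by (simp add: f_p e_closed t.lift_basis)

text \<open>
  The universal property of the hull gives a map back. Both composites fix the generators.
\<close>

theorem ring_case:
  "\<exists>\<phi>\<in>algebra_iso R X (exterior_hull_algebra R n). \<forall>i\<in>{1..n}. \<phi> (ring_exterior_gen R n i) = exterior_hull_gen R n i"
proof -
  obtain g where g: "algebra_hom R h.W X g" and g_basis: "\<And>i. i \<in> {1..n} \<Longrightarrow> g (h.q (x.e i)) = p (e i)"
  proof (rule h.W_universal[OF X_semialgebra Id_on_compat[OF X.A.semiring_axioms], of "\<lambda>i. p (e i)"])
    show "(k \<odot>\<^bsub>X\<^esub> x, l \<odot>\<^bsub>X\<^esub> x) \<in> Id_on (carrier X)" if "(k, l) \<in> Id_on (carrier R)" "x \<in> carrier X" for k l x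
      using that by auto
    show "p (e i) \<in> carrier X" for i
      by (simp add: X_fields e_closed)
    show "p (e i) \<otimes>\<^bsub>X\<^esub> p (e i) = \<zero>\<^bsub>X\<^esub>" for i
      by (rule X_vector_square[OF d.basis_closed])
    show "p (e i) \<otimes>\<^bsub>X\<^esub> p (e j) = (\<ominus> \<one>) \<odot>\<^bsub>X\<^esub> (p (e j) \<otimes>\<^bsub>X\<^esub> p (e i))" for i j
      by (rule X_anticommute)
    show "(h x, h y) \<in> Id_on (carrier X)"
      if "\<And>x y. (x, y) \<in> mle x.E \<Longrightarrow> (h x, h y) \<in> Id_on (carrier X)" "(x, y) \<in> mle x.E \<union> (mle x.E)\<inverse>" for h x y
      using that by fastforce
  qed auto
  have "g (t.lift x) = p x" if "x \<in> carrier T" for x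
    using that
  proof (induction x rule: d.T_induct)
    case (add x y)
    then show ?case
      using t.up.ext_closed[OF add(1)] t.up.ext_closed[OF add(2)]
      by (simp only: t.up.ext_add algebra_homD(2)[OF g] X_add)
  next
    case (mult x y)
    then show ?case
      using t.up.ext_closed[OF mult(1)] t.up.ext_closed[OF mult(2)]
      by (simp only: t.up.ext_mult algebra_homD(3)[OF g] X_mult)
  next
    case (smult k x)
    then show ?case
      using t.up.ext_closed[OF smult(2)]
      by (simp only: t.up.ext_smult algebra_homD(4)[OF g] X_smult K_carrier)
  next
    case one
    show ?case
      by (simp only: t.up.ext_one algebra_homD(6)[OF g] X_fields)
  next
    case (basis i)
    then show ?case
      by (simp only: t.lift_basis g_basis)
  qed
  then have gf: "g (f y) = y" if "y \<in> carrier X" for y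
    using that by (auto simp: X_fields f_p)
  have fg: "f (g w) = w" if "w \<in> carrier h.W" for w
    by (rule h.W_hom_eq[OF algebra_hom_comp[OF g f_hom] _ that]) (simp add: g_basis f_basis)
  have "f \<in> algebra_iso R X h.W"
    by (rule algebra_iso_of_inverse_homs[OF X_semialgebra h.W_semialgebra f_hom g gf fg])
  moreover have "f (ring_exterior_gen R n i) = exterior_hull_gen R n i" if "i \<in> {1..n}" for i
    using f_basis[OF that] unfolding hull_gen_eq ring_exterior_gen_def Let_def .
  ultimately show ?thesis
    unfolding hull_algebra_eq by blast
qed

end

section \<open>Polynomials over a semiring\<close>

locale polynomials = semiring S + comm_monoid S for S :: "('s, 'x) ring_scheme" (structure) + fixes n :: nat
begin

abbreviation Poly where "Poly \<equiv> polynomial_semiring S n"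

text \<open>The component at a monomial in other indeterminates is zero.\<close>

definition component :: "nat multiset \<Rightarrow> ('s, 's) module"
  where "component m = \<lparr>carrier = (if set_mset m \<subseteq> {1..n} then carrier S else {\<zero>}),
    mult = undefined, one = undefined, zero = \<zero>, add = add S, smult = mult S\<rparr>"

lemma component_carrier: "x \<in> carrier (component m) \<longleftrightarrow> x \<in> carrier S \<and> (x \<noteq> \<zero> \<longrightarrow> set_mset m \<subseteq> {1..n})"
  by (auto simp: component_def)

lemma component_simps: "\<zero>\<^bsub>component m\<^esub> = \<zero>" "x \<oplus>\<^bsub>component m\<^esub> y = x \<oplus> y" "x \<odot>\<^bsub>component m\<^esub> y = x \<otimes> y"
  by (simp_all add: component_def)

lemma component_monoid: "abelian_monoid (component m)"
proof (rule abelian_monoidI)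
  fix x y z assume *: "x \<in> carrier (component m)" "y \<in> carrier (component m)"
  then show "x \<oplus>\<^bsub>component m\<^esub> y \<in> carrier (component m)"
    by (auto simp: component_carrier component_simps)
  show "x \<oplus>\<^bsub>component m\<^esub> y = y \<oplus>\<^bsub>component m\<^esub> x" "\<zero>\<^bsub>component m\<^esub> \<oplus>\<^bsub>component m\<^esub> x = x"
    using * by (simp_all add: component_carrier component_simps a_comm)
  show "x \<oplus>\<^bsub>component m\<^esub> y \<oplus>\<^bsub>component m\<^esub> z = x \<oplus>\<^bsub>component m\<^esub> (y \<oplus>\<^bsub>component m\<^esub> z)" if "z \<in> carrier (component m)"
    using * that by (simp add: component_carrier component_simps a_assoc)
qed (simp add: component_carrier component_simps)

lemma component_mult: "\<lbrakk>x \<in> carrier (component k); y \<in> carrier (component j)\<rbrakk> \<Longrightarrow> x \<otimes> y \<in> carrier (component (k + j))"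
  by (cases "x = \<zero>"; cases "y = \<zero>") (auto simp: component_carrier)

lemma finite_submultisets: "finite {k :: 'a multiset. k \<subseteq># l}"
proof (induction l)
  case (add x l)
  have "{k. k \<subseteq># add_mset x l} \<subseteq> {k. k \<subseteq># l} \<union> add_mset x ` {k. k \<subseteq># l}"
  proof
    fix k assume k: "k \<in> {k. k \<subseteq># add_mset x l}"
    show "k \<in> {k. k \<subseteq># l} \<union> add_mset x ` {k. k \<subseteq># l}"
    proof (cases "x \<in># k")
      case True
      then obtain k' where "k = add_mset x k'"
        by (metis insert_DiffM)
      then show ?thesis
        using k by auto
    next
      case False
      then show ?thesis
        using k by (force simp: subseteq_mset_def not_in_iff split: if_splits)
    qed
  qed
  then show ?case
    using add by (meson finite_UnI finite_imageI finite_subset)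
qed simp

lemma Poly_carrier: "carrier Poly = {f. (\<forall>m. f m \<in> carrier (component m)) \<and> finite {m. f m \<noteq> \<zero>}}"
  by (auto simp: polynomial_semiring_def component_carrier)

lemma polynomials_graded: "graded_algebra S component (\<lambda>k j x y. x \<otimes> y) \<one> Poly"
proof -
  have splits: "{k. \<exists>j. k + j = l} = {k. k \<subseteq># l}" for l :: "nat multiset"
    by (auto simp: mset_subset_eq_exists_conv)
  have mult: "(f \<otimes>\<^bsub>Poly\<^esub> g) l = (\<Oplus>\<^bsub>component l\<^esub>k\<in>{k. \<exists>j. k + j = l}. f k \<otimes> g (l - k))"
    if "f \<in> carrier Poly" "g \<in> carrier Poly" for f g l
  proof -
    have c: "f k \<otimes> g (l - k) \<in> carrier (component l)" if "k \<subseteq># l" for k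
    proof -
      have "k + (l - k) = l"
        using that by simp
      then show ?thesis
        using component_mult[of "f k" k "g (l - k)" "l - k"] \<open>f \<in> carrier Poly\<close> \<open>g \<in> carrier Poly\<close>
        by (simp add: Poly_carrier)
    qed
    have "(\<Oplus>\<^bsub>component l\<^esub>k\<in>{k. k \<subseteq># l}. f k \<otimes> g (l - k)) = (\<Oplus>k\<in>{k. k \<subseteq># l}. f k \<otimes> g (l - k))"
      by (rule finsum_hom[OF component_monoid abelian_monoid_axioms, where h = "\<lambda>x. x"])
        (use c in \<open>simp_all add: component_carrier component_simps\<close>)
    then show ?thesis
      unfolding splits by (simp add: polynomial_semiring_def)
  qed
  interpret component: abelian_monoid "component l" for l
    by (rule component_monoid)
  show ?thesis
  proof
    show "finite {k. \<exists>j. k + j = l}" for l :: "nat multiset"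
      unfolding splits by (rule finite_submultisets)
    show "(f \<otimes>\<^bsub>Poly\<^esub> g) l = (\<Oplus>\<^bsub>component l\<^esub>k\<in>{k. \<exists>j. k + j = l}. f k \<otimes> g (l - k))"
      if "f \<in> carrier Poly" "g \<in> carrier Poly" for f g l
      using mult that .
    show "x \<otimes> y \<in> carrier (component (k + j))" if "x \<in> carrier (component k)" "y \<in> carrier (component j)" for x y k j
      using component_mult that .
    show "a \<odot>\<^bsub>component l\<^esub> x \<in> carrier (component l)" if "a \<in> carrier S" "x \<in> carrier (component l)" for a x l
      using that by (cases "x = \<zero>") (auto simp: component_carrier component_simps)
    show "carrier Poly = {f. (\<forall>l. f l \<in> carrier (component l)) \<and> finite {l. f l \<noteq> \<zero>\<^bsub>component l\<^esub>}}"
      by (simp add: Poly_carrier component_simps)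
  qed (auto simp: component_carrier component_simps l_distr r_distr m_ac polynomial_semiring_def)
qed

end

sublocale polynomials \<subseteq> P: graded_algebra S component "\<lambda>k j x y. x \<otimes> y" \<one> "polynomial_semiring S n"
  by (rule polynomials_graded)

sublocale polynomials \<subseteq> P: semialg S "polynomial_semiring S n"
  by unfold_locales (rule P.graded_semialgebra)

context polynomials
begin

abbreviation var where "var \<equiv> polynomial_var S"

lemma var_hom: "var i = P.hom {#i#} \<one>"
  by (auto simp: polynomial_var_def P.hom_def component_simps)

lemma var_closed: "i \<in> {1..n} \<Longrightarrow> var i \<in> carrier Poly"
  unfolding var_hom by (intro P.hom_closed) (simp add: component_carrier)

lemma var_comm: "i \<in> {1..n} \<Longrightarrow> j \<in> {1..n} \<Longrightarrow> var i \<otimes>\<^bsub>Poly\<^esub> var j = var j \<otimes>\<^bsub>Poly\<^esub> var i"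
  unfolding var_hom by (simp add: P.hom_mult component_carrier add_mset_commute)

lemma Poly_induct [consumes 1, case_names add mult smult one var]:
  assumes x: "x \<in> carrier Poly"
    and add: "\<And>x y. \<lbrakk>x \<in> carrier Poly; y \<in> carrier Poly; Q x; Q y\<rbrakk> \<Longrightarrow> Q (x \<oplus>\<^bsub>Poly\<^esub> y)"
    and mult: "\<And>x y. \<lbrakk>x \<in> carrier Poly; y \<in> carrier Poly; Q x; Q y\<rbrakk> \<Longrightarrow> Q (x \<otimes>\<^bsub>Poly\<^esub> y)"
    and smult: "\<And>b x. \<lbrakk>b \<in> carrier S; x \<in> carrier Poly; Q x\<rbrakk> \<Longrightarrow> Q (b \<odot>\<^bsub>Poly\<^esub> x)"
    and one: "Q \<one>\<^bsub>Poly\<^esub>"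
    and var: "\<And>i. i \<in> {1..n} \<Longrightarrow> Q (var i)"
  shows "Q x"
proof -
  have zero: "Q \<zero>\<^bsub>Poly\<^esub>"
    using smult[OF zero_closed _ one] by simp
  have hom: "Q (P.hom m s)" if "s \<in> carrier (component m)" for m s
    using that
  proof (induction m)
    case empty
    then have "P.hom {#} s = s \<odot>\<^bsub>Poly\<^esub> \<one>\<^bsub>Poly\<^esub>"
      by (simp add: P.A_one_hom P.hom_smult component_carrier component_simps)
    then show ?case
      using empty smult[OF _ _ one] by (simp add: component_carrier)
  next
    case (add i m)
    show ?case
    proof (cases "s = \<zero>")
      case True
      then show ?thesis
        using zero P.hom_zero[of "add_mset i m"] by (simp add: component_simps)
    next
      case False
      then have *: "s \<in> carrier (component m)" "i \<in> {1..n}" "s \<in> carrier S"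
        using add.prems by (auto simp: component_carrier)
      then have "P.hom m s \<otimes>\<^bsub>Poly\<^esub> var i = P.hom (add_mset i m) s"
        unfolding var_hom by (simp add: P.hom_mult component_carrier)
      then show ?thesis
        using mult[OF P.hom_closed[OF *(1)] var_closed[OF *(2)] add.IH[OF *(1)] var[OF *(2)]] by simp
    qed
  qed
  show ?thesis
    using x by (induction x rule: P.graded_induct) (use add hom in auto)
qed

end


section \<open>The idem over an idempotent semifield\<close>

locale semifield_exterior_case =
  fixes S :: "'s ring" (structure) and n :: nat
  assumes semifield: "idempotent_semifield S"

sublocale semifield_exterior_case \<subseteq> semiring S
  using semifield by (simp add: idempotent_semifield_def)

sublocale semifield_exterior_case \<subseteq> comm_monoid S
  using semifield by (simp add: idempotent_semifield_def)

sublocale semifield_exterior_case \<subseteq> polynomials S n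
  by unfold_locales

context semifield_exterior_case
begin

lemma idem: "x \<in> carrier S \<Longrightarrow> x \<oplus> x = x"
  using semifield r_distr[of \<one> \<one> x] by (simp add: idempotent_semifield_def)

text \<open>
  Idempotency passes from scalars to algebras, which therefore carry a natural order.
\<close>

lemma semialg_idem:
  assumes "semialgebra S A" "x \<in> carrier A"
  shows "x \<oplus>\<^bsub>A\<^esub> x = x"
proof -
  interpret A: semialg S A by unfold_locales fact
  show ?thesis
    using A.smult_l_distr[of \<one> \<one> x] assms(2) by (simp add: idem)
qed

text \<open>
  A defining relation expresses \<open>\<Sum>a\<^sub>i\<close> as \<open>b + t\<close>, hence \<open>b + \<Sum>a\<^sub>i = b + b + t = \<Sum>a\<^sub>i\<close>. The sum over
  all but one index exists since there is at least one index.
\<close>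

lemma semifield_rel_facts:
  assumes "(X, Y) \<in> semifield_mon_rels S"
  shows "X \<in> carrier (monoid_blue S \<zero>) \<and> Y \<in> carrier (monoid_blue S \<zero>) \<and>
      (msum S (\<lambda>x. x) X, msum S (\<lambda>x. x) Y) \<in> nat_order S"
proof -
  obtain b and m :: nat and a where m: "1 \<le> m" and b: "b \<in> carrier S"
    and a: "\<And>i. i \<in> {1..m} \<Longrightarrow> a i \<in> carrier S"
    and eq: "\<And>k. k \<in> {1..m} \<Longrightarrow> (\<Oplus>i\<in>{1..m}. a i) = b \<oplus> (\<Oplus>i\<in>{1..m} - {k}. a i)"
    and X: "X = formal \<zero> b" and Y: "Y = (\<Sum>i\<in>{1..m}. formal \<zero> (a i))"
    using assms unfolding semifield_mon_rels_def Pi_def by blast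
  let ?s = "\<Oplus>i\<in>{1..m}. a i" and ?t = "\<Oplus>i\<in>{1..m} - {1}. a i"
  have s: "?s \<in> carrier S" and t: "?t \<in> carrier S"
    using a by (auto intro!: finsum_closed)
  have "b \<oplus> ?s = b \<oplus> (b \<oplus> ?t)"
    using eq[of 1] m by simp
  also have "\<dots> = ?s"
    using eq[of 1] m b t idem by (simp add: a_assoc[symmetric])
  finally have "(b, ?s) \<in> nat_order S"
    using b s by (simp add: nat_order_def)
  moreover have "msum S (\<lambda>x. x) X = b"
    using b by (simp add: X formal_def)
  ultimately show ?thesis
    using b sum_formal_closed[of "{1..m}" a] msum_sum_formal[of "{1..m}" a] a
    by (simp add: X Y monoid_blue_def formal_def)
qed

lemma semifield_relI:
  assumes "b \<in> carrier S" "k \<in> carrier S" "l \<in> carrier S" "k \<oplus> l = b \<oplus> l" "k \<oplus> l = b \<oplus> k"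
  shows "(formal \<zero> b, formal \<zero> k + formal \<zero> l) \<in> semifield_mon_rels S"
proof -
  let ?a = "\<lambda>i :: nat. if i = 1 then k else l"
  have sum: "(\<Oplus>i\<in>{1..2}. ?a i) = k \<oplus> l"
    using finsum_two[of ?a] assms by simp
  have D: "{1..2::nat} - {1} = {2}" "{1..2::nat} - {2} = {1}"
    by auto
  have "(\<Oplus>i\<in>{1..2}. ?a i) = b \<oplus> (\<Oplus>i\<in>{1..2} - {j}. ?a i)" if "j \<in> {1..2}" for j
  proof (cases "j = 1")
    case True
    then show ?thesis
      unfolding sum True D using assms by (simp add: finsum_insert)
  next
    case False
    then have j: "j = 2"
      using that by auto
    show ?thesis
      unfolding sum j D using assms by (simp add: finsum_insert)
  qed
  then have "(formal \<zero> b, \<Sum>i\<in>{1..2}. formal \<zero> (?a i)) \<in> semifield_mon_rels S"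
    unfolding semifield_mon_rels_def using assms
    by (intro CollectI exI[of _ b] exI[of _ "2 :: nat"] exI[of _ ?a]) simp
  then show ?thesis
    unfolding sum_two by simp
qed

end

sublocale semifield_exterior_case \<subseteq> mb: monomial_blueprint S "semifield_mon_rels S" "nat_order S" "semifield_mon S"
proof
  show "semifield_mon_rels S \<subseteq> carrier (monoid_blue S \<zero>) \<times> carrier (monoid_blue S \<zero>)"
    using semifield_rel_facts by auto
  show "(msum S (\<lambda>x. x) X, msum S (\<lambda>x. x) Y) \<in> nat_order S" if "(X, Y) \<in> semifield_mon_rels S" for X Y
    using semifield_rel_facts[OF that] by blast
qed (use nat_order_compat[OF semiring_axioms idem] in \<open>simp_all add: semifield_mon_def oblueprint.defs f1pm_algebra.defs\<close>)

context semifield_exterior_case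
begin

abbreviation B where "B \<equiv> semifield_mon S"

lemma B_eps: "eps B = mb.elt \<one>"
  by (simp add: semifield_mon_def oblueprint.defs f1pm_algebra.defs mb.elt_def)

lemma elt_add_ble: "k \<in> carrier S \<Longrightarrow> l \<in> carrier S \<Longrightarrow> (mb.elt (k \<oplus> l), mb.elt k \<oplus>\<^bsub>B\<^esub> mb.elt l) \<in> ble B"
proof (rule mb.ble_two_terms)
  assume kl: "k \<in> carrier S" "l \<in> carrier S"
  have "k \<oplus> l = (k \<oplus> l) \<oplus> l"
    using kl idem[of l] by (simp add: a_assoc)
  moreover have "k \<oplus> l = (k \<oplus> l) \<oplus> k"
    using kl idem[of k] by (metis a_assoc a_comm)
  ultimately show "(formal \<zero> (k \<oplus> l), formal \<zero> k + formal \<zero> l) \<in> semifield_mon_rels S"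
    using kl by (intro semifield_relI) auto
qed auto

text \<open>
  If \<open>k \<le> l\<close> in the natural order, then \<open>1.k \<le> 1.l + 1.l\<close>, since both sums \<open>l + l\<close> and
  \<open>k + l\<close> equal \<open>l\<close>. In the idem this becomes \<open>1.k \<le> 1.l\<close>, which yields the inequality
  \<open>1.k + 1.l \<le> 1.(k + l)\<close> opposite to the one in \<open>S\<^sup>m\<^sup>o\<^sup>n\<close>.
\<close>

lemma elt_le_double: "(k, l) \<in> nat_order S \<Longrightarrow> (mb.elt k, mb.elt l \<oplus>\<^bsub>B\<^esub> mb.elt l) \<in> ble B"
  by (rule mb.ble_two_terms; (rule semifield_relI)?) (auto simp: nat_order_def idem)

end

sublocale semifield_exterior_case \<subseteq> x: exterior_algebra "semifield_mon S" n
  by (intro exterior_algebra.intro tensor_powers.intro mb.B_ordered, unfold_locales)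
    (simp add: B_eps mb.elt_closed)

sublocale semifield_exterior_case \<subseteq> h: exterior_quotient S "semifield_mon_rels S" "nat_order S" "semifield_mon S" n
    \<one> "{(\<one>\<^bsub>semifield_mon S\<^esub>, \<one>\<^bsub>semifield_mon S\<^esub> \<oplus>\<^bsub>semifield_mon S\<^esub> \<one>\<^bsub>semifield_mon S\<^esub>),
      (\<one>\<^bsub>semifield_mon S\<^esub> \<oplus>\<^bsub>semifield_mon S\<^esub> \<one>\<^bsub>semifield_mon S\<^esub>, \<one>\<^bsub>semifield_mon S\<^esub>)}"
    "(\<lambda>m. (m, m \<oplus>\<^bsub>exterior (semifield_mon S) n\<^esub> m)) ` carrier (exterior (semifield_mon S) n) \<union>
     (\<lambda>m. (m \<oplus>\<^bsub>exterior (semifield_mon S) n\<^esub> m, m)) ` carrier (exterior (semifield_mon S) n)"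
proof
  let ?Hm = "(\<lambda>m. (m, m \<oplus>\<^bsub>x.E\<^esub> m)) ` carrier x.E \<union> (\<lambda>m. (m \<oplus>\<^bsub>x.E\<^esub> m, m)) ` carrier x.E"
  let ?Hb = "{(\<one>\<^bsub>B\<^esub>, \<one>\<^bsub>B\<^esub> \<oplus>\<^bsub>B\<^esub> \<one>\<^bsub>B\<^esub>), (\<one>\<^bsub>B\<^esub> \<oplus>\<^bsub>B\<^esub> \<one>\<^bsub>B\<^esub>, \<one>\<^bsub>B\<^esub>)}"
  have bc: "ble B \<subseteq> carrier B \<times> carrier B"
    using preorder_on_carrier[OF x.ble_preorder] by auto
  show Hb: "?Hb \<subseteq> carrier B \<times> carrier B"
    by auto
  show "?Hm \<subseteq> carrier x.E \<times> carrier x.E"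
    by auto
  show "mult_compat x.E ?Hm"
    by (rule mult_compatI) (auto simp: x.E.A.l_distr x.E.A.r_distr)
  show "(a \<odot>\<^bsub>x.E\<^esub> x, b \<odot>\<^bsub>x.E\<^esub> x) \<in> gen_additive_preorder B x.E ?Hm"
    if "(a, b) \<in> ?Hb" "x \<in> carrier x.E" for a b x
    using that by (auto simp: gen_additive_preorder_def x.E.smult_l_distr)
  let ?\<beta> = "gen_ring_preorder B (ble B) ?Hb"
  note \<beta> = gen_ring_preorder_preorder[OF x.semiring_axioms bc Hb] gen_ring_preorder_add[OF x.semiring_axioms bc Hb]
    gen_ring_preorder_mult[OF x.semiring_axioms bc Hb] gen_ring_preorder_order[OF x.semiring_axioms bc Hb]
    gen_ring_preorder_rels[OF x.semiring_axioms bc Hb]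
  fix k l assume kl: "k \<in> carrier S" "l \<in> carrier S"
  show "(mb.elt (k \<oplus> l), mb.elt k \<oplus>\<^bsub>B\<^esub> mb.elt l) \<in> ?\<beta>"
    using elt_add_ble[OF kl] \<beta>(4) by blast
  let ?d = "mb.elt (k \<oplus> l)"
  have d: "?d \<in> carrier B"
    using kl by (simp add: mb.elt_closed)
  \<comment> \<open>Here \<open>1 + 1 = 1\<close> is used in the quotient of the scalars.\<close>
  have double: "(?d \<oplus>\<^bsub>B\<^esub> ?d, ?d) \<in> ?\<beta>"
    using mult_compatD(1)[OF \<beta>(3) subsetD[OF \<beta>(5)] d, of "\<one>\<^bsub>B\<^esub> \<oplus>\<^bsub>B\<^esub> \<one>\<^bsub>B\<^esub>" "\<one>\<^bsub>B\<^esub>"] d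
    by (simp add: x.l_distr)
  have le: "(k, k \<oplus> l) \<in> nat_order S" "(l, k \<oplus> l) \<in> nat_order S"
    using kl idem[of k] idem[of l] by (auto simp: nat_order_def a_assoc[symmetric]) (metis a_assoc a_comm)
  have "(mb.elt k, ?d) \<in> ?\<beta>" "(mb.elt l, ?d) \<in> ?\<beta>"
    using preorder_on_trans[OF \<beta>(1) _ double] elt_le_double[OF le(1)] elt_le_double[OF le(2)] \<beta>(4) by blast+
  then have "(mb.elt k \<oplus>\<^bsub>B\<^esub> mb.elt l, ?d \<oplus>\<^bsub>B\<^esub> ?d) \<in> ?\<beta>"
    by (rule add_compat2[OF x.abelian_monoid_axioms \<beta>(1,2)])
  then show "(mb.elt k \<oplus>\<^bsub>B\<^esub> mb.elt l, ?d) \<in> ?\<beta>"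
    using double by (rule preorder_on_trans[OF \<beta>(1)])
qed (simp_all add: B_eps)

context semifield_exterior_case
begin

lemma idem_algebra_eq: "exterior_idem_algebra S n = h.W"
  by (simp add: exterior_idem_algebra_def h.W_def h.\<beta>_def h.\<rho>_def idem_rel_def module_idem_def
      module_idem_rel_def mb.elt_def Let_def)

lemma idem_gen_eq: "exterior_idem_gen S n i = h.q (x.e i)"
  by (simp add: exterior_idem_gen_def h.q_def h.\<rho>_def module_idem_rel_def exterior_gen_def Let_def)

subsection \<open>The Giansiracusa exterior algebra\<close>

abbreviation X where "X \<equiv> giansiracusa_exterior S n"
abbreviation gc where "gc \<equiv> giansiracusa_cong S n"
abbreviation p where "p \<equiv> cls gc"

abbreviation squares where "squares \<equiv> {(var i \<otimes>\<^bsub>Poly\<^esub> var i, \<zero>\<^bsub>Poly\<^esub>) | i. i \<in> {1..n}}"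

lemma squares_carrier: "squares \<subseteq> carrier Poly \<times> carrier Poly"
  using var_closed by auto

lemma gc_gen: "gc = gen_ring_congruence Poly squares"
  by (simp add: giansiracusa_cong_def Let_def)

lemmas gc_facts =
  gen_ring_congruence_preorder[OF P.A.semiring_axioms squares_carrier, folded gc_gen]
  gen_ring_congruence_add[OF P.A.semiring_axioms squares_carrier, folded gc_gen]
  gen_ring_congruence_mult[OF P.A.semiring_axioms squares_carrier, folded gc_gen]
  gen_ring_congruence_rels[OF P.A.semiring_axioms squares_carrier, folded gc_gen]
  gen_ring_congruence_sym[OF P.A.semiring_axioms squares_carrier, folded gc_gen]

lemmas X_defs = giansiracusa_exterior_def module_quot_def ring_quot_def ring.defs module.defs

lemma X_fields: "carrier X = p ` carrier Poly" "\<zero>\<^bsub>X\<^esub> = p \<zero>\<^bsub>Poly\<^esub>" "\<one>\<^bsub>X\<^esub> = p \<one>\<^bsub>Poly\<^esub>"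
  by (simp_all add: X_defs)

lemma X_add: "x \<in> carrier Poly \<Longrightarrow> y \<in> carrier Poly \<Longrightarrow> p x \<oplus>\<^bsub>X\<^esub> p y = p (x \<oplus>\<^bsub>Poly\<^esub> y)"
  using lift2_cls[OF gc_facts(1), of x y "add Poly"] add_compat2[OF P.A.abelian_monoid_axioms gc_facts(1,2)]
  by (simp add: X_defs)

lemma X_mult: "x \<in> carrier Poly \<Longrightarrow> y \<in> carrier Poly \<Longrightarrow> p x \<otimes>\<^bsub>X\<^esub> p y = p (x \<otimes>\<^bsub>Poly\<^esub> y)"
  using lift2_cls[OF gc_facts(1), of x y "mult Poly"] mult_compat2[OF gc_facts(1,3)]
  by (simp add: X_defs)

lemma X_smult: "k \<in> carrier S \<Longrightarrow> x \<in> carrier Poly \<Longrightarrow> k \<odot>\<^bsub>X\<^esub> p x = p (k \<odot>\<^bsub>Poly\<^esub> x)"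
  using lift1_cls[OF gc_facts(1), of x "smult Poly k"] P.smult_compat[OF gc_facts(3,1)]
  by (simp add: X_defs)

lemma X_semialgebra: "semialgebra S X"
  by (rule semialgebra_image[OF P.semialgebra semiring_axioms comm_monoid_axioms X_fields(1), where \<iota> = "\<lambda>k. k"])
    (simp_all add: X_fields X_add X_mult X_smult)

end

sublocale semifield_exterior_case \<subseteq> X: semialg S "giansiracusa_exterior S n"
  by unfold_locales (rule X_semialgebra)

context semifield_exterior_case
begin

lemma X_square: "i \<in> {1..n} \<Longrightarrow> p (var i) \<otimes>\<^bsub>X\<^esub> p (var i) = \<zero>\<^bsub>X\<^esub>"
proof -
  assume i: "i \<in> {1..n}"
  then have "(var i \<otimes>\<^bsub>Poly\<^esub> var i, \<zero>\<^bsub>Poly\<^esub>) \<in> gc"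
    using gc_facts(4) by blast
  then have "p (var i \<otimes>\<^bsub>Poly\<^esub> var i) = p \<zero>\<^bsub>Poly\<^esub>"
    using symD[OF gc_facts(5)] by (intro cls_eqI[OF gc_facts(1)])
  then show ?thesis
    using var_closed[OF i] by (simp add: X_mult X_fields)
qed

subsection \<open>The map from the Giansiracusa exterior algebra\<close>

text \<open>
  Here \<open>\<epsilon> = 1\<close>, so the generators commute. The elements commuting with a given one form a
  subalgebra; this is applied to each generator and then to an arbitrary element.
\<close>

lemma W_commute: "x \<in> carrier h.W \<Longrightarrow> y \<in> carrier h.W \<Longrightarrow> x \<otimes>\<^bsub>h.W\<^esub> y = y \<otimes>\<^bsub>h.W\<^esub> x"
proof -
  have e: "h.q (x.e i) \<in> carrier h.W" for i
    by (simp add: h.q_closed x.e_closed)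
  have step: "x \<otimes>\<^bsub>h.W\<^esub> c = c \<otimes>\<^bsub>h.W\<^esub> x"
    if c: "c \<in> carrier h.W" and gen: "\<And>i. i \<in> {1..n} \<Longrightarrow> h.q (x.e i) \<otimes>\<^bsub>h.W\<^esub> c = c \<otimes>\<^bsub>h.W\<^esub> h.q (x.e i)"
      and x: "x \<in> carrier h.W" for c x
    using x
  proof (induction x rule: h.W_induct)
    case (mult x y)
    have "x \<otimes>\<^bsub>h.W\<^esub> y \<otimes>\<^bsub>h.W\<^esub> c = x \<otimes>\<^bsub>h.W\<^esub> (c \<otimes>\<^bsub>h.W\<^esub> y)"
      using mult c by (simp add: h.W.A.m_assoc)
    also have "\<dots> = c \<otimes>\<^bsub>h.W\<^esub> (x \<otimes>\<^bsub>h.W\<^esub> y)"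
      using mult c by (simp flip: h.W.A.m_assoc)
    finally show ?case .
  next
    case (add x y)
    then show ?case
      using c by (simp only: h.W.A.l_distr h.W.A.r_distr)
  next
    case (smult k x)
    then show ?case
      using c by (simp only: h.W.smult_mult_l h.W.smult_mult_r)
  next
    case one
    show ?case
      using c by simp
  next
    case (basis i)
    then show ?case
      by (rule gen)
  qed
  have gens: "h.q (x.e i) \<otimes>\<^bsub>h.W\<^esub> h.q (x.e j) = h.q (x.e j) \<otimes>\<^bsub>h.W\<^esub> h.q (x.e i)" if "i \<in> {1..n}" "j \<in> {1..n}" for i j
    using h.W_anticommute[OF that] e by (cases "i = j") auto
  have "x \<otimes>\<^bsub>h.W\<^esub> h.q (x.e i) = h.q (x.e i) \<otimes>\<^bsub>h.W\<^esub> x" if "i \<in> {1..n}" "x \<in> carrier h.W" for i x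
    by (rule step[OF e _ that(2)]) (use gens that in auto)
  then show "x \<in> carrier h.W \<Longrightarrow> y \<in> carrier h.W \<Longrightarrow> x \<otimes>\<^bsub>h.W\<^esub> y = y \<otimes>\<^bsub>h.W\<^esub> x"
    using step[of y x] by simp
qed

end

sublocale semifield_exterior_case \<subseteq> Wc: comm_monoid h.W
  by unfold_locales (rule W_commute)

context semifield_exterior_case
begin

definition monomial :: "nat multiset \<Rightarrow> (nat \<Rightarrow> 's multiset set tensor) set set"
  where "monomial m = (\<Otimes>\<^bsub>h.W\<^esub>i\<in>{1..n}. h.q (x.e i) [^]\<^bsub>h.W\<^esub> count m i)"

lemma gen_closed: "h.q (x.e i) \<in> carrier h.W"
  by (simp add: h.q_closed x.e_closed)

lemma monomial_closed: "monomial m \<in> carrier h.W"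
  unfolding monomial_def by (rule Wc.finprod_closed) (simp add: gen_closed)

lemma monomial_add: "monomial (k + j) = monomial k \<otimes>\<^bsub>h.W\<^esub> monomial j"
proof -
  have "monomial (k + j) = (\<Otimes>\<^bsub>h.W\<^esub>i\<in>{1..n}. h.q (x.e i) [^]\<^bsub>h.W\<^esub> count k i \<otimes>\<^bsub>h.W\<^esub> h.q (x.e i) [^]\<^bsub>h.W\<^esub> count j i)"
    unfolding monomial_def by (rule Wc.finprod_cong') (simp_all add: gen_closed h.W.A.nat_pow_mult)
  also have "\<dots> = monomial k \<otimes>\<^bsub>h.W\<^esub> monomial j"
    unfolding monomial_def by (rule Wc.finprod_multf) (simp_all add: gen_closed)
  finally show ?thesis .
qed

lemma monomial_empty: "monomial {#} = \<one>\<^bsub>h.W\<^esub>"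
  by (simp add: monomial_def)

lemma monomial_single:
  assumes "i \<in> {1..n}"
  shows "monomial {#i#} = h.q (x.e i)"
proof -
  have "monomial {#i#} = (\<Otimes>\<^bsub>h.W\<^esub>j\<in>{1..n}. if i = j then h.q (x.e j) else \<one>\<^bsub>h.W\<^esub>)"
    unfolding monomial_def by (rule Wc.finprod_cong') (auto simp: gen_closed)
  also have "\<dots> = h.q (x.e i)"
    by (rule Wc.finprod_singleton) (use assms gen_closed in auto)
  finally show ?thesis .
qed

end

sublocale semifield_exterior_case \<subseteq> t: graded_hom S component "\<lambda>k j x y. x \<otimes> y" \<one> "polynomial_semiring S n" h.W
    "\<lambda>m s. s \<odot>\<^bsub>h.W\<^esub> monomial m"
proof
  note m = monomial_closed
  fix x y a k j
  assume x: "x \<in> carrier (component k)"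
  then have xS: "x \<in> carrier S"
    by (simp add: component_carrier)
  show "x \<odot>\<^bsub>h.W\<^esub> monomial k \<in> carrier h.W"
    using xS m by simp
  show "(a \<odot>\<^bsub>component k\<^esub> x) \<odot>\<^bsub>h.W\<^esub> monomial k = a \<odot>\<^bsub>h.W\<^esub> (x \<odot>\<^bsub>h.W\<^esub> monomial k)" if "a \<in> carrier S"
    using xS that m by (simp add: component_simps h.W.smult_assoc)
  show "(x \<oplus>\<^bsub>component k\<^esub> y) \<odot>\<^bsub>h.W\<^esub> monomial k = x \<odot>\<^bsub>h.W\<^esub> monomial k \<oplus>\<^bsub>h.W\<^esub> y \<odot>\<^bsub>h.W\<^esub> monomial k"
    if "y \<in> carrier (component k)"
    using xS that m by (simp add: component_simps component_carrier h.W.smult_l_distr)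
  show "(x \<otimes> y) \<odot>\<^bsub>h.W\<^esub> monomial (k + j) = (x \<odot>\<^bsub>h.W\<^esub> monomial k) \<otimes>\<^bsub>h.W\<^esub> (y \<odot>\<^bsub>h.W\<^esub> monomial j)"
    if "y \<in> carrier (component j)"
  proof -
    have yS: "y \<in> carrier S"
      using that by (simp add: component_carrier)
    show ?thesis
      using h.W.smult_mult_l[OF xS m[of k] h.W.smult_closed[OF yS m[of j]]] h.W.smult_mult_r[OF yS m[of k] m[of j]]
      by (simp add: monomial_add h.W.smult_assoc xS yS m)
  qed
qed (simp_all add: component_simps monomial_closed monomial_empty)

context semifield_exterior_case
begin

lemma ext_var: "i \<in> {1..n} \<Longrightarrow> t.ext (var i) = h.q (x.e i)"
  unfolding var_hom by (simp add: t.ext_hom component_carrier monomial_single gen_closed)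

lemma ext_cong: "(x, y) \<in> gc \<Longrightarrow> t.ext x = t.ext y"
proof -
  define r where "r = {(x, y). x \<in> carrier Poly \<and> y \<in> carrier Poly \<and> t.ext x = t.ext y}"
  have "gc \<subseteq> r"
    unfolding gc_gen
  proof (rule gen_ring_congruence_least)
    show "equiv (carrier Poly) r"
      by (rule equivI) (auto simp: r_def refl_on_def sym_def trans_def)
    show "add_compat Poly r"
      by (rule add_compatI) (auto simp: r_def t.ext_add)
    show "mult_compat Poly r"
      by (rule mult_compatI) (auto simp: r_def t.ext_mult)
    show "squares \<subseteq> r"
      by (auto simp: r_def var_closed t.ext_mult ext_var t.ext_zero h.W_square)
  qed
  then show "(x, y) \<in> gc \<Longrightarrow> t.ext x = t.ext y"
    by (auto simp: r_def)
qed

definition f where "f Y = t.ext (inv_into (carrier Poly) p Y)"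

lemma f_p:
  assumes x: "x \<in> carrier Poly"
  shows "f (p x) = t.ext x"
  unfolding f_def
proof (rule factor_through_image[where q = p and k = t.ext, OF x])
  fix y assume "y \<in> carrier Poly" "p y = p x"
  then show "t.ext y = t.ext x"
    using cls_eq_iff[OF gc_facts(1), of y x] ext_cong by blast
qed

lemma f_hom: "algebra_hom S X h.W f"
  unfolding algebra_hom_def
  by (auto simp: X_fields X_add X_mult X_smult f_p t.ext_closed t.ext_add t.ext_mult t.ext_zero t.ext_one t.ext_smult)

lemma f_var: "i \<in> {1..n} \<Longrightarrow> f (p (var i)) = h.q (x.e i)"
  by (simp add: f_p var_closed ext_var)

text \<open>
  As in the case of a ring, the two maps are inverse to each other on generators.
\<close>

theorem semifield_case:
  "\<exists>\<phi>\<in>algebra_iso S X (exterior_idem_algebra S n). \<forall>i\<in>{1..n}. \<phi> (giansiracusa_gen S n i) = exterior_idem_gen S n i"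
proof -
  note X_idem = semialg_idem[OF X_semialgebra]
  \<comment> \<open>The target is ordered naturally, and then \<open>m = m + m\<close> holds in it.\<close>
  note nat = nat_order_compat[OF X.A.semiring_axioms X_idem]
  obtain g where g: "algebra_hom S h.W X g" and g_var: "\<And>i. i \<in> {1..n} \<Longrightarrow> g (h.q (x.e i)) = p (var i)"
  proof (rule h.W_universal[OF X_semialgebra nat, of "\<lambda>i. p (var i)"])
    show "(k \<odot>\<^bsub>X\<^esub> x, l \<odot>\<^bsub>X\<^esub> x) \<in> nat_order X" if "(k, l) \<in> nat_order S" "x \<in> carrier X" for k l x
      using that X.smult_l_distr[of k l x] by (auto simp: nat_order_def)
    show "p (var i) \<in> carrier X" if "i \<in> {1..n}" for i
      using var_closed[OF that] by (simp add: X_fields)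
    show "p (var i) \<otimes>\<^bsub>X\<^esub> p (var i) = \<zero>\<^bsub>X\<^esub>" if "i \<in> {1..n}" for i
      by (rule X_square[OF that])
    show "p (var i) \<otimes>\<^bsub>X\<^esub> p (var j) = \<one> \<odot>\<^bsub>X\<^esub> (p (var j) \<otimes>\<^bsub>X\<^esub> p (var i))" if "i \<in> {1..n}" "j \<in> {1..n}" for i j
      using var_closed[OF that(1)] var_closed[OF that(2)] var_comm[OF that]
      by (simp add: X_mult X_smult)
    show "(h x, h y) \<in> nat_order X"
      if closed: "\<And>x. x \<in> carrier x.E \<Longrightarrow> h x \<in> carrier X"
        and add: "\<And>x y. \<lbrakk>x \<in> carrier x.E; y \<in> carrier x.E\<rbrakk> \<Longrightarrow> h (x \<oplus>\<^bsub>x.E\<^esub> y) = h x \<oplus>\<^bsub>X\<^esub> h y"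
        and xy: "(x, y) \<in> (\<lambda>m. (m, m \<oplus>\<^bsub>x.E\<^esub> m)) ` carrier x.E \<union> (\<lambda>m. (m \<oplus>\<^bsub>x.E\<^esub> m, m)) ` carrier x.E" for h x y
    proof -
      obtain m where m: "m \<in> carrier x.E" "(x, y) = (m, m \<oplus>\<^bsub>x.E\<^esub> m) \<or> (x, y) = (m \<oplus>\<^bsub>x.E\<^esub> m, m)"
        using xy by blast
      have "h x = h m" "h y = h m"
        using m(2) add[OF m(1) m(1)] X_idem[OF closed[OF m(1)]] by auto
      then show ?thesis
        using closed[OF m(1)] X_idem[OF closed[OF m(1)]] by (simp add: nat_order_def)
    qed
  qed auto
  have "g (t.ext x) = p x" if "x \<in> carrier Poly" for x
    using that
  proof (induction x rule: Poly_induct)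
    case (add x y)
    then show ?case
      using t.ext_closed[OF add(1)] t.ext_closed[OF add(2)]
      by (simp only: t.ext_add algebra_homD(2)[OF g] X_add)
  next
    case (mult x y)
    then show ?case
      using t.ext_closed[OF mult(1)] t.ext_closed[OF mult(2)]
      by (simp only: t.ext_mult algebra_homD(3)[OF g] X_mult)
  next
    case (smult k x)
    then show ?case
      using t.ext_closed[OF smult(2)]
      by (simp only: t.ext_smult algebra_homD(4)[OF g] X_smult)
  next
    case one
    show ?case
      by (simp only: t.ext_one algebra_homD(6)[OF g] X_fields)
  next
    case (var i)
    then show ?case
      by (simp only: ext_var g_var)
  qed
  then have gf: "g (f y) = y" if "y \<in> carrier X" for y
    using that by (auto simp: X_fields f_p)
  have fg: "f (g w) = w" if "w \<in> carrier h.W" for w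
    by (rule h.W_hom_eq[OF algebra_hom_comp[OF g f_hom] _ that]) (simp add: g_var f_var)
  have "f \<in> algebra_iso S X h.W"
    by (rule algebra_iso_of_inverse_homs[OF X_semialgebra h.W_semialgebra f_hom g gf fg])
  moreover have "f (giansiracusa_gen S n i) = exterior_idem_gen S n i" if "i \<in> {1..n}" for i
    using f_var[OF that] unfolding idem_gen_eq giansiracusa_gen_def .
  ultimately show ?thesis
    unfolding idem_algebra_eq by blast
qed

end

theorem theoremB:
  fixes R :: "'r ring" and S :: "'s ring" and n :: nat
  shows "(cring R \<longrightarrow>
            (\<exists>\<phi> \<in> algebra_iso R (ring_exterior R n) (exterior_hull_algebra R n).
              \<forall>i\<in>{1..n}. \<phi> (ring_exterior_gen R n i) = exterior_hull_gen R n i))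
       \<and> (idempotent_semifield S \<longrightarrow>
            (\<exists>\<phi> \<in> algebra_iso S (giansiracusa_exterior S n) (exterior_idem_algebra S n).
              \<forall>i\<in>{1..n}. \<phi> (giansiracusa_gen S n i) = exterior_idem_gen S n i))"
proof (intro conjI impI)
  assume "cring R"
  then interpret ring_exterior_case R n
    by (rule ring_exterior_case.intro)
  show "\<exists>\<phi> \<in> algebra_iso R (ring_exterior R n) (exterior_hull_algebra R n).
      \<forall>i\<in>{1..n}. \<phi> (ring_exterior_gen R n i) = exterior_hull_gen R n i"
    by (rule ring_case)
next
  assume "idempotent_semifield S"
  then interpret semifield_exterior_case S n
    by (rule semifield_exterior_case.intro)
  show "\<exists>\<phi> \<in> algebra_iso S (giansiracusa_exterior S n) (exterior_idem_algebra S n).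
      \<forall>i\<in>{1..n}. \<phi> (giansiracusa_gen S n i) = exterior_idem_gen S n i"
    by (rule semifield_case)
qed

end
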